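(* Let $a,d\in\mathbb{Z}$ with $ad\neq 0$, and let $f(x)=x^4+ax^3+d$. Then $f(x)$ is monogenic with $\mathrm{Gal}(f)\simeq A_4$ if and only if there exists an integer $k\neq 0$ such that $a=4k$, $d=27k^4+1$, and $d$ is squarefree.
   Context: A monic polynomial $f(x)\in\mathbb{Z}[x]$ of degree 4 is called monogenic if $f(x)$ is irreducible over $\mathbb{Q}$ and, for $\theta$ with $f(\theta)=0$ and $K=\mathbb{Q}(\theta)$, the set $\{1,\theta,\theta^2,\theta^3\}$ is a $\mathbb{Z}$-basis of the ring of integers $\mathbb{Z}_K$ of $K$ (equivalently, $\mathbb{Z}_K=\mathbb{Z}[\theta]$). $\mathrm{Gal}(f)$ is the Galois group of $f$ over $\mathbb{Q}$, i.e. the Galois group over $\mathbb{Q}$ of the splitting field of $f$. $A_4$ is the alternating group of order 12. *)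

theory Defs
  imports
    "HOL-Computational_Algebra.Computational_Algebra"
    "HOL-Algebra.Algebra"
    "HOL-Algebra.Algebraic_Closure_Type"
begin

text \<open>Number fields are realised as subfields of \<open>\<complex>\<close>.\<close>

abbreviation complex_ring :: "complex ring" where
  "complex_ring \<equiv> ring_of_type_algebra"

definition subfield_ring :: "complex set \<Rightarrow> complex ring" where
  "subfield_ring L = complex_ring\<lparr>carrier := L\<rparr>"

definition adjoin :: "complex set \<Rightarrow> complex set" where
  "adjoin A = generate_field complex_ring (\<rat> \<union> A)"

definition complex_roots :: "int poly \<Rightarrow> complex set" where
  "complex_roots f = {z. poly (map_poly of_int f) z = 0}"

definition splitting_field :: "int poly \<Rightarrow> complex set" where
  "splitting_field f = adjoin (complex_roots f)"

text \<open>The multiplication of \<open>BijGroup L\<close> is composition of maps, and its elements are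
  \<open>undefined\<close> outside \<open>L\<close>, so that each automorphism of \<open>L\<close> is counted only once.\<close>

definition galois_group :: "complex set \<Rightarrow> complex set \<Rightarrow> (complex \<Rightarrow> complex) monoid" where
  "galois_group L F = (BijGroup L)
     \<lparr>carrier := {\<sigma> \<in> Bij L. \<sigma> \<in> ring_iso (subfield_ring L) (subfield_ring L) \<and>
                            (\<forall>x\<in>F. \<sigma> x = x)}\<rparr>"

definition Gal :: "int poly \<Rightarrow> (complex \<Rightarrow> complex) monoid" where
  "Gal f = galois_group (splitting_field f) \<rat>"

definition ring_of_integers :: "complex set \<Rightarrow> complex set" where
  "ring_of_integers K = {x \<in> K. algebraic_int x}"

interpretation int_module: Modules.module "\<lambda>(n::int) (x::complex). of_int n * x"
  by standard (simp_all add: algebra_simps)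

definition integral_basis :: "complex set \<Rightarrow> complex set \<Rightarrow> bool" where
  "integral_basis B M \<longleftrightarrow> int_module.independent B \<and> int_module.span B = M"

definition monogenic :: "int poly \<Rightarrow> bool" where
  "monogenic f \<longleftrightarrow>
     Polynomial.lead_coeff f = 1 \<and>
     Factorial_Ring.irreducible (map_poly of_int f :: rat poly) \<and>
     (\<forall>\<theta> \<in> complex_roots f.
        integral_basis {\<theta> ^ i | i. i < Polynomial.degree f} (ring_of_integers (adjoin {\<theta>})))"

end

theory Submission
  imports Defs "Jordan_Normal_Form.Char_Poly"
begin

text \<open>
  Let \<open>f = x\<^sup>4 + a x\<^sup>3 + d\<close>, of discriminant \<open>d\<^sup>2 (256 d - 27 a\<^sup>4)\<close>. If the Galois group is \<open>A\<^sub>4\<close>, which has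
  no subgroup of index 2, then the discriminant is a square, so \<open>256 d - 27 a\<^sup>4 = s\<^sup>2\<close>. If \<open>f\<close> is
  monogenic, no \<open>m > 1\<close> satisfies \<open>m\<^sup>2 | f(r)\<close> and \<open>m | f'(r)\<close> for an integer \<open>r\<close>: with
  \<open>f = (X - r) W + f(r)\<close>, the element \<open>W(t) / m\<close> would be integral. Taking \<open>r = 0\<close>, \<open>r = - 3 a / 4\<close> modulo
  \<open>m\<^sup>2\<close>, and \<open>r = - 1\<close> shows that \<open>d\<close> is squarefree, that \<open>s\<close> is a power of 2, and that
  this power is 16.

  Conversely, let \<open>a = 4 k\<close> and \<open>d = 27 k\<^sup>4 + 1\<close> be squarefree, which forces \<open>k\<close> to be even. Then \<open>f(x - 1)\<close> is
  Eisenstein at 2, the discriminant is \<open>(16 d)\<^sup>2\<close>, and the resolvent cubic has no rational root, so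
  the Galois group embeds into \<open>A\<^sub>4\<close> and has order divisible by 4 and 3. For a root \<open>t\<close>, the
  different \<open>f'(t) = 4 t\<^sup>2 (t + 3 k)\<close> is \<open>4 t\<^sup>2\<close> times a unit, so \<open>4 t\<^sup>2 x\<close> lies in \<open>\<int>[t]\<close> for every
  algebraic integer \<open>x\<close> of the field; norms of elements of \<open>\<int>[t]\<close> allow one to cancel 2, 2, \<open>t\<close> and \<open>t\<close>.
\<close>


section \<open>Algebraic integers\<close>

text \<open>Modulo an odd prime a double root of f is 0 or -3a/4, because f' = x^2 (4x + 3a);
  moreover 256 f(-3a/4) = 256 d - 27 a^4. Modulo 2, once a is even, f' vanishes identically, which
  is why -1 is a third point to test. For s = 16 the equation 256 d = 27 a^4 + 256 with a = 4k
  becomes d = 27 k^4 + 1, and then f(-3k) = 1: this makes t + 3k a unit and leaves only 2 and t to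
  be cancelled. Both are handled by norms: t has the squarefree norm d, while t + 1 has norm f(-1),
  twice an odd number, and its fourth power is 2 times an integral element. If an integer n makes
  n/t or n (t + 1)^3 / 2 integral, taking norms gives d | n or 2 | n, and this controls the
  coordinates of an integral element. On the Galois side, automorphisms come from extending
  embeddings of subfields of the complex numbers one generator at a time.\<close>

lemma algebraic_int_eigenvalue:
  fixes x :: complex and v :: "nat \<Rightarrow> complex" and A :: "nat \<Rightarrow> nat \<Rightarrow> int"
  assumes eig: "\<And>i. i < n \<Longrightarrow> x * v i = (\<Sum>j<n. of_int (A i j) * v j)"
    and "k < n" "v k \<noteq> 0"
  shows "algebraic_int x"
proof -
  define M where "M = mat n n (\<lambda>(i, j). A i j)"
  have M: "M \<in> carrier_mat n n" unfolding M_def by simp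
  \<comment> \<open>With \<open>v\<close> as eigenvector, \<open>x\<close> is a root of the
    characteristic polynomial, which is monic with integer coefficients.\<close>
  have "eigenvector (map_mat complex_of_int M) (vec n v) x"
    unfolding eigenvector_def
  proof (intro conjI)
    show "vec n v \<in> carrier_vec (dim_row (map_mat complex_of_int M))" using M by simp
    show "vec n v \<noteq> 0\<^sub>v (dim_row (map_mat complex_of_int M))"
      using assms(2,3) M by (metis carrier_matD(1) index_map_mat(2) index_vec index_zero_vec(1))
    show "map_mat complex_of_int M *\<^sub>v vec n v = x \<cdot>\<^sub>v vec n v"
      by (rule eq_vecI)
        (auto simp: M_def scalar_prod_def eig atLeast0LessThan intro!: sum.cong)
  qed
  hence "eigenvalue (map_mat complex_of_int M) x" unfolding eigenvalue_def by blast
  moreover have "map_mat complex_of_int M \<in> carrier_mat n n" using M by simp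
  ultimately have "poly (char_poly (map_mat complex_of_int M)) x = 0"
    using eigenvalue_root_char_poly by blast
  hence "poly (map_poly of_int (char_poly M)) x = 0"
    using of_int_hom.char_poly_hom[OF M] by metis
  moreover have "lead_coeff (char_poly M) = 1" using degree_monic_char_poly[OF M] by simp
  ultimately show ?thesis using algebraic_int_altdef_ipoly by blast
qed

text \<open>The determinant trick: the coordinates of \<open>x * s\<close> form an integer matrix
  with eigenvalue \<open>x\<close>. They need not be unique, so \<open>S\<close> may be dependent;
  the nonzero \<open>s0\<close> keeps the eigenvector from vanishing.\<close>

lemma algebraic_int_of_span:
  assumes "finite S" "s0 \<in> S" "s0 \<noteq> 0"
    and mult: "\<And>s. s \<in> S \<Longrightarrow> x * s \<in> int_module.span S"
  shows "algebraic_int x"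
proof -
  obtain h where h: "bij_betw h {0..<card S} S"
    using ex_bij_betw_nat_finite[OF assms(1)] by blast
  have "\<exists>u. x * s = (\<Sum>v\<in>S. of_int (u v) * v)" if "s \<in> S" for s
    using mult[OF that] unfolding int_module.span_finite[OF assms(1)] by blast
  then obtain u where u: "\<And>s. s \<in> S \<Longrightarrow> x * s = (\<Sum>v\<in>S. of_int (u s v) * v)" by metis
  obtain k where k: "k < card S" "h k = s0"
    using h assms(2) unfolding bij_betw_def by (metis atLeastLessThan_iff image_iff)
  show ?thesis
  proof (rule algebraic_int_eigenvalue[where n = "card S" and v = h and k = k
        and A = "\<lambda>i j. u (h i) (h j)"])
    fix i assume "i < card S"
    hence "h i \<in> S" using h by (meson atLeastLessThan_iff bij_betwE zero_le)
    hence "x * h i = (\<Sum>v\<in>S. of_int (u (h i) v) * v)" by (rule u)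
    also have "\<dots> = (\<Sum>j\<in>{0..<card S}. of_int (u (h i) (h j)) * h j)"
      by (rule sum.reindex_bij_betw[OF h, symmetric])
    finally show "x * h i = (\<Sum>j<card S. of_int (u (h i) (h j)) * h j)"
      by (simp add: atLeast0LessThan)
  qed (use k(1) k(2) assms(3) in simp_all)
qed

lemma int_span_mult_closed:
  assumes "\<And>s. s \<in> S \<Longrightarrow> x * s \<in> int_module.span S" and "v \<in> int_module.span S"
  shows "x * v \<in> int_module.span S"
  using assms(2)
proof (induction rule: int_module.span_induct_alt)
  case base
  show ?case by (simp add: int_module.span_zero)
next
  case (step c y z)
  have "x * (of_int c * y + z) = of_int c * (x * y) + x * z" by (simp add: algebra_simps)
  thus ?case using step assms(1) int_module.span_add int_module.span_scale by metis
qed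

lemma monic_power_eq:
  fixes x :: complex and p :: "int poly"
  assumes "poly (map_poly of_int p) x = 0" "lead_coeff p = 1"
  shows "degree p > 0" "x ^ degree p = (\<Sum>k<degree p. of_int (- coeff p k) * x ^ k)"
proof -
  have "0 = (\<Sum>k\<le>degree p. of_int (coeff p k) * x ^ k)"
    using assms(1) by (simp add: poly_altdef degree_map_poly coeff_map_poly)
  also have "\<dots> = (\<Sum>k<degree p. of_int (coeff p k) * x ^ k) + x ^ degree p"
    using assms(2) by (simp add: lessThan_Suc_atMost[symmetric])
  finally show "x ^ degree p = (\<Sum>k<degree p. of_int (- coeff p k) * x ^ k)"
    by (simp add: sum_negf eq_neg_iff_add_eq_0 add.commute)
  show "degree p > 0"
  proof (rule ccontr)
    assume "\<not> degree p > 0"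
    hence "degree p = 0" by simp
    then obtain c where "p = [:c:]" using degree_eq_zeroE by blast
    thus False using assms by simp
  qed
qed

text \<open>The span of the monomials x^i y^j below the two degrees is stable under multiplication
  by \<open>x\<close> and by \<open>y\<close>: an exponent that reaches the degree is rewritten by
  the monic equation. Both degrees are positive, so 1 is among the monomials.\<close>

lemma algebraic_int_add_mult:
  fixes x y :: complex
  assumes "algebraic_int x" "algebraic_int y"
  shows "algebraic_int (x + y) \<and> algebraic_int (x * y)"
proof -
  obtain p where p: "poly (map_poly of_int p) x = 0" "lead_coeff p = 1"
    using assms(1) algebraic_int_altdef_ipoly by blast
  obtain q where q: "poly (map_poly of_int q) y = 0" "lead_coeff q = 1"
    using assms(2) algebraic_int_altdef_ipoly by blast
  note P = monic_power_eq[OF p] and Q = monic_power_eq[OF q]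
  define S where "S = (\<lambda>(i, j). x ^ i * y ^ j) ` ({..<degree p} \<times> {..<degree q})"
  have S: "x ^ i * y ^ j \<in> int_module.span S" if "i < degree p" "j < degree q" for i j
    using that unfolding S_def by (intro int_module.span_base) auto
  have x: "x * s \<in> int_module.span S" if s: "s \<in> S" for s
  proof -
    obtain i j where ij: "i < degree p" "j < degree q" "s = x ^ i * y ^ j"
      using s unfolding S_def by (elim imageE SigmaE) simp
    show ?thesis
    proof (cases "Suc i < degree p")
      case True
      thus ?thesis using S[of "Suc i" j] ij by (simp add: mult.assoc)
    next
      case False
      hence "x * s = x ^ degree p * y ^ j" using ij
        by (metis Suc_lessI mult.assoc power_Suc)
      also have "\<dots> = (\<Sum>k<degree p. of_int (- coeff p k) * (x ^ k * y ^ j))"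
        by (subst P(2)) (simp add: sum_distrib_right mult.assoc)
      also have "\<dots> \<in> int_module.span S"
        by (intro int_module.span_sum int_module.span_scale S) (use ij in auto)
      finally show ?thesis .
    qed
  qed
  have y: "y * s \<in> int_module.span S" if s: "s \<in> S" for s
  proof -
    obtain i j where ij: "i < degree p" "j < degree q" "s = x ^ i * y ^ j"
      using s unfolding S_def by (elim imageE SigmaE) simp
    show ?thesis
    proof (cases "Suc j < degree q")
      case True
      thus ?thesis using S[of i "Suc j"] ij by (simp add: algebra_simps)
    next
      case False
      hence "degree q = Suc j" using ij by simp
      hence "y * s = y ^ degree q * x ^ i" using ij by simp
      also have "\<dots> = (\<Sum>k<degree q. of_int (- coeff q k) * (x ^ i * y ^ k))"
        by (subst Q(2)) (simp add: sum_distrib_left sum_distrib_right algebra_simps)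
      also have "\<dots> \<in> int_module.span S"
        by (intro int_module.span_sum int_module.span_scale S) (use ij in auto)
      finally show ?thesis .
    qed
  qed
  have S0: "finite S" "1 \<in> S"
    using P(1) Q(1) unfolding S_def by (auto intro!: image_eqI[of _ _ "(0, 0)"])
  have "algebraic_int (x + y)"
    using x y by (intro algebraic_int_of_span[OF S0])
      (auto simp: distrib_right intro!: int_module.span_add)
  moreover have "algebraic_int (x * y)"
    using x y int_span_mult_closed
    by (intro algebraic_int_of_span[OF S0]) (auto simp: mult.assoc)
  ultimately show ?thesis by blast
qed

section \<open>Polynomials over a subring of the complex numbers\<close>

definition complex_subring :: "complex set \<Rightarrow> bool" where
  "complex_subring S \<longleftrightarrow>
     1 \<in> S \<and> (\<forall>x\<in>S. - x \<in> S) \<and> (\<forall>x\<in>S. \<forall>y\<in>S. x + y \<in> S \<and> x * y \<in> S)"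

lemma complex_subringD:
  assumes "complex_subring S"
  shows "0 \<in> S" "1 \<in> S" "x \<in> S \<Longrightarrow> - x \<in> S"
    "x \<in> S \<Longrightarrow> y \<in> S \<Longrightarrow> x + y \<in> S" "x \<in> S \<Longrightarrow> y \<in> S \<Longrightarrow> x - y \<in> S"
    "x \<in> S \<Longrightarrow> y \<in> S \<Longrightarrow> x * y \<in> S" "x \<in> S \<Longrightarrow> x ^ n \<in> S"
proof -
  show *: "1 \<in> S" "x \<in> S \<Longrightarrow> - x \<in> S" "x \<in> S \<Longrightarrow> y \<in> S \<Longrightarrow> x + y \<in> S"
    "x \<in> S \<Longrightarrow> y \<in> S \<Longrightarrow> x * y \<in> S" for x y
    using assms unfolding complex_subring_def by auto
  show "0 \<in> S" using *(3)[OF *(1) *(2)[OF *(1)]] by simp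
  show "x \<in> S \<Longrightarrow> y \<in> S \<Longrightarrow> x - y \<in> S" using *(3)[OF _ *(2), of x y] by simp
  show "x \<in> S \<Longrightarrow> x ^ n \<in> S" by (induction n) (auto intro: *)
qed

lemma complex_subring_sum:
  assumes "complex_subring S" "\<And>i. i \<in> A \<Longrightarrow> g i \<in> S"
  shows "(\<Sum>i\<in>A. g i) \<in> S"
  using assms(2) by (induction A rule: infinite_finite_induct)
    (auto intro: complex_subringD[OF assms(1)])

lemma complex_subring_prod:
  assumes "complex_subring S" "\<And>i. i \<in> A \<Longrightarrow> g i \<in> S"
  shows "(\<Prod>i\<in>A. g i) \<in> S"
  using assms(2) by (induction A rule: infinite_finite_induct)
    (auto intro: complex_subringD[OF assms(1)])

lemma complex_subring_Ints: "complex_subring \<int>"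
  and complex_subring_Rats: "complex_subring \<rat>"
  by (auto simp: complex_subring_def)

lemma complex_subring_algebraic_int: "complex_subring {x. algebraic_int x}"
  unfolding complex_subring_def using algebraic_int_add_mult by auto

lemma algebraic_int_closed [intro]:
  fixes x y :: complex
  assumes "algebraic_int x" "algebraic_int y"
  shows "algebraic_int (x + y)" "algebraic_int (x - y)" "algebraic_int (x * y)"
  using complex_subringD(4-6)[OF complex_subring_algebraic_int] assms by auto

lemma algebraic_int_pow [intro]: "algebraic_int (x :: complex) \<Longrightarrow> algebraic_int (x ^ n)"
  using complex_subringD(7)[OF complex_subring_algebraic_int] by auto

lemma algebraic_int_of_int [simp]: "algebraic_int (of_int n :: complex)"
  by (simp add: int_imp_algebraic_int)

text \<open>Coefficients stay complex and are only constrained to a set, so that integers,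
  rationals, number fields and algebraic integers are treated alike without changing the coefficient
  type.\<close>

definition polys_over :: "complex set \<Rightarrow> complex poly set" where
  "polys_over S = {p. \<forall>i. coeff p i \<in> S}"

lemma polys_over_mono: "S \<subseteq> T \<Longrightarrow> p \<in> polys_over S \<Longrightarrow> p \<in> polys_over T"
  unfolding polys_over_def by auto

lemma polys_over_algebraic_int: "p \<in> polys_over \<int> \<Longrightarrow> p \<in> polys_over {x. algebraic_int x}"
  unfolding polys_over_def by (auto intro: int_imp_algebraic_int)

lemma polys_over_Rats: "p \<in> polys_over \<int> \<Longrightarrow> p \<in> polys_over \<rat>"
  by (rule polys_over_mono) (auto elim: Ints_cases)

lemma polys_over_of_int [simp]: "map_poly of_int p \<in> polys_over \<int>"
  unfolding polys_over_def by (auto simp: coeff_map_poly)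

lemma polys_over_of_rat [simp]: "map_poly of_rat p \<in> polys_over \<rat>"
  unfolding polys_over_def by (auto simp: coeff_map_poly)

lemma polys_over_closed:
  assumes "complex_subring S"
  shows "0 \<in> polys_over S" "1 \<in> polys_over S"
    "c \<in> S \<Longrightarrow> [:c:] \<in> polys_over S" "c \<in> S \<Longrightarrow> monom c n \<in> polys_over S"
    "c \<in> S \<Longrightarrow> p \<in> polys_over S \<Longrightarrow> pCons c p \<in> polys_over S"
    "p \<in> polys_over S \<Longrightarrow> - p \<in> polys_over S"
    "p \<in> polys_over S \<Longrightarrow> q \<in> polys_over S \<Longrightarrow> p + q \<in> polys_over S"
    "p \<in> polys_over S \<Longrightarrow> q \<in> polys_over S \<Longrightarrow> p - q \<in> polys_over S"
    "p \<in> polys_over S \<Longrightarrow> q \<in> polys_over S \<Longrightarrow> p * q \<in> polys_over S"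
    "c \<in> S \<Longrightarrow> p \<in> polys_over S \<Longrightarrow> smult c p \<in> polys_over S"
  unfolding polys_over_def
  by (auto simp: coeff_1 coeff_pCons coeff_mult split: nat.splits
      intro!: complex_subringD[OF assms] complex_subring_sum[OF assms])

lemma complex_subring_polys_over_sum:
  assumes "complex_subring S" "\<And>i. i \<in> A \<Longrightarrow> g i \<in> polys_over S"
  shows "(\<Sum>i\<in>A. g i) \<in> polys_over S"
  using assms(2) by (induction A rule: infinite_finite_induct)
    (auto intro: polys_over_closed[OF assms(1)])

lemma complex_subring_polys_over_prod:
  assumes "complex_subring S" "\<And>i. i \<in> A \<Longrightarrow> g i \<in> polys_over S"
  shows "(\<Prod>i\<in>A. g i) \<in> polys_over S"
  using assms(2) by (induction A rule: infinite_finite_induct)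
    (auto intro: polys_over_closed[OF assms(1)])

lemma poly_in_subring:
  assumes "complex_subring S" "p \<in> polys_over S" "x \<in> S"
  shows "poly p x \<in> S"
  unfolding poly_altdef using assms
  by (intro complex_subring_sum) (auto simp: polys_over_def intro!: complex_subringD)

lemma monic_reduction:
  fixes f p :: "complex poly"
  assumes "lead_coeff f = 1" "degree f > 0" "degree f \<le> degree p"
  defines "p' \<equiv> p - monom (lead_coeff p) (degree p - degree f) * f"
  shows "degree p' < degree p"
proof -
  let ?t = "monom (lead_coeff p) (degree p - degree f)"
  have p0: "lead_coeff p \<noteq> 0" using assms(2,3) by auto
  have f0: "f \<noteq> 0" using assms(1) by auto
  have d: "degree (?t * f) = degree p"
    using p0 f0 assms(3) by (subst degree_mult_eq) (auto simp: degree_monom_eq)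
  have "lead_coeff (?t * f) = lead_coeff p"
    using assms(1) by (simp only: lead_coeff_mult lead_coeff_monom) simp
  hence "coeff p' (degree p) = 0" unfolding p'_def using d by simp
  moreover have "degree p' \<le> degree p"
    unfolding p'_def by (rule degree_diff_le) (simp_all add: d)
  moreover have False if eq: "degree p' = degree p" and zero: "coeff p' (degree p) = 0"
  proof -
    have "p' = 0" using zero unfolding eq[symmetric] by simp
    thus False using eq assms(2,3) by simp
  qed
  ultimately show ?thesis by (meson le_neq_implies_less)
qed

text \<open>Eliminating the leading term by a monic divisor needs no division of coefficients, so
  quotient and remainder stay over any subring, in particular over \<open>\<int>\<close>.\<close>

lemma monic_division:
  assumes S: "complex_subring S" and f: "f \<in> polys_over S" "lead_coeff f = 1" "degree f > 0"
    and p: "p \<in> polys_over S"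
  obtains q r where "q \<in> polys_over S" "r \<in> polys_over S" "p = f * q + r" "degree r < degree f"
proof -
  have "\<exists>q\<in>polys_over S. \<exists>r\<in>polys_over S. p = f * q + r \<and> degree r < degree f"
    using p
  proof (induction "degree p" arbitrary: p rule: less_induct)
    case less
    show ?case
    proof (cases "degree p < degree f")
      case True
      thus ?thesis using less.prems polys_over_closed(1)[OF S]
        by (intro bexI[of _ 0] bexI[of _ p]) auto
    next
      case False
      define t where "t = monom (lead_coeff p) (degree p - degree f)"
      have t: "t \<in> polys_over S"
        unfolding t_def using less.prems by (intro polys_over_closed(4)[OF S]) (auto simp: polys_over_def)
      have "degree (p - t * f) < degree p"
        unfolding t_def using f False by (intro monic_reduction) auto
      moreover have "p - t * f \<in> polys_over S"
        by (intro polys_over_closed[OF S] t f less.prems)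
      ultimately obtain q r where qr: "q \<in> polys_over S" "r \<in> polys_over S"
        "p - t * f = f * q + r" "degree r < degree f" using less.hyps by blast
      have "p = f * (t + q) + r" using qr(3) by (simp add: algebra_simps)
      thus ?thesis using qr t polys_over_closed(7)[OF S] by blast
    qed
  qed
  thus ?thesis using that by blast
qed

text \<open>The ring S[t] as the image of evaluation at \<open>t\<close>: an order for
  \<open>S\<close> = \<open>\<int>\<close>, and already a field when \<open>S\<close> is an
  \<open>algebraic_field\<close> and \<open>t\<close> an algebraic integer.\<close>

definition adjoin_ring :: "complex set \<Rightarrow> complex \<Rightarrow> complex set" where
  "adjoin_ring S t = (\<lambda>p. poly p t) ` polys_over S"

lemma adjoin_ringI: "p \<in> polys_over S \<Longrightarrow> poly p t \<in> adjoin_ring S t"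
  unfolding adjoin_ring_def by blast

lemma adjoin_ringE:
  assumes "x \<in> adjoin_ring S t"
  obtains p where "p \<in> polys_over S" "x = poly p t"
  using assms unfolding adjoin_ring_def by blast

lemma adjoin_ring_mono: "S \<subseteq> T \<Longrightarrow> adjoin_ring S t \<subseteq> adjoin_ring T t"
  unfolding adjoin_ring_def using polys_over_mono by blast

lemma complex_subring_adjoin_ring:
  assumes "complex_subring S"
  shows "complex_subring (adjoin_ring S t)"
  unfolding complex_subring_def
proof (intro conjI ballI)
  show "1 \<in> adjoin_ring S t" using adjoin_ringI[OF polys_over_closed(2)[OF assms], of t] by simp
  fix x assume "x \<in> adjoin_ring S t"
  then obtain p where p: "p \<in> polys_over S" "x = poly p t" by (rule adjoin_ringE)
  show "- x \<in> adjoin_ring S t" using adjoin_ringI[OF polys_over_closed(6)[OF assms p(1)], of t] p by simp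
  fix y assume "y \<in> adjoin_ring S t"
  then obtain q where q: "q \<in> polys_over S" "y = poly q t" by (rule adjoin_ringE)
  show "x + y \<in> adjoin_ring S t" "x * y \<in> adjoin_ring S t"
    using adjoin_ringI[OF polys_over_closed(7)[OF assms p(1) q(1)], of t]
      adjoin_ringI[OF polys_over_closed(9)[OF assms p(1) q(1)], of t] p q by simp_all
qed

lemma adjoin_ring_generator: "complex_subring S \<Longrightarrow> t \<in> adjoin_ring S t"
  using adjoin_ringI[of "[:0, 1:]" S t] polys_over_closed complex_subringD by fastforce

lemma adjoin_ring_base: "complex_subring S \<Longrightarrow> c \<in> S \<Longrightarrow> c \<in> adjoin_ring S t"
  using adjoin_ringI[of "[:c:]" S t] polys_over_closed by fastforce

lemma adjoin_ring_reduced: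
  assumes "complex_subring S" "f \<in> polys_over S" "lead_coeff f = 1" "degree f > 0"
    and "poly f t = 0" "x \<in> adjoin_ring S t"
  obtains r where "r \<in> polys_over S" "degree r < degree f" "x = poly r t"
proof -
  obtain p where p: "p \<in> polys_over S" "x = poly p t" using assms(6) by (rule adjoin_ringE)
  obtain q r where "r \<in> polys_over S" "p = f * q + r" "degree r < degree f"
    using monic_division[OF assms(1-4) p(1)] by metis
  thus ?thesis using that p assms(5) by simp
qed

lemma adjoin_ring_subset:
  assumes "complex_subring T" "S \<subseteq> T" "t \<in> T"
  shows "adjoin_ring S t \<subseteq> T"
  using poly_in_subring[OF assms(1) polys_over_mono[OF assms(2)] assms(3)]
  unfolding adjoin_ring_def by blast


section \<open>Fields of algebraic numbers\<close>

text \<open>The denominators make inverses available: such a ring is automatically a field.\<close>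

definition algebraic_field :: "complex set \<Rightarrow> bool" where
  "algebraic_field S \<longleftrightarrow> complex_subring S \<and> \<rat> \<subseteq> S \<and>
     (\<forall>x\<in>S. \<exists>n::nat. n > 0 \<and> algebraic_int (of_nat n * x))"

lemma polys_over_pCons: "pCons a p \<in> polys_over S \<longleftrightarrow> a \<in> S \<and> p \<in> polys_over S"
proof
  assume *: "pCons a p \<in> polys_over S"
  hence "coeff (pCons a p) 0 \<in> S" "\<And>i. coeff (pCons a p) (Suc i) \<in> S" unfolding polys_over_def by blast+
  thus "a \<in> S \<and> p \<in> polys_over S" unfolding polys_over_def by simp
qed (auto simp: polys_over_def coeff_pCons split: nat.splits)

text \<open>If the constant term of the equation vanishes, a factor \<open>x\<close> cancels and the
  induction continues; otherwise a + x p(x) = 0 exhibits the inverse as -p(x) / a.\<close>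

lemma inverse_via_poly:
  assumes S: "complex_subring S" "\<rat> \<subseteq> S" and x: "x \<in> S" "x \<noteq> 0"
    and p: "p \<in> polys_over \<rat>" "p \<noteq> 0" "poly p x = 0"
  shows "inverse x \<in> S"
  using p
proof (induction p)
  case 0
  thus ?case by simp
next
  case (pCons a p)
  have a: "a \<in> \<rat>" and p: "p \<in> polys_over \<rat>"
    using pCons.prems(1) by (simp_all add: polys_over_pCons)
  show ?case
  proof (cases "a = 0")
    case True
    thus ?thesis using pCons p x by auto
  next
    case False
    have "poly p x \<in> S" using poly_in_subring[OF S(1) polys_over_mono[OF S(2) p] x(1)] .
    moreover have "inverse x = - inverse a * poly p x"
      using pCons.prems(3) False x(2) by (simp add: field_simps add_eq_0_iff)
    moreover have "- inverse a \<in> S" using a S(2) by auto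
    ultimately show ?thesis
      using complex_subringD(6)[OF S(1), of "- inverse a" "poly p x"] by metis
  qed
qed

lemma algebraic_field_inverse:
  assumes "algebraic_field S" "x \<in> S" "x \<noteq> 0"
  shows "inverse x \<in> S"
proof -
  obtain n :: nat where n: "n > 0" "algebraic_int (of_nat n * x)"
    using assms unfolding algebraic_field_def by blast
  obtain p where p: "lead_coeff p = 1" "\<forall>i. coeff p i \<in> \<int>" "poly p (of_nat n * x) = 0"
    using n(2) by (auto elim: algebraic_int.cases)
  have S: "complex_subring S" "\<rat> \<subseteq> S" using assms(1) unfolding algebraic_field_def by auto
  have "of_nat n \<in> S" using S(2) by auto
  hence nx: "of_nat n * x \<in> S" using assms(2) complex_subringD(6)[OF S(1)] by blast
  have "inverse (of_nat n * x) \<in> S"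
    by (rule inverse_via_poly[OF S nx, of p])
      (use p n assms(3) polys_over_Rats[of p] in \<open>auto simp: polys_over_def\<close>)
  hence "of_nat n * inverse (of_nat n * x) \<in> S"
    using \<open>of_nat n \<in> S\<close> complex_subringD(6)[OF S(1)] by blast
  moreover have "of_nat n * inverse (of_nat n * x) = inverse x" using n(1) by (simp add: field_simps)
  ultimately show ?thesis by (simp only:)
qed

lemma algebraic_field_Rats: "algebraic_field \<rat>"
  unfolding algebraic_field_def
proof (intro conjI ballI)
  fix x :: complex assume "x \<in> \<rat>"
  then obtain a b where "b > 0" "x = of_int a / of_int b" by (auto elim: Rats_cases')
  hence "of_nat (nat b) * x = of_int a" "nat b > 0" by auto
  thus "\<exists>n::nat. n > 0 \<and> algebraic_int (of_nat n * x)" by (metis algebraic_int_of_int)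
qed (use complex_subring_Rats in auto)

text \<open>If \<open>m\<close> clears \<open>a\<close> and \<open>n\<close> clears p(t), then
  \<open>m * n\<close> clears a + t p(t). Inverses in S[t] thus come from denominators, without a
  minimal polynomial of \<open>t\<close> over \<open>S\<close>.\<close>

lemma algebraic_field_adjoin_ring:
  assumes S: "algebraic_field S" and t: "algebraic_int t"
  shows "algebraic_field (adjoin_ring S t)"
proof -
  have S': "complex_subring S" "\<rat> \<subseteq> S" using S unfolding algebraic_field_def by auto
  have "\<exists>n::nat. n > 0 \<and> algebraic_int (of_nat n * poly p t)" if "p \<in> polys_over S" for p
    using that
  proof (induction p)
    case 0
    show ?case by (intro exI[of _ 1]) auto
  next
    case (pCons a p)
    have a: "a \<in> S" and p: "p \<in> polys_over S"
      using pCons.prems(1) by (simp_all add: polys_over_pCons)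
    obtain m :: nat where m: "m > 0" "algebraic_int (of_nat m * a)"
      using S a unfolding algebraic_field_def by blast
    obtain n :: nat where n: "n > 0" "algebraic_int (of_nat n * poly p t)"
      using pCons.IH[OF p] by blast
    have "algebraic_int (of_int (int n) * (of_nat m * a) + of_int (int m) * (t * (of_nat n * poly p t)))"
      by (intro algebraic_int_closed m n t algebraic_int_of_int)
    hence "algebraic_int (of_nat (m * n) * poly (pCons a p) t)" by (simp add: algebra_simps)
    thus ?case using m n by (intro exI[of _ "m * n"]) auto
  qed
  thus ?thesis unfolding algebraic_field_def
    using complex_subring_adjoin_ring[OF S'(1)] S'(2) adjoin_ring_base[OF S'(1)]
    by (auto elim!: adjoin_ringE)
qed

section \<open>The operations of \<open>complex_ring\<close> and the field
  \<open>adjoin\<close>\<close>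

lemma complex_ring_simps:
  "\<one>\<^bsub>complex_ring\<^esub> = (1 :: complex)" "\<zero>\<^bsub>complex_ring\<^esub> = (0 :: complex)"
  "x \<oplus>\<^bsub>complex_ring\<^esub> y = x + y" "x \<otimes>\<^bsub>complex_ring\<^esub> y = x * y"
  "carrier complex_ring = UNIV"
  by (simp_all add: ring_of_type_algebra_def)

lemma complex_ring_uminus: "\<ominus>\<^bsub>complex_ring\<^esub> x = - x"
proof -
  interpret C: cring complex_ring by (rule cring_from_type_algebra)
  have "- x \<oplus>\<^bsub>complex_ring\<^esub> x = \<zero>\<^bsub>complex_ring\<^esub>" by (simp add: complex_ring_simps)
  thus ?thesis using C.minus_equality[of "- x" x] by (simp add: complex_ring_simps)
qed

lemma complex_ring_inverse: "x \<noteq> 0 \<Longrightarrow> inv\<^bsub>complex_ring\<^esub> x = inverse x"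
proof -
  assume x: "x \<noteq> 0"
  interpret C: cring complex_ring by (rule cring_from_type_algebra)
  have "x \<otimes>\<^bsub>complex_ring\<^esub> inverse x = \<one>\<^bsub>complex_ring\<^esub>" using x by (simp add: complex_ring_simps)
  thus ?thesis using C.comm_inv_char[of x "inverse x"] by (simp add: complex_ring_simps)
qed

lemma adjoin_least:
  assumes "algebraic_field S" "A \<subseteq> S"
  shows "adjoin A \<subseteq> S"
proof
  have S: "complex_subring S" "\<rat> \<subseteq> S" using assms(1) unfolding algebraic_field_def by auto
  fix x assume "x \<in> adjoin A"
  thus "x \<in> S" unfolding adjoin_def
    by induction (use assms S in \<open>auto simp: complex_ring_simps complex_ring_uminus
        complex_ring_inverse complex_subringD[OF S(1)] algebraic_field_inverse\<close>)
qed

lemma subset_adjoin: "A \<subseteq> adjoin A" "\<rat> \<subseteq> adjoin A"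
  unfolding adjoin_def by (auto intro: generate_field.incl)

lemma complex_subring_adjoin: "complex_subring (adjoin A)"
  unfolding complex_subring_def adjoin_def
  using generate_field.one[of complex_ring "\<rat> \<union> A"] generate_field.a_inv[of _ complex_ring "\<rat> \<union> A"]
    generate_field.eng_add[of _ complex_ring "\<rat> \<union> A"] generate_field.eng_mult[of _ complex_ring "\<rat> \<union> A"]
  by (auto simp: complex_ring_simps complex_ring_uminus)

lemma adjoin_singleton:
  assumes "algebraic_int t"
  shows "adjoin {t} = adjoin_ring \<rat> t"
proof
  show "adjoin {t} \<subseteq> adjoin_ring \<rat> t"
    using algebraic_field_adjoin_ring[OF algebraic_field_Rats assms]
      adjoin_ring_generator[OF complex_subring_Rats] by (intro adjoin_least) auto
  show "adjoin_ring \<rat> t \<subseteq> adjoin {t}"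
    using complex_subring_adjoin subset_adjoin by (intro adjoin_ring_subset) auto
qed

section \<open>Roots of irreducible polynomials\<close>

abbreviation irreducible_over_rat :: "int poly \<Rightarrow> bool" where
  "irreducible_over_rat f \<equiv> Factorial_Ring.irreducible (map_poly of_int f :: rat poly)"

lemma of_rat_of_int_poly: "map_poly of_rat (map_poly of_int f :: rat poly) = (map_poly of_int f :: complex poly)"
  by (simp add: map_poly_map_poly o_def)

text \<open>Otherwise the irreducible polynomial is coprime to \<open>p\<close> over the rationals,
  and a Bezout identity evaluated at the common root \<open>t\<close> reads 0 = 1.\<close>

lemma irreducible_over_rat_dvd:
  fixes f :: "int poly"
  assumes irr: "irreducible_over_rat f" and t: "t \<in> complex_roots f"
    and p: "p \<in> polys_over \<rat>" "poly p t = 0"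
  shows "\<exists>q\<in>polys_over \<rat>. p = map_poly of_int f * q"
proof -
  interpret h: map_poly_inj_idom_hom "of_rat :: rat \<Rightarrow> complex" ..
  let ?F = "map_poly of_int f :: rat poly"
  have "\<And>i. coeff p i \<in> \<rat>" using p(1) unfolding polys_over_def by blast
  then obtain P where P: "p = map_poly of_rat P" by (rule ratpolyE)
  have "?F dvd P"
  proof (rule ccontr)
    assume "\<not> ?F dvd P"
    hence "Rings.coprime ?F P"
      using field_poly_irreducible_imp_prime[OF irr] prime_elem_imp_coprime by blast
    hence "fst (bezout_coefficients ?F P) * ?F + snd (bezout_coefficients ?F P) * P = 1"
      by (simp add: bezout_coefficients_fst_snd)
    then obtain a b where "a * ?F + b * P = 1" by blast
    hence "map_poly of_rat a * map_poly of_rat ?F + map_poly of_rat b * p = (1 :: complex poly)"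
      unfolding P by (metis h.hom_add h.hom_mult h.hom_one)
    hence "poly (map_poly of_rat a * map_poly of_rat ?F + map_poly of_rat b * p) t = (1::complex)"
      by simp
    thus False using p(2) t unfolding of_rat_of_int_poly complex_roots_def by simp
  qed
  then obtain Q where Q: "P = ?F * Q" by blast
  have "p = map_poly of_int f * map_poly of_rat Q"
    unfolding P Q by (simp add: h.hom_mult of_rat_of_int_poly)
  thus ?thesis using polys_over_of_rat by blast
qed

lemma irreducible_over_rat_conjugate:
  assumes "irreducible_over_rat f" "t \<in> complex_roots f" "r \<in> complex_roots f"
    and "p \<in> polys_over \<rat>" "poly p t = 0"
  shows "poly p r = 0"
  using irreducible_over_rat_dvd[OF assms(1,2,4,5)] assms(3) unfolding complex_roots_def by auto

lemma irreducible_over_rat_low_degree: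
  assumes "irreducible_over_rat f" "t \<in> complex_roots f"
    and "p \<in> polys_over \<rat>" "poly p t = 0" "degree p < degree f"
  shows "p = 0"
proof (rule ccontr)
  assume p: "p \<noteq> 0"
  obtain q where q: "p = map_poly of_int f * q"
    using irreducible_over_rat_dvd[OF assms(1-4)] by blast
  have "degree (map_poly of_int f :: complex poly) \<le> degree p"
    using p q by (intro dvd_imp_degree_le) auto
  thus False using assms(5) by simp
qed

lemma degree_root_pos:
  assumes "lead_coeff f = 1" "t \<in> complex_roots f"
  shows "degree f > 0"
  using monic_power_eq(1)[of f t] assms unfolding complex_roots_def by simp

lemma algebraic_int_root_monic:
  assumes "lead_coeff f = 1" "t \<in> complex_roots f"
  shows "algebraic_int t"
  using assms algebraic_int_altdef_ipoly unfolding complex_roots_def by blast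

lemma irreducible_over_rat_separable:
  assumes "irreducible_over_rat f" "lead_coeff f = 1" "t \<in> complex_roots f"
  shows "poly (map_poly of_int (pderiv f)) t \<noteq> 0"
proof
  assume 0: "poly (map_poly of_int (pderiv f)) t = 0"
  have "degree f > 0" using degree_root_pos assms by blast
  hence "(map_poly of_int (pderiv f) :: complex poly) = 0"
    by (intro irreducible_over_rat_low_degree[OF assms(1,3) _ 0])
      (auto intro: polys_over_Rats simp: degree_pderiv)
  thus False using \<open>degree f > 0\<close> by (simp add: pderiv_eq_0_iff)
qed

lemma complex_roots_product:
  assumes irr: "irreducible_over_rat f" and lc: "lead_coeff f = 1"
  shows "finite (complex_roots f)" "map_poly of_int f = (\<Prod>r\<in>complex_roots f. [:- r, 1:])"
    "card (complex_roots f) = degree f"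
proof -
  let ?F = "map_poly of_int f :: complex poly"
  have "?F \<noteq> 0" using lc by auto
  thus fin: "finite (complex_roots f)"
    unfolding complex_roots_def using poly_roots_finite by blast
  have "rsquarefree ?F" unfolding rsquarefree_roots
    using irreducible_over_rat_separable[OF irr lc]
    by (auto simp: complex_roots_def of_int_hom.map_poly_pderiv)
  from complex_poly_decompose_rsquarefree[OF this] lc
  show *: "?F = (\<Prod>r\<in>complex_roots f. [:- r, 1:])"
    unfolding complex_roots_def by simp
  have "degree ?F = (\<Sum>r\<in>complex_roots f. 1)"
    by (subst *, subst degree_prod_sum_eq) auto
  thus "card (complex_roots f) = degree f" by simp
qed

lemma complex_roots_nonempty:
  assumes "lead_coeff f = 1" "degree f > 0"
  shows "complex_roots f \<noteq> {}"
proof -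
  have "\<not> constant (poly (map_poly of_int f :: complex poly))"
    using assms(2) by (simp add: constant_degree)
  thus ?thesis unfolding complex_roots_def using fundamental_theorem_of_algebra by blast
qed

section \<open>Monogenic polynomials\<close>

lemma complex_subring_int_span: "complex_subring S \<Longrightarrow> v \<in> int_module.span B \<Longrightarrow> B \<subseteq> S \<Longrightarrow> v \<in> S"
proof -
  assume S: "complex_subring S" and v: "v \<in> int_module.span B" and B: "B \<subseteq> S"
  have nat: "complex_of_nat n \<in> S" for n
    by (induction n) (auto intro: complex_subringD[OF S])
  have int: "complex_of_int n \<in> S" for n
    by (cases n rule: int_cases2) (auto intro: nat complex_subringD[OF S])
  show ?thesis using v
  proof (induction rule: int_module.span_induct_alt)
    case base
    show ?case by (rule complex_subringD(1)[OF S])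
  next
    case (step c x y)
    thus ?case using B int complex_subringD(4,6)[OF S] by blast
  qed
qed

lemma int_span_powers:
  assumes lc: "lead_coeff f = 1" and t: "t \<in> complex_roots f"
  shows "int_module.span {t ^ i | i. i < degree f} = adjoin_ring \<int> t"
proof (intro equalityI subsetI)
  fix x assume "x \<in> int_module.span {t ^ i | i. i < degree f}"
  thus "x \<in> adjoin_ring \<int> t"
    by (rule complex_subring_int_span[OF complex_subring_adjoin_ring[OF complex_subring_Ints]])
      (auto intro!: complex_subringD complex_subring_adjoin_ring complex_subring_Ints adjoin_ring_generator)
next
  fix x assume "x \<in> adjoin_ring \<int> t"
  then obtain r where r: "r \<in> polys_over \<int>" "degree r < degree f" "x = poly r t"
    using adjoin_ring_reduced[OF complex_subring_Ints, of "map_poly of_int f" t x] lc t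
      degree_root_pos[OF lc t] by (auto simp: complex_roots_def)
  have "x = (\<Sum>i\<le>degree r. coeff r i * t ^ i)" using r by (simp add: poly_altdef)
  also have "\<dots> \<in> int_module.span {t ^ i | i. i < degree f}"
  proof (intro int_module.span_sum)
    fix i assume i: "i \<in> {..degree r}"
    obtain n where "coeff r i = of_int n" using r(1) by (auto simp: polys_over_def elim!: Ints_cases)
    moreover have "t ^ i \<in> int_module.span {t ^ i | i. i < degree f}"
      using i r(2) by (intro int_module.span_base) auto
    ultimately show "coeff r i * t ^ i \<in> int_module.span {t ^ i | i. i < degree f}"
      using int_module.span_scale by simp
  qed
  finally show "x \<in> int_module.span {t ^ i | i. i < degree f}" .
qed

text \<open>The basis in \<open>monogenic\<close> is a set of numbers; its sums can be indexed by
  exponents only once the powers are known to be distinct.\<close>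

lemma inj_on_powers:
  assumes irr: "irreducible_over_rat f" and t: "t \<in> complex_roots f"
  shows "inj_on (\<lambda>i. t ^ i) {..<degree f}"
proof (rule inj_onI)
  fix i j assume ij: "i \<in> {..<degree f}" "j \<in> {..<degree f}" "t ^ i = t ^ j"
  have "monom 1 i - monom 1 j = (0 :: complex poly)"
    by (rule irreducible_over_rat_low_degree[OF irr t])
      (use ij in \<open>auto simp: poly_monom intro!: polys_over_closed[OF complex_subring_Rats]
         degree_diff_less simp: degree_monom_eq\<close>)
  hence "monom 1 i = (monom 1 j :: complex poly)" by simp
  thus "i = j" by (metis degree_monom_eq one_neq_zero)
qed

lemma independent_powers:
  assumes irr: "irreducible_over_rat f" and t: "t \<in> complex_roots f"
  shows "int_module.independent {t ^ i | i. i < degree f}"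
proof
  let ?B = "{t ^ i | i. i < degree f}"
  have B: "?B = (\<lambda>i. t ^ i) ` {..<degree f}" by auto
  have fin: "finite ?B" unfolding B by simp
  assume "int_module.dependent ?B"
  then obtain u v where u: "v \<in> ?B" "u v \<noteq> 0" "(\<Sum>v\<in>?B. of_int (u v) * v) = 0"
    unfolding int_module.dependent_finite[OF fin] by blast
  define p where "p = (\<Sum>i<degree f. monom (complex_of_int (u (t ^ i))) i)"
  have cp: "coeff p j = (if j < degree f then of_int (u (t ^ j)) else 0)" for j
    unfolding p_def coeff_sum by (auto simp: if_distrib cong: if_cong)
  obtain j where j: "j < degree f" "v = t ^ j" using u(1) by blast
  have "p = 0"
  proof (rule irreducible_over_rat_low_degree[OF irr t])
    show "p \<in> polys_over \<rat>" unfolding polys_over_def by (auto simp: cp)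
    show "poly p t = 0"
      using u(3) unfolding B sum.reindex[OF inj_on_powers[OF irr t]] p_def
      by (simp add: poly_sum poly_monom)
    show "degree p < degree f"
      using j by (intro degree_lessI) (auto simp: cp)
  qed
  hence "coeff p j = 0" by simp
  thus False using u(2) j cp[of j] by simp
qed

text \<open>Independence follows from irreducibility, and Z[t] consists of algebraic integers
  because \<open>t\<close> is one; the inclusion of the ring of integers in Z[t] is the whole
  content.\<close>

lemma integral_basis_powers_iff:
  assumes irr: "irreducible_over_rat f" and lc: "lead_coeff f = 1" and t: "t \<in> complex_roots f"
  shows "integral_basis {t ^ i | i. i < degree f} (ring_of_integers (adjoin {t})) \<longleftrightarrow>
     (\<forall>x\<in>adjoin_ring \<rat> t. algebraic_int x \<longrightarrow> x \<in> adjoin_ring \<int> t)"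
proof -
  have alg: "algebraic_int t" using algebraic_int_root_monic[OF lc t] .
  have "adjoin_ring \<int> t \<subseteq> {x. algebraic_int x}"
    using alg by (intro adjoin_ring_subset complex_subring_algebraic_int) (auto intro: int_imp_algebraic_int)
  moreover have "adjoin_ring \<int> t \<subseteq> adjoin_ring \<rat> t" by (rule adjoin_ring_mono) (auto elim: Ints_cases)
  ultimately show ?thesis
    unfolding integral_basis_def int_span_powers[OF lc t] ring_of_integers_def adjoin_singleton[OF alg]
    using independent_powers[OF irr t] by auto
qed

text \<open>With \<open>f = (X - r) W + f(r)\<close> and \<open>W = (X - r) V + f'(r)\<close>, a root \<open>t\<close> satisfies
  \<open>W(t)\<^sup>2 = f'(r) W(t) - f(r) V(t)\<close>; dividing by \<open>m\<^sup>2\<close> shows that \<open>W(t) / m\<close> is integral.\<close>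

lemma monogenic_no_double_root:
  assumes mon: "monogenic f" and deg: "degree f > 0" and m: "m > 1"
    and dvd: "m\<^sup>2 dvd poly f r" "m dvd poly (pderiv f) r"
  shows False
proof -
  have lc: "lead_coeff f = 1" and irr: "irreducible_over_rat f"
    using mon unfolding monogenic_def by auto
  obtain t where t: "t \<in> complex_roots f" using complex_roots_nonempty[OF lc deg] by blast
  define W where "W = synthetic_div f r"
  define V where "V = synthetic_div W r"
  have fW: "f = [:- r, 1:] * W + [:poly f r:]" unfolding W_def using synthetic_div_correct' by metis
  have WV: "W = [:- r, 1:] * V + [:poly W r:]" unfolding V_def using synthetic_div_correct' by metis
  have "pderiv f = W + [:- r, 1:] * pderiv W"
    by (subst fW) (simp only: pderiv_add pderiv_mult, simp add: pderiv_pCons)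
  hence Wr: "poly W r = poly (pderiv f) r" by simp
  have "W \<noteq> 0" unfolding W_def using deg by (simp add: synthetic_div_eq_0_iff)
  have dW: "degree W = degree f - 1" unfolding W_def by (simp add: degree_synthetic_div)
  have "lead_coeff ([:- r, 1:] * W + [:poly f r:]) = lead_coeff ([:- r, 1:] * W)"
  proof -
    have "degree ([:- r, 1:] * W) = 1 + degree W" using \<open>W \<noteq> 0\<close> by (subst degree_mult_eq) auto
    hence "degree [:poly f r:] < degree ([:- r, 1:] * W)" by simp
    from lead_coeff_add_le[OF this] show ?thesis by (simp only: add.commute[of "[:poly f r:]"])
  qed
  hence lW: "lead_coeff W = 1" using lc fW by (simp only: lead_coeff_mult) simp
  obtain a where a: "poly f r = m\<^sup>2 * a" using dvd(1) by blast
  obtain b where b: "poly (pderiv f) r = m * b" using dvd(2) by blast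
  let ?C = "map_poly complex_of_int"
  define w where "w = poly (?C W) t"
  define v where "v = poly (?C V) t"
  have alg: "algebraic_int t" using algebraic_int_root_monic[OF lc t] .
  have v: "algebraic_int v" unfolding v_def
    using alg poly_in_subring[OF complex_subring_algebraic_int polys_over_algebraic_int[OF polys_over_of_int]]
    by blast
  have const: "poly (?C [:c:]) t = of_int c" for c
    by (simp add: poly_altdef coeff_map_poly)
  have ev: "poly (?C ([:- r, 1:] * p + [:c:])) t = (t - of_int r) * poly (?C p) t + of_int c" for p c
  proof -
    have "poly (?C [:- r, 1:]) t = t - of_int r"
      by (simp add: poly_altdef coeff_map_poly)
    thus ?thesis
      by (simp only: of_int_poly_hom.hom_mult of_int_poly_hom.hom_add poly_add poly_mult const)
  qed
  have "poly (?C f) t = (t - of_int r) * w + of_int (poly f r)"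
    unfolding w_def by (subst fW, rule ev)
  hence e1: "(t - of_int r) * w = - of_int (m\<^sup>2 * a)"
    using t a by (simp add: complex_roots_def eq_neg_iff_add_eq_0)
  have e2: "w = (t - of_int r) * v + of_int (m * b)"
    unfolding w_def v_def b[symmetric] Wr[symmetric] by (subst WV, rule ev)
  have "w * w = ((t - of_int r) * w) * v + of_int (m * b) * w"
    by (subst (2) e2) (simp add: algebra_simps)
  hence w2: "w * w = - of_int (m\<^sup>2 * a) * v + of_int (m * b) * w" unfolding e1 .
  define x where "x = w / of_int m"
  have m0: "complex_of_int m \<noteq> 0" using m by simp
  have "poly [:0, - of_int b, 1:] x = - of_int a * v"
  proof -
    have "w = of_int m * x" unfolding x_def using m0 by simp
    moreover have "M\<^sup>2 * (x * x - B * x + A * v) = (M * x) * (M * x) - (- (M\<^sup>2 * A) * v + (M * B) * (M * x))"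
      for M A B :: complex by (simp add: power2_eq_square ring_distribs mult_ac)
    ultimately have "(of_int m)\<^sup>2 * (x * x - of_int b * x + of_int a * v) =
        w * w - (- of_int (m\<^sup>2 * a) * v + of_int (m * b) * w)"
      by (simp only: of_int_mult of_int_power)
    hence "(of_int m)\<^sup>2 * (x * x - of_int b * x + of_int a * v) = 0" unfolding w2 by simp
    with m0 have "x * x - of_int b * x + of_int a * v = 0" by simp
    thus ?thesis by (simp add: algebra_simps eq_neg_iff_add_eq_0)
  qed
  moreover have "algebraic_int (- of_int a * v)"
    using algebraic_int_closed(3)[OF algebraic_int_of_int[of "-a"] v] by simp
  moreover have "\<forall>i. coeff [:0, - complex_of_int b, 1:] i \<in> \<int>"
    by (auto simp: coeff_pCons split: nat.splits)
  \<comment> \<open>\<open>x\<close> is a root of X^2 - b X = - a v, where the left side is monic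
    and integral and the right side an algebraic integer.\<close>
  ultimately have x: "algebraic_int x"
    using algebraic_int_root[of "- of_int a * v" "[:0, - complex_of_int b, 1:]" x] by simp
  have "x = poly (smult (1 / of_int m) (?C W)) t" unfolding x_def w_def by simp
  moreover have "smult (1 / of_int m) (?C W) \<in> polys_over \<rat>"
    by (intro polys_over_closed[OF complex_subring_Rats] polys_over_Rats polys_over_of_int) auto
  ultimately have "x \<in> adjoin_ring \<rat> t" using adjoin_ringI by metis
  hence "x \<in> adjoin_ring \<int> t"
    using mon x integral_basis_powers_iff[OF irr lc t] t unfolding monogenic_def by blast
  then obtain q where q: "q \<in> polys_over \<int>" "degree q < degree f" "x = poly q t"
    using adjoin_ring_reduced[OF complex_subring_Ints, of "map_poly of_int f" t x] lc t deg
    by (auto simp: complex_roots_def)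
  \<comment> \<open>If W(t) / m = q(t) with integral \<open>q\<close>, then W and m q agree at
    \<open>t\<close> and have degree below that of \<open>f\<close>, so they coincide. The leading
    coefficient 1 of W would then be divisible by \<open>m\<close>.\<close>
  have "?C W - smult (of_int m) q = 0"
  proof (rule irreducible_over_rat_low_degree[OF irr t])
    show "?C W - smult (of_int m) q \<in> polys_over \<rat>"
      using q(1) by (intro polys_over_Rats polys_over_closed[OF complex_subring_Ints]) auto
    show "poly (?C W - smult (of_int m) q) t = 0" using q(3) m0 unfolding x_def w_def by (simp add: field_simps)
    have "degree (?C W) < degree f" using dW deg by simp
    moreover have "degree (smult (of_int m) q) < degree f" using q(2) m0 by simp
    ultimately show "degree (?C W - smult (of_int m) q) < degree f"
      by (rule degree_diff_less)
  qed
  hence "coeff (?C W) (degree W) = of_int m * coeff q (degree W)"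
    by (metis coeff_smult eq_iff_diff_eq_0)
  moreover have "coeff (?C W) (degree W) = 1" using lW by (simp add: coeff_map_poly)
  moreover obtain n where "coeff q (degree W) = of_int n"
    using q(1) by (auto simp: polys_over_def elim!: Ints_cases)
  ultimately have "complex_of_int (m * n) = of_int 1" by simp
  hence "m * n = 1" by (simp only: of_int_eq_iff)
  thus False using m by (simp add: zmult_eq_1_iff)
qed


section \<open>The arithmetic of the discriminant\<close>

lemma odd_part_int:
  fixes s :: int
  assumes "s \<noteq> 0"
  obtains j m where "s = 2 ^ j * m" "odd m"
proof -
  have "\<exists>j m. s = 2 ^ j * m \<and> odd m" using assms
  proof (induction "nat \<bar>s\<bar>" arbitrary: s rule: less_induct)
    case less
    show ?case
    proof (cases "even s")
      case True
      then obtain t where t: "s = 2 * t" by blast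
      then obtain j m where "t = 2 ^ j * m" "odd m" using less.hyps[of t] less.prems by force
      thus ?thesis using t by (intro exI[of _ "Suc j"] exI[of _ m]) simp
    next
      case False
      thus ?thesis by (intro exI[of _ 0] exI[of _ s]) simp
    qed
  qed
  thus ?thesis using that by blast
qed

lemma odd_power4:
  fixes a :: int
  assumes "odd a"
  obtains q where "a ^ 4 = 8 * q + 1"
proof -
  obtain u where u: "a = 2 * u + 1" using assms by (elim oddE)
  have "a ^ 4 = 8 * (2 * u ^ 4 + 4 * u ^ 3 + 3 * u\<^sup>2 + u) + 1"
    unfolding u by (simp add: algebra_simps power2_eq_square power3_eq_cube power4_eq_xxxx)
  thus ?thesis by (rule that)
qed

lemma even_neq_odd: "2 * x = 2 * y + 1 \<Longrightarrow> False" for x y :: int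
  by presburger

text \<open>The double root of \<open>f\<close> modulo an odd divisor of the discriminant is \<open>- 3 a / 4\<close>.\<close>

lemma quartic_double_root:
  fixes a d s m :: int
  assumes sq: "256 * d - 27 * a ^ 4 = s\<^sup>2" and m: "odd m" "m dvd s"
  shows "\<exists>r. m\<^sup>2 dvd r ^ 4 + a * r ^ 3 + d \<and> m dvd r\<^sup>2 * (4 * r + 3 * a)"
proof -
  obtain u where u: "m = 2 * u + 1" using m(1) by (elim oddE)
  define e where "e = u\<^sup>2 + u"
  have e: "m\<^sup>2 = 4 * e + 1" unfolding u e_def by (simp add: power2_eq_square algebra_simps)
  \<comment> \<open>From 4 e = m^2 - 1, the inverse of 4 modulo m^2 is \<open>- e\<close>; hence
    \<open>r\<close> represents -3a/4.\<close>
  define r where "r = 3 * a * e"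
  have r: "4 * r + 3 * a = m\<^sup>2 * (3 * a)" unfolding r_def e by (simp add: algebra_simps)
  \<comment> \<open>Division of 256 f by 4x + 3a; the remainder is 256 f(-3a/4).\<close>
  have id: "256 * (r ^ 4 + a * r ^ 3 + d) =
      (4 * r + 3 * a) * ((4 * r) ^ 3 + a * (4 * r)\<^sup>2 - 3 * a\<^sup>2 * (4 * r) + 9 * a ^ 3)
        + (256 * d - 27 * a ^ 4)"
    by (simp add: algebra_simps power2_eq_square power3_eq_cube power4_eq_xxxx)
  have "m\<^sup>2 dvd 256 * (r ^ 4 + a * r ^ 3 + d)"
    unfolding id unfolding r sq using m(2) by (intro dvd_add dvd_mult2 dvd_power_same) auto
  moreover have "Rings.coprime (m\<^sup>2) 256"
  proof -
    have "Rings.coprime m 2" using m(1) by simp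
    hence "Rings.coprime (m\<^sup>2) (2 ^ 8)" by (simp only: coprime_power_left_iff coprime_power_right_iff) simp
    thus ?thesis by simp
  qed
  ultimately have "m\<^sup>2 dvd r ^ 4 + a * r ^ 3 + d" using coprime_dvd_mult_right_iff by blast
  moreover have "m dvd r\<^sup>2 * (4 * r + 3 * a)" unfolding r by (auto simp: power2_eq_square)
  ultimately show ?thesis by blast
qed

text \<open>\<open>nonmax\<close> is what \<open>monogenic_no_double_root\<close> says about this
  quartic. It reduces \<open>s\<close> to a power of 2 up to sign, and the equation 256 d = 27 a^4 +
  4^j is then divided by powers of 2, each time forcing another factor 2 out of \<open>a\<close> and
  of 4^j.\<close>

lemma quartic_square_discriminant:
  fixes a d s :: int
  assumes nonmax: "\<And>m r. m > 1 \<Longrightarrow> m\<^sup>2 dvd r ^ 4 + a * r ^ 3 + d \<Longrightarrow> m dvd r\<^sup>2 * (4 * r + 3 * a) \<Longrightarrow> False"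
    and sq: "256 * d - 27 * a ^ 4 = s\<^sup>2" and ad: "a * d \<noteq> 0"
  shows "\<exists>k. k \<noteq> 0 \<and> a = 4 * k \<and> d = 27 * k ^ 4 + 1 \<and> squarefree d"
proof -
  have not4: "\<not> m\<^sup>2 dvd d" if "m > 1" for m using nonmax[of m 0] that by auto
  have sqf: "squarefree d" unfolding squarefree_def
  proof (intro allI impI)
    fix x assume x: "x\<^sup>2 dvd d"
    hence "\<bar>x\<bar>\<^sup>2 dvd d" by simp
    hence "\<not> \<bar>x\<bar> > 1" using not4 by blast
    moreover have "x \<noteq> 0" using x ad by auto
    ultimately have "\<bar>x\<bar> = 1" by linarith
    thus "x dvd 1" by auto
  qed
  have no_odd: False if "odd m" "m dvd s" "m > 1" for m
    using quartic_double_root[OF sq that(1,2)] nonmax[OF that(3)] by blast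
  \<comment> \<open>Zero would be divisible by the odd number 3.\<close>
  have "s \<noteq> 0" using no_odd[of 3] by auto
  then obtain j m where jm: "s = 2 ^ j * m" "odd m" by (rule odd_part_int)
  have "\<not> \<bar>m\<bar> > 1" using no_odd[of "\<bar>m\<bar>"] jm by auto
  moreover have "m \<noteq> 0" using jm(2) by auto
  ultimately have "\<bar>m\<bar> = 1" by linarith
  hence "m\<^sup>2 = 1" by (metis power2_abs one_power2)
  moreover have "((2 :: int) ^ j)\<^sup>2 = (2\<^sup>2) ^ j" by (simp only: power_mult[symmetric] mult.commute)
  ultimately have s2: "s\<^sup>2 = 4 ^ j" unfolding jm by (simp add: power_mult_distrib)
  have eq: "256 * d = 27 * a ^ 4 + 4 ^ j" using sq s2 by simp
  \<comment> \<open>Here 27 (8 q + 1) + 1 = 4 (54 q + 7) is divisible by 4 but not by 8.\<close>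
  have odd_contra: False if b: "odd b" and x: "16 * x = 27 * b ^ 4 + 1" for b x :: int
  proof -
    obtain q where "b ^ 4 = 8 * q + 1" using odd_power4[OF b] .
    thus False using x even_neq_odd[of "2 * x" "27 * q + 3"] by simp
  qed
  have "even a"
  proof (rule ccontr)
    assume "\<not> even a"
    hence "odd (27 * a ^ 4)" by simp
    hence "odd ((4 :: int) ^ j)" using eq by (metis even_add even_mult_iff even_numeral)
    hence "j = 0" by (cases j) auto
    thus False using odd_contra[of a "16 * d"] eq \<open>\<not> even a\<close> by simp
  qed
  then obtain b where b: "a = 2 * b" by blast
  have eq2: "256 * d = 432 * b ^ 4 + 4 ^ j" using eq unfolding b by (simp add: power_mult_distrib)
  have "j \<ge> 2"
  proof (rule ccontr)
    assume "\<not> j \<ge> 2"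
    hence "j = 0 \<or> j = 1" by auto
    thus False using eq2 even_neq_odd[of "128 * d" "216 * b ^ 4"] even_neq_odd[of "32 * d" "54 * b ^ 4"]
      by auto
  qed
  then obtain i where i: "j = i + 2" by (metis add.commute le_iff_add)
  have eq3: "16 * d = 27 * b ^ 4 + 4 ^ i" using eq2 unfolding i by simp
  have "even b"
  proof (rule ccontr)
    assume "\<not> even b"
    hence "odd (27 * b ^ 4)" by simp
    hence "odd ((4 :: int) ^ i)" using eq3 by (metis even_add even_mult_iff even_numeral)
    hence "i = 0" by (cases i) auto
    thus False using odd_contra[of b d] eq3 \<open>\<not> even b\<close> by simp
  qed
  then obtain k where k: "b = 2 * k" by blast
  have eq4: "16 * d = 432 * k ^ 4 + 4 ^ i" using eq3 unfolding k by (simp add: power_mult_distrib)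
  have "i \<ge> 2"
  proof (rule ccontr)
    assume "\<not> i \<ge> 2"
    hence "i = 0 \<or> i = 1" by auto
    thus False using eq4 even_neq_odd[of "8 * d" "216 * k ^ 4"] even_neq_odd[of "2 * d" "54 * k ^ 4"]
      by auto
  qed
  then obtain h where h: "i = h + 2" by (metis add.commute le_iff_add)
  have eq5: "d = 27 * k ^ 4 + 4 ^ h" using eq4 unfolding h by simp
  have a: "a = 4 * k" using b k by simp
  \<comment> \<open>A remaining factor 4 makes f(0) = d divisible by 4 for even \<open>k\<close>,
    and f(-1) divisible by 4 for odd \<open>k\<close>; each contradicts \<open>nonmax\<close> at
    2.\<close>
  have "h = 0"
  proof (rule ccontr)
    assume "h \<noteq> 0"
    then obtain g where "h = Suc g" by (cases h) auto
    hence d: "d = 27 * k ^ 4 + 4 * 4 ^ g" using eq5 by simp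
    show False
    proof (cases "even k")
      case True
      then obtain l where "k = 2 * l" by blast
      hence "d = 2\<^sup>2 * (108 * l ^ 4 + 4 ^ g)" unfolding d by (simp add: power_mult_distrib)
      thus False using not4[of 2] by simp
    next
      case False
      obtain q where "k ^ 4 = 8 * q + 1" using odd_power4[OF False] .
      hence "(- 1) ^ 4 + a * (- 1) ^ 3 + d = 2\<^sup>2 * (7 - k + 54 * q + 4 ^ g)" unfolding a d by simp
      hence "2\<^sup>2 dvd (- 1) ^ 4 + a * (- 1) ^ 3 + d" by (metis dvd_triv_left)
      moreover have "2 dvd (- 1)\<^sup>2 * (4 * (- 1) + 3 * a)" unfolding a by simp
      ultimately show False using nonmax[of 2 "- 1"] by simp
    qed
  qed
  hence "d = 27 * k ^ 4 + 1" using eq5 by simp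
  moreover have "k \<noteq> 0" using a ad by auto
  ultimately show ?thesis using a sqf by blast
qed


section \<open>Extension of embeddings\<close>

definition embedding_on :: "complex set \<Rightarrow> (complex \<Rightarrow> complex) \<Rightarrow> bool" where
  "embedding_on F \<sigma> \<longleftrightarrow> \<sigma> 1 = 1 \<and>
     (\<forall>x\<in>F. \<forall>y\<in>F. \<sigma> (x + y) = \<sigma> x + \<sigma> y \<and> \<sigma> (x * y) = \<sigma> x * \<sigma> y)"

lemma embedding_onD:
  assumes "embedding_on F \<sigma>"
  shows "\<sigma> 1 = 1" "x \<in> F \<Longrightarrow> y \<in> F \<Longrightarrow> \<sigma> (x + y) = \<sigma> x + \<sigma> y"
    "x \<in> F \<Longrightarrow> y \<in> F \<Longrightarrow> \<sigma> (x * y) = \<sigma> x * \<sigma> y"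
  using assms unfolding embedding_on_def by auto

lemma algebraic_fieldD:
  assumes "algebraic_field F"
  shows "complex_subring F" "\<rat> \<subseteq> F"
  using assms unfolding algebraic_field_def by auto

lemma algebraic_field_subset:
  assumes "algebraic_field F" "complex_subring S" "\<rat> \<subseteq> S" "S \<subseteq> F"
  shows "algebraic_field S"
  using assms unfolding algebraic_field_def by blast

lemma embedding_on_0:
  assumes "algebraic_field F" "embedding_on F \<sigma>"
  shows "\<sigma> 0 = 0"
  using embedding_onD(2)[OF assms(2), of 0 0] complex_subringD(1)[OF algebraic_fieldD(1)[OF assms(1)]]
  by simp

lemma embedding_on_uminus:
  assumes "algebraic_field F" "embedding_on F \<sigma>" "x \<in> F"
  shows "\<sigma> (- x) = - \<sigma> x"
  using embedding_onD(2)[OF assms(2), of x "- x"] assms(3) embedding_on_0[OF assms(1,2)]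
    complex_subringD(3)[OF algebraic_fieldD(1)[OF assms(1)]]
  by (simp add: minus_unique)

lemma embedding_on_diff:
  assumes "algebraic_field F" "embedding_on F \<sigma>" "x \<in> F" "y \<in> F"
  shows "\<sigma> (x - y) = \<sigma> x - \<sigma> y"
  using embedding_onD(2)[OF assms(2), of x "- y"] assms(3,4) embedding_on_uminus[OF assms(1,2)]
    complex_subringD(3)[OF algebraic_fieldD(1)[OF assms(1)]]
  by simp

lemma embedding_on_eq_0_iff:
  assumes "algebraic_field F" "embedding_on F \<sigma>" "x \<in> F"
  shows "\<sigma> x = 0 \<longleftrightarrow> x = 0"
proof
  assume 0: "\<sigma> x = 0"
  show "x = 0"
  proof (rule ccontr)
    assume "x \<noteq> 0"
    hence "\<sigma> (x * inverse x) = \<sigma> x * \<sigma> (inverse x)"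
      using embedding_onD(3)[OF assms(2,3)] algebraic_field_inverse[OF assms(1,3)] by blast
    thus False using 0 \<open>x \<noteq> 0\<close> embedding_onD(1)[OF assms(2)] by simp
  qed
qed (use embedding_on_0[OF assms(1,2)] in simp)

lemma embedding_on_inj:
  assumes "algebraic_field F" "embedding_on F \<sigma>"
  shows "inj_on \<sigma> F"
proof (rule inj_onI)
  fix x y assume xy: "x \<in> F" "y \<in> F" "\<sigma> x = \<sigma> y"
  hence "\<sigma> (x - y) = 0" using embedding_on_diff[OF assms] by simp
  moreover have "x - y \<in> F" using complex_subringD(5)[OF algebraic_fieldD(1)[OF assms(1)]] xy by blast
  ultimately show "x = y" using embedding_on_eq_0_iff[OF assms] by simp
qed

lemma embedding_on_sum:
  assumes "algebraic_field F" "embedding_on F \<sigma>" "\<And>i. i \<in> A \<Longrightarrow> g i \<in> F"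
  shows "\<sigma> (\<Sum>i\<in>A. g i) = (\<Sum>i\<in>A. \<sigma> (g i))"
  using assms(3)
proof (induction A rule: infinite_finite_induct)
  case (insert i A)
  have "(\<Sum>i\<in>A. g i) \<in> F"
    using insert by (intro complex_subring_sum algebraic_fieldD(1)[OF assms(1)]) auto
  thus ?case using insert embedding_onD(2)[OF assms(2), of "g i" "\<Sum>i\<in>A. g i"] by simp
qed (use embedding_on_0[OF assms(1,2)] in simp_all)

lemma embedding_on_Rats:
  assumes F: "algebraic_field F" and \<sigma>: "embedding_on F \<sigma>" and q: "q \<in> \<rat>"
  shows "\<sigma> q = q"
proof -
  note Q = algebraic_fieldD(2)[OF F]
  have nat: "\<sigma> (of_nat n) = of_nat n" for n
  proof (induction n)
    case (Suc n)
    have "of_nat n \<in> F" "1 \<in> F" using Q by auto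
    thus ?case using Suc embedding_onD(1,2)[OF \<sigma>] by simp
  qed (use embedding_on_0[OF F \<sigma>] in simp)
  have int: "\<sigma> (of_int n) = of_int n" for n
  proof (cases n rule: int_cases2)
    case (nonpos m)
    have "of_nat m \<in> F" using Q by auto
    thus ?thesis using nonpos nat embedding_on_uminus[OF F \<sigma>] by simp
  qed (use nat in simp)
  obtain a b where ab: "b > 0" "q = of_int a / of_int b" using q by (auto elim: Rats_cases')
  have "\<sigma> (of_int b * q) = \<sigma> (of_int b) * \<sigma> q"
    by (rule embedding_onD(3)[OF \<sigma>]) (use Q q in auto)
  moreover have eq: "of_int b * q = of_int a" using ab by simp
  ultimately have "of_int b * \<sigma> q = of_int b * q" using int by metis
  thus ?thesis using ab(1) by simp
qed

lemma embedding_on_map_poly: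
  assumes F: "algebraic_field F" and \<sigma>: "embedding_on F \<sigma>"
    and p: "p \<in> polys_over F" and q: "q \<in> polys_over F"
  shows "map_poly \<sigma> (p - q) = map_poly \<sigma> p - map_poly \<sigma> q"
    "map_poly \<sigma> (p + q) = map_poly \<sigma> p + map_poly \<sigma> q"
    "map_poly \<sigma> (p * q) = map_poly \<sigma> p * map_poly \<sigma> q"
proof -
  note 0 = embedding_on_0[OF F \<sigma>]
  have c: "coeff p i \<in> F" "coeff q i \<in> F" for i using p q unfolding polys_over_def by auto
  note S = algebraic_fieldD(1)[OF F]
  show "map_poly \<sigma> (p - q) = map_poly \<sigma> p - map_poly \<sigma> q"
    by (rule poly_eqI) (simp add: coeff_map_poly 0 embedding_on_diff[OF F \<sigma>] c)
  show "map_poly \<sigma> (p + q) = map_poly \<sigma> p + map_poly \<sigma> q"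
    by (rule poly_eqI) (simp add: coeff_map_poly 0 embedding_onD(2)[OF \<sigma>] c)
  show "map_poly \<sigma> (p * q) = map_poly \<sigma> p * map_poly \<sigma> q"
  proof (rule poly_eqI)
    fix n
    have "\<sigma> (\<Sum>i\<le>n. coeff p i * coeff q (n - i)) = (\<Sum>i\<le>n. \<sigma> (coeff p i * coeff q (n - i)))"
      by (rule embedding_on_sum[OF F \<sigma>]) (intro complex_subringD(6)[OF S] c)
    also have "\<dots> = (\<Sum>i\<le>n. \<sigma> (coeff p i) * \<sigma> (coeff q (n - i)))"
      by (intro sum.cong refl embedding_onD(3)[OF \<sigma>] c)
    finally show "coeff (map_poly \<sigma> (p * q)) n = coeff (map_poly \<sigma> p * map_poly \<sigma> q) n"
      by (simp add: coeff_map_poly 0 coeff_mult)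
  qed
qed

lemma embedding_on_poly:
  assumes F: "algebraic_field F" and \<sigma>: "embedding_on F \<sigma>" and p: "p \<in> polys_over F" and x: "x \<in> F"
  shows "poly (map_poly \<sigma> p) (\<sigma> x) = \<sigma> (poly p x)"
  using p
proof (induction p)
  case 0
  show ?case using embedding_on_0[OF F \<sigma>] by simp
next
  case (pCons a p)
  have a: "a \<in> F" and p: "p \<in> polys_over F" using pCons.prems by (simp_all add: polys_over_pCons)
  note S = algebraic_fieldD(1)[OF F]
  have px: "poly p x \<in> F" "x * poly p x \<in> F" using poly_in_subring[OF S p x] x complex_subringD(6)[OF S] by auto
  have "map_poly \<sigma> (pCons a p) = pCons (\<sigma> a) (map_poly \<sigma> p)"
    using embedding_on_0[OF F \<sigma>] by (intro poly_eqI) (simp add: coeff_map_poly coeff_pCons split: nat.split)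
  thus ?case using pCons.IH[OF p] a x px by (simp add: embedding_onD(2,3)[OF \<sigma>])
qed

lemma embedding_on_poly_Rats:
  assumes F: "algebraic_field F" and \<sigma>: "embedding_on F \<sigma>" and p: "p \<in> polys_over \<rat>" and x: "x \<in> F"
  shows "poly p (\<sigma> x) = \<sigma> (poly p x)"
proof -
  have "map_poly \<sigma> p = p"
    using p embedding_on_0[OF F \<sigma>] embedding_on_Rats[OF F \<sigma>]
    by (intro poly_eqI) (auto simp: coeff_map_poly polys_over_def)
  thus ?thesis
    using embedding_on_poly[OF F \<sigma> polys_over_mono[OF algebraic_fieldD(2)[OF F] p] x] by simp
qed

text \<open>The extension sends p(a) to the value at \<open>b\<close> of the transported polynomial.
  The hypothesis \<open>conj\<close> says exactly that this does not depend on the \<open>p\<close>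
  chosen by \<open>SOME\<close>.\<close>

lemma embedding_on_extend:
  assumes F: "algebraic_field F" and \<sigma>: "embedding_on F \<sigma>"
    and conj: "\<And>p. p \<in> polys_over F \<Longrightarrow> poly p a = 0 \<Longrightarrow> poly (map_poly \<sigma> p) b = 0"
  obtains \<tau> where "embedding_on (adjoin_ring F a) \<tau>" "\<And>x. x \<in> F \<Longrightarrow> \<tau> x = \<sigma> x" "\<tau> a = b"
proof -
  note S = algebraic_fieldD(1)[OF F] and 0 = embedding_on_0[OF F \<sigma>]
  define \<tau> where "\<tau> x = poly (map_poly \<sigma> (SOME p. p \<in> polys_over F \<and> x = poly p a)) b" for x
  have \<tau>: "\<tau> (poly p a) = poly (map_poly \<sigma> p) b" if p: "p \<in> polys_over F" for p
  proof -
    define q where "q = (SOME q. q \<in> polys_over F \<and> poly p a = poly q a)"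
    have q: "q \<in> polys_over F" "poly p a = poly q a"
      using someI[of "\<lambda>q. q \<in> polys_over F \<and> poly p a = poly q a" p] p unfolding q_def by auto
    have "poly (map_poly \<sigma> (p - q)) b = 0"
      using q p by (intro conj polys_over_closed(8)[OF S]) auto
    thus ?thesis using embedding_on_map_poly(1)[OF F \<sigma> p q(1)] unfolding \<tau>_def q_def[symmetric] by simp
  qed
  have const: "\<tau> x = \<sigma> x" if "x \<in> F" for x
  proof -
    have "map_poly \<sigma> [:x:] = [:\<sigma> x:]"
      using 0 by (intro poly_eqI) (simp add: coeff_map_poly coeff_pCons split: nat.split)
    thus ?thesis using \<tau>[of "[:x:]"] polys_over_closed(3)[OF S that] by simp
  qed
  have "embedding_on (adjoin_ring F a) \<tau>"
    unfolding embedding_on_def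
  proof (intro conjI ballI)
    show "\<tau> 1 = 1" using const[of 1] complex_subringD(2)[OF S] embedding_onD(1)[OF \<sigma>] by simp
    fix x y assume "x \<in> adjoin_ring F a" "y \<in> adjoin_ring F a"
    then obtain p q where pq: "p \<in> polys_over F" "q \<in> polys_over F" "x = poly p a" "y = poly q a"
      by (metis adjoin_ringE)
    show "\<tau> (x + y) = \<tau> x + \<tau> y" "\<tau> (x * y) = \<tau> x * \<tau> y"
      using \<tau>[of "p + q"] \<tau>[of "p * q"] \<tau>[of p] \<tau>[of q] pq polys_over_closed(7,9)[OF S pq(1,2)]
        embedding_on_map_poly(2,3)[OF F \<sigma> pq(1,2)] by simp_all
  qed
  moreover have "\<tau> a = b"
  proof -
    have "map_poly \<sigma> [:0, 1:] = [:0, 1:]"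
      using 0 embedding_onD(1)[OF \<sigma>]
      by (intro poly_eqI) (simp add: coeff_map_poly coeff_pCons split: nat.split)
    moreover have "[:0, 1:] \<in> polys_over F"
      using complex_subringD(1,2)[OF S] by (simp add: polys_over_pCons polys_over_closed(1)[OF S])
    ultimately show ?thesis using \<tau>[of "[:0, 1:]"] by simp
  qed
  ultimately show ?thesis using that const by blast
qed

text \<open>The image \<open>b\<close> is a root of the transported minimal polynomial of \<open>a\<close> over \<open>F\<close>.\<close>

lemma embedding_on_conjugate:
  assumes F: "algebraic_field F" and \<sigma>: "embedding_on F \<sigma>" and a: "algebraic_int a"
  obtains b where "\<And>p. p \<in> polys_over F \<Longrightarrow> poly p a = 0 \<Longrightarrow> poly (map_poly \<sigma> p) b = 0"
proof -
  note S = algebraic_fieldD(1)[OF F]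
  define P where "P = {p \<in> polys_over F. p \<noteq> 0 \<and> poly p a = 0}"
  obtain g where g: "lead_coeff g = 1" "\<forall>i. coeff g i \<in> \<int>" "poly g a = 0"
    using a by (auto elim: algebraic_int.cases)
  have "g \<in> polys_over \<rat>" using g(2) polys_over_Rats[of g] by (simp add: polys_over_def)
  hence "g \<in> P" using g polys_over_mono[OF algebraic_fieldD(2)[OF F]] unfolding P_def by auto
  then obtain m0 where m0: "m0 \<in> P" "\<And>p. p \<in> P \<Longrightarrow> degree m0 \<le> degree p"
    using exists_least_iff[of "\<lambda>n. \<exists>p\<in>P. degree p = n"] by (metis not_le)
  \<comment> \<open>A nonzero polynomial of least degree over \<open>F\<close> vanishing at
    \<open>a\<close>, made monic: \<open>F\<close> contains the inverse of the leading coefficient.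
    As \<open>\<sigma>\<close> maps 1 to 1, transport keeps the degree, so a complex root
    \<open>b\<close> exists.\<close>
  define m where "m = smult (inverse (lead_coeff m0)) m0"
  have lc: "lead_coeff m0 \<in> F" "lead_coeff m0 \<noteq> 0" using m0(1) unfolding P_def polys_over_def by auto
  have m: "m \<in> polys_over F" "lead_coeff m = 1" "poly m a = 0" "degree m = degree m0"
    using m0(1) lc polys_over_closed(10)[OF S algebraic_field_inverse[OF F lc]]
    unfolding m_def P_def by auto
  have min: "p = 0" if "p \<in> polys_over F" "poly p a = 0" "degree p < degree m" for p
    using m0(2)[of p] that m(4) unfolding P_def by force
  have "degree m > 0"
  proof (rule ccontr)
    assume "\<not> degree m > 0"
    then obtain c where "m = [:c:]" by (metis degree_eq_zeroE gr0I)
    thus False using m(2,3) by simp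
  qed
  have "\<sigma> (lead_coeff m) \<noteq> 0" using m(2) embedding_onD(1)[OF \<sigma>] by simp
  hence "degree (map_poly \<sigma> m) = degree m" by (rule map_poly_degree_eq)
  hence "\<not> constant (poly (map_poly \<sigma> m))" using \<open>degree m > 0\<close> by (simp add: constant_degree)
  then obtain b where b: "poly (map_poly \<sigma> m) b = 0" using fundamental_theorem_of_algebra by blast
  have "poly (map_poly \<sigma> p) b = 0" if p: "p \<in> polys_over F" "poly p a = 0" for p
  proof -
    obtain q r where qr: "q \<in> polys_over F" "r \<in> polys_over F" "p = m * q + r" "degree r < degree m"
      using monic_division[OF S m(1,2) \<open>degree m > 0\<close> p(1)] .
    have "poly r a = 0" using p(2) m(3) qr(3) by simp
    hence "r = 0" using min qr by blast
    thus ?thesis using qr(3) embedding_on_map_poly(3)[OF F \<sigma> m(1) qr(1)] b by simp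
  qed
  thus ?thesis using that by blast
qed

text \<open>One generator is adjoined at a time. The last conjunct, minimality of \<open>E\<close>
  among complex subrings, is what later identifies \<open>E\<close> with the splitting
  field.\<close>

lemma embedding_on_extend_finite:
  assumes "finite A" "\<And>a. a \<in> A \<Longrightarrow> algebraic_int a" "algebraic_field F" "embedding_on F \<sigma>"
  shows "\<exists>E \<tau>. algebraic_field E \<and> embedding_on E \<tau> \<and> F \<subseteq> E \<and> A \<subseteq> E \<and> (\<forall>x\<in>F. \<tau> x = \<sigma> x) \<and>
     (\<forall>L. complex_subring L \<and> F \<subseteq> L \<and> A \<subseteq> L \<longrightarrow> E \<subseteq> L)"
  using assms
proof (induction A arbitrary: F \<sigma> rule: finite_induct)
  case empty
  thus ?case by blast
next
  case (insert a A)
  have a: "algebraic_int a" using insert.prems(1) by blast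
  obtain b where "\<And>p. p \<in> polys_over F \<Longrightarrow> poly p a = 0 \<Longrightarrow> poly (map_poly \<sigma> p) b = 0"
    using embedding_on_conjugate[OF insert.prems(2,3) a] by blast
  then obtain \<tau> where \<tau>: "embedding_on (adjoin_ring F a) \<tau>" "\<And>x. x \<in> F \<Longrightarrow> \<tau> x = \<sigma> x"
    using embedding_on_extend[OF insert.prems(2,3), of a b] by metis
  note S = algebraic_fieldD(1)[OF insert.prems(2)]
  have "algebraic_field (adjoin_ring F a)" by (rule algebraic_field_adjoin_ring[OF insert.prems(2) a])
  then obtain E \<tau>' where E: "algebraic_field E" "embedding_on E \<tau>'" "adjoin_ring F a \<subseteq> E" "A \<subseteq> E"
    "\<forall>x\<in>adjoin_ring F a. \<tau>' x = \<tau> x"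
    "\<forall>L. complex_subring L \<and> adjoin_ring F a \<subseteq> L \<and> A \<subseteq> L \<longrightarrow> E \<subseteq> L"
    using insert.IH[of "adjoin_ring F a" \<tau>] insert.prems(1) \<tau>(1) by (metis insertI2)
  have sub: "F \<subseteq> adjoin_ring F a" "a \<in> adjoin_ring F a"
    using adjoin_ring_base[OF S] adjoin_ring_generator[OF S] by auto
  have min: "E \<subseteq> L" if L: "complex_subring L" "F \<subseteq> L" "insert a A \<subseteq> L" for L
    using E(6) L adjoin_ring_subset[OF L(1,2), of a] by blast
  show ?case using E(1-5) sub \<tau>(2) min by (intro exI[of _ E] exI[of _ \<tau>']) auto
qed

section \<open>The Galois group\<close>

lemma Gal_carrier_iff:
  fixes f :: "int poly"
  defines "L \<equiv> splitting_field f"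
  assumes L: "algebraic_field L"
  shows "\<sigma> \<in> carrier (Gal f) \<longleftrightarrow> \<sigma> \<in> extensional L \<and> bij_betw \<sigma> L L \<and> embedding_on L \<sigma>"
proof -
  have "\<sigma> \<in> carrier (Gal f) \<longleftrightarrow> \<sigma> \<in> extensional L \<and> bij_betw \<sigma> L L \<and> embedding_on L \<sigma> \<and> (\<forall>x\<in>\<rat>. \<sigma> x = x)"
    unfolding Gal_def galois_group_def L_def[symmetric] Bij_def ring_iso_def Ring.ring_hom_def
      subfield_ring_def embedding_on_def
    by (auto simp: complex_ring_simps dest: bij_betwE)
  thus ?thesis using embedding_on_Rats[OF L] by blast
qed

lemma Gal_mult:
  assumes "\<sigma> \<in> carrier (Gal f)" "\<tau> \<in> carrier (Gal f)"
  shows "\<sigma> \<otimes>\<^bsub>Gal f\<^esub> \<tau> = compose (splitting_field f) \<sigma> \<tau>"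
  using assms unfolding Gal_def galois_group_def by (simp add: BijGroup_def)

lemma Gal_one: "\<one>\<^bsub>Gal f\<^esub> = restrict (\<lambda>x. x) (splitting_field f)"
  unfolding Gal_def galois_group_def by (simp add: BijGroup_def)

text \<open>The identity of \<open>\<rat>\<close> is extended only to obtain the field
  \<open>E\<close>. It is an \<open>algebraic_field\<close> containing the roots, and by minimality
  it lies in every complex subring that does, so it equals the splitting field.\<close>

lemma algebraic_field_splitting_field:
  assumes lc: "lead_coeff f = 1"
  shows "algebraic_field (splitting_field f)"
proof -
  have "(map_poly of_int f :: complex poly) \<noteq> 0" using lc by auto
  hence fin: "finite (complex_roots f)" unfolding complex_roots_def using poly_roots_finite by blast
  have "embedding_on \<rat> (\<lambda>x. x)" unfolding embedding_on_def by simp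
  then obtain E where E: "algebraic_field E" "\<rat> \<subseteq> E" "complex_roots f \<subseteq> E"
    "\<forall>L. complex_subring L \<and> \<rat> \<subseteq> L \<and> complex_roots f \<subseteq> L \<longrightarrow> E \<subseteq> L"
    using embedding_on_extend_finite[OF fin algebraic_int_root_monic[OF lc] algebraic_field_Rats] by blast
  have "E \<subseteq> splitting_field f" using E(4) complex_subring_adjoin subset_adjoin
    unfolding splitting_field_def by blast
  moreover have "splitting_field f \<subseteq> E" unfolding splitting_field_def using adjoin_least[OF E(1,3)] .
  ultimately show ?thesis using E(1) by simp
qed

lemma complex_roots_subset_splitting_field: "complex_roots f \<subseteq> splitting_field f"
  unfolding splitting_field_def by (rule subset_adjoin)

lemma embedding_permutes_roots:
  assumes lc: "lead_coeff f = 1" and \<sigma>: "embedding_on (splitting_field f) \<sigma>"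
  shows "bij_betw \<sigma> (complex_roots f) (complex_roots f)"
proof -
  note F = algebraic_field_splitting_field[OF lc]
  note R = complex_roots_subset_splitting_field[of f]
  have "(map_poly of_int f :: complex poly) \<noteq> 0" using lc by auto
  hence fin: "finite (complex_roots f)" unfolding complex_roots_def using poly_roots_finite by blast
  have "\<sigma> ` complex_roots f \<subseteq> complex_roots f"
  proof clarify
    fix r assume r: "r \<in> complex_roots f"
    have "poly (map_poly of_int f) (\<sigma> r) = \<sigma> (poly (map_poly of_int f) r)"
      by (rule embedding_on_poly_Rats[OF F \<sigma>]) (use r R in \<open>auto intro: polys_over_Rats\<close>)
    thus "\<sigma> r \<in> complex_roots f" using r embedding_on_0[OF F \<sigma>] unfolding complex_roots_def by simp
  qed
  moreover have "inj_on \<sigma> (complex_roots f)"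
    using embedding_on_inj[OF F \<sigma>] R inj_on_subset by blast
  ultimately show ?thesis using endo_inj_surj[OF fin] unfolding bij_betw_def by blast
qed

text \<open>Both the elements mapped into the splitting field and the image of the field are
  algebraic fields containing all roots, which are merely permuted; by \<open>adjoin_least\<close>
  each contains the splitting field.\<close>

lemma embedding_of_splitting_field_bij:
  assumes lc: "lead_coeff f = 1" and \<sigma>: "embedding_on (splitting_field f) \<sigma>"
  shows "bij_betw \<sigma> (splitting_field f) (splitting_field f)"
proof -
  let ?L = "splitting_field f" and ?R = "complex_roots f"
  note F = algebraic_field_splitting_field[OF lc]
  note S = algebraic_fieldD(1)[OF F] and Q = algebraic_fieldD(2)[OF F]
  note R = complex_roots_subset_splitting_field[of f]
  note perm = embedding_permutes_roots[OF lc \<sigma>]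
  note hom = embedding_onD[OF \<sigma>] embedding_on_uminus[OF F \<sigma>]
  have "algebraic_field {x\<in>?L. \<sigma> x \<in> ?L}"
  proof (rule algebraic_field_subset[OF F])
    show "complex_subring {x\<in>?L. \<sigma> x \<in> ?L}"
      unfolding complex_subring_def using complex_subringD[OF S] hom by auto
    show "\<rat> \<subseteq> {x\<in>?L. \<sigma> x \<in> ?L}" using Q embedding_on_Rats[OF F \<sigma>] by auto
  qed auto
  moreover have "?R \<subseteq> {x\<in>?L. \<sigma> x \<in> ?L}" using R perm bij_betwE by fastforce
  ultimately have into: "?L \<subseteq> {x\<in>?L. \<sigma> x \<in> ?L}"
    using adjoin_least unfolding splitting_field_def by metis
  have "algebraic_field (\<sigma> ` ?L)"
  proof (rule algebraic_field_subset[OF F])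
    show "complex_subring (\<sigma> ` ?L)"
      unfolding complex_subring_def
    proof (intro conjI ballI)
      show "1 \<in> \<sigma> ` ?L" using hom(1) complex_subringD(2)[OF S] by (metis image_eqI)
      fix x assume "x \<in> \<sigma> ` ?L"
      then obtain x' where x: "x' \<in> ?L" "x = \<sigma> x'" by blast
      show "- x \<in> \<sigma> ` ?L"
        using x hom(4)[of x'] complex_subringD(3)[OF S] by (metis image_eqI)
      fix y assume "y \<in> \<sigma> ` ?L"
      then obtain y' where y: "y' \<in> ?L" "y = \<sigma> y'" by blast
      show "x + y \<in> \<sigma> ` ?L" "x * y \<in> \<sigma> ` ?L"
        using x y hom(2,3)[of x' y'] complex_subringD(4,6)[OF S, of x' y'] by (metis image_eqI)+
    qed
    show "\<rat> \<subseteq> \<sigma> ` ?L" using Q embedding_on_Rats[OF F \<sigma>] by (metis image_eqI subset_iff)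
  qed (use into in auto)
  moreover have "?R \<subseteq> \<sigma> ` ?L" using perm R unfolding bij_betw_def by blast
  ultimately have "?L \<subseteq> \<sigma> ` ?L" using adjoin_least unfolding splitting_field_def by metis
  thus ?thesis using into embedding_on_inj[OF F \<sigma>] unfolding bij_betw_def by blast
qed

text \<open>Since \<open>y\<close> satisfies every rational equation of \<open>x\<close>, there is
  an embedding of Q[x] with \<open>x\<close> going to \<open>y\<close>; adjoining the roots of
  \<open>f\<close> extends it to the splitting field, where embeddings are bijective.\<close>

theorem Gal_conjugate:
  assumes lc: "lead_coeff f = 1" and x: "x \<in> splitting_field f" "algebraic_int x"
    and conj: "\<And>p. p \<in> polys_over \<rat> \<Longrightarrow> poly p x = 0 \<Longrightarrow> poly p y = 0"
  obtains \<sigma> where "\<sigma> \<in> carrier (Gal f)" "\<sigma> x = y"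
proof -
  let ?L = "splitting_field f"
  note F = algebraic_field_splitting_field[OF lc]
  have "(map_poly of_int f :: complex poly) \<noteq> 0" using lc by auto
  hence fin: "finite (complex_roots f)" unfolding complex_roots_def using poly_roots_finite by blast
  have "embedding_on \<rat> (\<lambda>x. x)" unfolding embedding_on_def by simp
  moreover have "map_poly (\<lambda>x. x) p = p" for p :: "complex poly" by (rule poly_eqI) (simp add: coeff_map_poly)
  ultimately obtain \<tau> where \<tau>: "embedding_on (adjoin_ring \<rat> x) \<tau>" "\<tau> x = y"
    using embedding_on_extend[OF algebraic_field_Rats, of "\<lambda>x. x" x y] conj by metis
  have "algebraic_field (adjoin_ring \<rat> x)" by (rule algebraic_field_adjoin_ring[OF algebraic_field_Rats x(2)])
  then obtain E \<sigma> where E: "algebraic_field E" "embedding_on E \<sigma>" "adjoin_ring \<rat> x \<subseteq> E"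
    "complex_roots f \<subseteq> E" "\<forall>z\<in>adjoin_ring \<rat> x. \<sigma> z = \<tau> z"
    "\<forall>L. complex_subring L \<and> adjoin_ring \<rat> x \<subseteq> L \<and> complex_roots f \<subseteq> L \<longrightarrow> E \<subseteq> L"
    using embedding_on_extend_finite[OF fin algebraic_int_root_monic[OF lc] _ \<tau>(1)] by blast
  have "adjoin_ring \<rat> x \<subseteq> ?L"
    using adjoin_ring_subset[OF algebraic_fieldD[OF F] x(1)] .
  hence "E \<subseteq> ?L" using E(6) algebraic_fieldD(1)[OF F] complex_roots_subset_splitting_field by blast
  moreover have "?L \<subseteq> E" unfolding splitting_field_def using adjoin_least[OF E(1,4)] .
  ultimately have EL: "E = ?L" by blast
  \<comment> \<open>Elements of the Galois group must be \<open>undefined\<close> outside the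
    splitting field.\<close>
  define \<rho> where "\<rho> = restrict \<sigma> ?L"
  note S = algebraic_fieldD(1)[OF F]
  have emb: "embedding_on ?L \<rho>"
    using E(2) unfolding EL embedding_on_def \<rho>_def by (auto simp: complex_subringD[OF S])
  moreover have "\<rho> \<in> extensional ?L" unfolding \<rho>_def by simp
  ultimately have "\<rho> \<in> carrier (Gal f)"
    unfolding Gal_carrier_iff[OF F] using embedding_of_splitting_field_bij[OF lc emb] by blast
  moreover have "\<rho> x = y" using x(1) E(5) adjoin_ring_generator[OF complex_subring_Rats] \<tau>(2)
    unfolding \<rho>_def by simp
  ultimately show ?thesis using that by blast
qed


section \<open>The discriminant and even permutations\<close>

lemma Gal_closed:
  assumes lc: "lead_coeff f = 1" and st: "\<sigma> \<in> carrier (Gal f)" "\<tau> \<in> carrier (Gal f)"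
  shows "\<sigma> \<otimes>\<^bsub>Gal f\<^esub> \<tau> \<in> carrier (Gal f)"
proof -
  let ?L = "splitting_field f"
  note F = algebraic_field_splitting_field[OF lc]
  note S = complex_subringD[OF algebraic_fieldD(1)[OF F]]
  have *: "\<sigma> \<in> extensional ?L" "bij_betw \<sigma> ?L ?L" "embedding_on ?L \<sigma>"
    "\<tau> \<in> extensional ?L" "bij_betw \<tau> ?L ?L" "embedding_on ?L \<tau>"
    using st unfolding Gal_carrier_iff[OF F] by auto
  have "\<tau> x \<in> ?L" if "x \<in> ?L" for x using *(5) that by (rule bij_betw_apply)
  hence "embedding_on ?L (compose ?L \<sigma> \<tau>)"
    using *(3,6) S unfolding embedding_on_def compose_def by simp
  moreover have "bij_betw (compose ?L \<sigma> \<tau>) ?L ?L" using *(2,5) by (metis bij_betw_compose)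
  ultimately show ?thesis unfolding Gal_mult[OF st] Gal_carrier_iff[OF F] by simp
qed

text \<open>A square root of the discriminant of the polynomial with roots t 1, ..., t 4. The
  indices match the set {1..4} permuted by \<open>alt_group 4\<close>.\<close>

definition vandermonde4 :: "(nat \<Rightarrow> complex) \<Rightarrow> complex" where
  "vandermonde4 t = (t 1 - t 2) * (t 1 - t 3) * (t 1 - t 4) * (t 2 - t 3) * (t 2 - t 4) * (t 3 - t 4)"

lemma vandermonde4_transpose:
  assumes "i \<in> {1..4}" "j \<in> {1..4}" "i \<noteq> j"
  shows "vandermonde4 (t \<circ> Transposition.transpose i j) = - vandermonde4 t"
proof -
  have "k = 1 \<or> k = 2 \<or> k = 3 \<or> k = 4" if "k \<in> {1..4}" for k :: nat
    using that unfolding atLeastAtMost_iff by linarith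
  note cases = this[OF assms(1)] this[OF assms(2)] assms(3)
  have flip: "t 2 - t 1 = - (t 1 - t 2)" "t 3 - t 1 = - (t 1 - t 3)" "t 4 - t 1 = - (t 1 - t 4)"
    "t 3 - t 2 = - (t 2 - t 3)" "t 4 - t 2 = - (t 2 - t 4)" "t 4 - t 3 = - (t 3 - t 4)" by simp_all
  from cases show ?thesis
    by (elim disjE; hypsubst;
        simp add: vandermonde4_def Transposition.transpose_def del: One_nat_def;
        simp only: flip mult_minus_left mult_minus_right minus_minus mult_ac)
qed

lemma vandermonde4_permutes:
  assumes "p permutes {1..4}"
  shows "vandermonde4 (t \<circ> p) = of_int (sign p) * vandermonde4 t"
proof -
  \<comment> \<open>The quantifier lets the induction hypothesis be applied to \<open>t\<close>
    composed with a transposition.\<close>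
  have "\<forall>t. vandermonde4 (t \<circ> p) = of_int (sign p) * vandermonde4 t"
    using assms finite_atLeastAtMost
  proof (induction p rule: permutes_induct)
    case id
    show ?case by simp
  next
    case (swap a b p)
    have "permutation p" using swap by (auto simp: permutation_permutes)
    hence "sign (Transposition.transpose a b \<circ> p) = - sign p"
      using swap by (simp add: sign_compose permutation_swap_id sign_swap_id)
    moreover have "vandermonde4 (t \<circ> (Transposition.transpose a b \<circ> p)) =
        of_int (sign p) * - vandermonde4 t" for t
      using swap.IH vandermonde4_transpose[OF swap.hyps(1-3), of t] by (metis comp_assoc)
    ultimately show ?case by (metis mult_minus_left mult_minus_right of_int_minus)
  qed
  thus ?thesis by blast
qed

lemma quartic_vieta:
  fixes a d :: complex
  assumes "[:d, 0, 0, a, 1:] = [:- x, 1:] * [:- y, 1:] * [:- z, 1:] * [:- w, 1:]"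
  shows "x + y + z + w = - a" "x * y + x * z + x * w + y * z + y * w + z * w = 0"
    "x * y * z + x * y * w + x * z * w + y * z * w = 0" "x * y * z * w = d"
proof -
  have "[:- x, 1:] * [:- y, 1:] * [:- z, 1:] * [:- w, 1:] =
      [:x * y * z * w, - (x * y * z + x * y * w + x * z * w + y * z * w),
        x * y + x * z + x * w + y * z + y * w + z * w, - (x + y + z + w), 1:]"
    by (simp add: ring_distribs mult_ac add_ac)
  with assms have "d = x * y * z * w" "0 = - (x * y * z + x * y * w + x * z * w + y * z * w)"
    "0 = x * y + x * z + x * w + y * z + y * w + z * w" "a = - (x + y + z + w)"
    by (simp_all only: pCons_eq_iff)
  thus "x + y + z + w = - a" "x * y + x * z + x * w + y * z + y * w + z * w = 0"
    "x * y * z + x * y * w + x * z * w + y * z * w = 0" "x * y * z * w = d"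
    by (simp_all only: neg_0_equal_iff_equal minus_minus)
qed

text \<open>The discriminant of a quartic is the product of f'(t i), and f' = x^2 (4x + 3a). The
  factors t i contribute d^2, the linear factors 256 f(-3a/4).\<close>

lemma vandermonde4_square:
  fixes a d :: complex
  assumes f: "[:d, 0, 0, a, 1:] = [:- t 1, 1:] * [:- t 2, 1:] * [:- t 3, 1:] * [:- t 4, 1:]"
  shows "(vandermonde4 t)\<^sup>2 = d\<^sup>2 * (256 * d - 27 * a ^ 4)"
proof -
  \<comment> \<open>This is f'(x) as a product of root differences; Vieta expresses the symmetric
    functions of the other three roots through \<open>x\<close> and \<open>a\<close>.\<close>
  have deriv: "(x - y) * (x - z) * (x - w) = x\<^sup>2 * (4 * x + 3 * a)"
    if "x + y + z + w = - a" "x * y + x * z + x * w + y * z + y * w + z * w = 0"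
      "x * y * z + x * y * w + x * z * w + y * z * w = 0" for x y z w
  proof -
    have p: "y + z + w = - a - x" using that(1) by (simp add: algebra_simps)
    have "y * z + y * w + z * w = - x * (y + z + w)"
      using that(2) by (simp add: algebra_simps eq_neg_iff_add_eq_0)
    hence q: "y * z + y * w + z * w = x * (a + x)" unfolding p by (simp add: algebra_simps)
    have "y * z * w = - x * (y * z + y * w + z * w)"
      using that(3) by (simp add: algebra_simps eq_neg_iff_add_eq_0)
    hence r: "y * z * w = - x * (x * (a + x))" unfolding q .
    have "(x - y) * (x - z) * (x - w) = x ^ 3 - x\<^sup>2 * (y + z + w) + x * (y * z + y * w + z * w) - y * z * w"
      by (simp add: algebra_simps power2_eq_square power3_eq_cube)
    also have "\<dots> = x\<^sup>2 * (4 * x + 3 * a)"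
      unfolding p q r by (simp add: algebra_simps power2_eq_square power3_eq_cube)
    finally show ?thesis .
  qed
  note v = quartic_vieta[OF f]
  define c where "c = - 3 * a / 4"
  have c: "3 * a = - 4 * c" unfolding c_def by simp
  have "poly [:d, 0, 0, a, 1:] c = (c - t 1) * (c - t 2) * (c - t 3) * (c - t 4)"
    unfolding f by (simp only: poly_mult) simp
  moreover have "256 * poly [:d, 0, 0, a, 1:] c = 256 * d - 27 * a ^ 4"
    unfolding c_def by (simp add: field_simps power4_eq_xxxx)
  moreover have lin: "4 * u + 3 * a = - 4 * (c - u)" for u unfolding c by simp
  have "(- 4 * A) * (- 4 * B) * (- 4 * C) * (- 4 * D) = 256 * (A * B * C * D)" for A B C D :: complex
    by simp
  hence "(4 * t 1 + 3 * a) * (4 * t 2 + 3 * a) * (4 * t 3 + 3 * a) * (4 * t 4 + 3 * a)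
      = 256 * ((c - t 1) * (c - t 2) * (c - t 3) * (c - t 4))"
    unfolding lin .
  ultimately have prod: "(4 * t 1 + 3 * a) * (4 * t 2 + 3 * a) * (4 * t 3 + 3 * a) * (4 * t 4 + 3 * a)
      = 256 * d - 27 * a ^ 4" by metis
  \<comment> \<open>Each of the six differences occurs once in either orientation; the six signs
    multiply to 1.\<close>
  have "(vandermonde4 t)\<^sup>2 =
      ((t 1 - t 2) * (t 1 - t 3) * (t 1 - t 4)) * ((t 2 - t 1) * (t 2 - t 3) * (t 2 - t 4)) *
      ((t 3 - t 1) * (t 3 - t 2) * (t 3 - t 4)) * ((t 4 - t 1) * (t 4 - t 2) * (t 4 - t 3))"
  proof -
    have "(A * B * C * D * E * G)\<^sup>2 = (A * B * C) * (- A * D * E) * (- B * - D * G) * (- C * - E * - G)"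
      for A B C D E G :: complex by (simp add: power2_eq_square mult_ac)
    from this[of "t 1 - t 2" "t 1 - t 3" "t 1 - t 4" "t 2 - t 3" "t 2 - t 4" "t 3 - t 4"]
    show ?thesis unfolding vandermonde4_def minus_diff_eq .
  qed
  also have "(t 1 - t 2) * (t 1 - t 3) * (t 1 - t 4) = (t 1)\<^sup>2 * (4 * t 1 + 3 * a)"
    by (rule deriv; use v in \<open>simp add: add_ac mult_ac\<close>)
  also have "(t 2 - t 1) * (t 2 - t 3) * (t 2 - t 4) = (t 2)\<^sup>2 * (4 * t 2 + 3 * a)"
    by (rule deriv; use v in \<open>simp add: add_ac mult_ac\<close>)
  also have "(t 3 - t 1) * (t 3 - t 2) * (t 3 - t 4) = (t 3)\<^sup>2 * (4 * t 3 + 3 * a)"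
    by (rule deriv; use v in \<open>simp add: add_ac mult_ac\<close>)
  also have "(t 4 - t 1) * (t 4 - t 2) * (t 4 - t 3) = (t 4)\<^sup>2 * (4 * t 4 + 3 * a)"
    by (rule deriv; use v in \<open>simp add: add_ac mult_ac\<close>)
  also have "(t 1)\<^sup>2 * (4 * t 1 + 3 * a) * ((t 2)\<^sup>2 * (4 * t 2 + 3 * a)) *
      ((t 3)\<^sup>2 * (4 * t 3 + 3 * a)) * ((t 4)\<^sup>2 * (4 * t 4 + 3 * a)) =
      (t 1 * t 2 * t 3 * t 4)\<^sup>2 * ((4 * t 1 + 3 * a) * (4 * t 2 + 3 * a) * (4 * t 3 + 3 * a) * (4 * t 4 + 3 * a))"
    by (simp add: power_mult_distrib mult_ac)
  also have "\<dots> = d\<^sup>2 * (256 * d - 27 * a ^ 4)" unfolding prod v(4) ..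
  finally show ?thesis .
qed

lemma embedding_vandermonde4:
  assumes F: "algebraic_field F" and \<sigma>: "embedding_on F \<sigma>" and t: "\<And>i. i \<in> {1..4} \<Longrightarrow> t i \<in> F"
  shows "\<sigma> (vandermonde4 t) = vandermonde4 (\<sigma> \<circ> t)" "vandermonde4 t \<in> F"
proof -
  note S = complex_subringD[OF algebraic_fieldD(1)[OF F]]
  have t: "t 1 \<in> F" "t 2 \<in> F" "t 3 \<in> F" "t 4 \<in> F" by (auto intro: t)
  show "vandermonde4 t \<in> F" unfolding vandermonde4_def by (intro S t)
  show "\<sigma> (vandermonde4 t) = vandermonde4 (\<sigma> \<circ> t)"
    unfolding vandermonde4_def
    by (simp add: embedding_onD(3)[OF \<sigma>] embedding_on_diff[OF F \<sigma>] S t del: One_nat_def)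
qed

lemma three_cycle_cubed:
  assumes "c \<in> three_cycles n"
  shows "c \<circ> c \<circ> c = id"
proof -
  obtain cs where cs: "c = cycle_of_list cs" "cycle cs" "length cs = 3" using assms by blast
  then obtain x y z where "cs = [x, y, z]"
    by (auto simp: length_Suc_conv numeral_3_eq_3)
  thus ?thesis using cs by (auto simp: fun_eq_iff Transposition.transpose_def)
qed

text \<open>A character of order two is trivial on elements of order three, and these generate \<open>A\<^sub>n\<close>.\<close>

lemma Gal_alt_group_fixes_sqrt:
  assumes lc: "lead_coeff f = 1" and iso: "Gal f \<cong> alt_group n"
    and x: "x \<in> splitting_field f" and sq: "x\<^sup>2 \<in> \<rat>" and \<sigma>: "\<sigma> \<in> carrier (Gal f)"
  shows "\<sigma> x = x"
proof -
  let ?L = "splitting_field f" and ?G = "Gal f"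
  note F = algebraic_field_splitting_field[OF lc]
  obtain h where h: "h \<in> hom ?G (alt_group n)" "bij_betw h (carrier ?G) (carrier (alt_group n))"
    using iso unfolding is_iso_def iso_def by blast
  have emb: "embedding_on ?L \<tau>" if "\<tau> \<in> carrier ?G" for \<tau>
    using that unfolding Gal_carrier_iff[OF F] by blast
  have sign: "\<tau> x = x \<or> \<tau> x = - x" if \<tau>: "\<tau> \<in> carrier ?G" for \<tau>
  proof -
    have "(\<tau> x)\<^sup>2 = \<tau> (x\<^sup>2)"
      using embedding_onD(3)[OF emb[OF \<tau>] x x] by (simp add: power2_eq_square)
    also have "\<dots> = x\<^sup>2" using embedding_on_Rats[OF F emb[OF \<tau>] sq] .
    finally show ?thesis by (simp add: power2_eq_iff)
  qed
  have mult: "(\<tau> \<otimes>\<^bsub>?G\<^esub> \<rho>) x = \<tau> (\<rho> x)" if "\<tau> \<in> carrier ?G" "\<rho> \<in> carrier ?G" for \<tau> \<rho>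
    using Gal_mult[OF that] x by (simp add: compose_eq)
  have neg: "\<tau> (- x) = - \<tau> x" if "\<tau> \<in> carrier ?G" for \<tau>
    using embedding_on_uminus[OF F emb[OF that] x] .
  have unit: "\<one>\<^bsub>?G\<^esub> \<in> carrier ?G"
    unfolding Gal_carrier_iff[OF F] Gal_one embedding_on_def
    using complex_subringD[OF algebraic_fieldD(1)[OF F]] bij_betw_id[of ?L] by (auto simp: id_def)
  have hm: "h (\<tau> \<otimes>\<^bsub>?G\<^esub> \<rho>) = h \<tau> \<circ> h \<rho>" if "\<tau> \<in> carrier ?G" "\<rho> \<in> carrier ?G" for \<tau> \<rho>
    using hom_mult[OF h(1) that] by (simp add: alt_group_mult)
  \<comment> \<open>\<open>h\<close> preserves products, so the image of the unit is an idempotent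
    bijection, that is, the identity.\<close>
  have "\<one>\<^bsub>?G\<^esub> \<otimes>\<^bsub>?G\<^esub> \<one>\<^bsub>?G\<^esub> = \<one>\<^bsub>?G\<^esub>"
    using Gal_mult[OF unit unit] by (simp add: Gal_one)
  hence "h \<one>\<^bsub>?G\<^esub> \<circ> h \<one>\<^bsub>?G\<^esub> = h \<one>\<^bsub>?G\<^esub>" using hm[OF unit unit] by simp
  moreover have "bij (h \<one>\<^bsub>?G\<^esub>)"
    using h(2) unit bij_betwE alt_group_carrier permutes_bij by metis
  ultimately have h1: "h \<one>\<^bsub>?G\<^esub> = id" 
    by (metis bij_is_inj comp_assoc comp_id inv_o_cancel id_comp)
  have inj: "\<tau> = \<rho>" if "\<tau> \<in> carrier ?G" "\<rho> \<in> carrier ?G" "h \<tau> = h \<rho>" for \<tau> \<rho>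
    using h(2) that unfolding bij_betw_def by (meson inj_onD)
  \<comment> \<open>The alternative is \<open>\<tau> x = - x\<close>; applying \<open>\<tau>\<close>
    three times then gives both \<open>x\<close> and \<open>- x\<close>, hence x = 0, which is fixed
    as well.\<close>
  have cubed: "\<tau> x = x" if \<tau>: "\<tau> \<in> carrier ?G" and c: "h \<tau> \<circ> h \<tau> \<circ> h \<tau> = id" for \<tau>
  proof -
    have tt: "\<tau> \<otimes>\<^bsub>?G\<^esub> \<tau> \<in> carrier ?G" using Gal_closed[OF lc] \<tau> by blast
    hence "\<tau> \<otimes>\<^bsub>?G\<^esub> \<tau> \<otimes>\<^bsub>?G\<^esub> \<tau> = \<one>\<^bsub>?G\<^esub>"
      using \<tau> Gal_closed[OF lc] unit hm c h1 by (intro inj) simp_all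
    hence "\<tau> (\<tau> (\<tau> x)) = x"
    proof -
      assume "\<tau> \<otimes>\<^bsub>?G\<^esub> \<tau> \<otimes>\<^bsub>?G\<^esub> \<tau> = \<one>\<^bsub>?G\<^esub>"
      moreover have "(\<tau> \<otimes>\<^bsub>?G\<^esub> \<tau> \<otimes>\<^bsub>?G\<^esub> \<tau>) x = (\<tau> \<otimes>\<^bsub>?G\<^esub> \<tau>) (\<tau> x)" by (rule mult[OF tt \<tau>])
      moreover have "(\<tau> \<otimes>\<^bsub>?G\<^esub> \<tau>) (\<tau> x) = \<tau> (\<tau> (\<tau> x))"
        using Gal_mult[OF \<tau> \<tau>] x sign[OF \<tau>] complex_subringD(3)[OF algebraic_fieldD(1)[OF F]]
        by (auto simp: compose_def)
      ultimately show ?thesis using x by (simp add: Gal_one)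
    qed
    thus ?thesis using sign[OF \<tau>] neg[OF \<tau>] by auto
  qed
  have "\<forall>\<tau>\<in>carrier ?G. h \<tau> = g \<longrightarrow> \<tau> x = x" if "g \<in> generate (alt_group n) (three_cycles n)" for g
    using that
  proof (induction rule: generate.induct)
    case one
    show ?case
    proof (intro ballI impI)
      fix \<tau> assume "\<tau> \<in> carrier ?G" "h \<tau> = \<one>\<^bsub>alt_group n\<^esub>"
      hence "\<tau> = \<one>\<^bsub>?G\<^esub>" using unit h1 by (intro inj) (simp_all add: alt_group_one)
      thus "\<tau> x = x" using x by (simp add: Gal_one)
    qed
  next
    case (incl c)
    show ?case using cubed three_cycle_cubed[OF incl] by auto
  next
    case (inv c)
    have c: "c \<in> carrier (alt_group n)" using inv three_cycles_incl by blast
    have "bij c" using c alt_group_carrier permutes_bij by blast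
    hence "inv' c \<circ> inv' c \<circ> inv' c = inv' (c \<circ> c \<circ> c)" by (simp add: o_inv_distrib bij_comp comp_assoc)
    hence "inv' c \<circ> inv' c \<circ> inv' c = id" using three_cycle_cubed[OF inv] by simp
    thus ?case using cubed alt_group_inv_equality[OF c] by auto
  next
    case (eng g1 g2)
    have "g1 \<in> carrier (alt_group n)" "g2 \<in> carrier (alt_group n)"
      using eng.hyps unfolding alt_group_carrier_as_three_cycles by auto
    hence "g1 \<in> h ` carrier ?G" "g2 \<in> h ` carrier ?G" using h(2) unfolding bij_betw_def by simp_all
    then obtain \<tau>1 \<tau>2 where \<tau>: "\<tau>1 \<in> carrier ?G" "\<tau>2 \<in> carrier ?G" "h \<tau>1 = g1" "h \<tau>2 = g2"
      by (elim imageE) simp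
    show ?case
    proof (intro ballI impI)
      fix \<rho> assume \<rho>: "\<rho> \<in> carrier ?G" "h \<rho> = g1 \<otimes>\<^bsub>alt_group n\<^esub> g2"
      have "\<rho> = \<tau>1 \<otimes>\<^bsub>?G\<^esub> \<tau>2"
        using \<rho> \<tau> Gal_closed[OF lc \<tau>(1,2)] hm[OF \<tau>(1,2)] by (intro inj) (simp_all add: alt_group_mult)
      moreover have "\<tau>1 x = x" "\<tau>2 x = x" using eng.IH \<tau> by blast+
      ultimately show "\<rho> x = x" using mult[OF \<tau>(1,2)] by simp
    qed
  qed
  moreover have "h \<sigma> \<in> generate (alt_group n) (three_cycles n)"
    using \<sigma> h(2) bij_betwE alt_group_carrier_as_three_cycles by blast
  ultimately show ?thesis using \<sigma> by blast
qed

text \<open>If \<open>x\<close> were irrational, it would satisfy no nonzero rational polynomial of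
  degree at most 1, so every rational polynomial vanishing at \<open>x\<close> would be a multiple
  of X^2 - D. Then \<open>- x\<close> is a conjugate, and some automorphism moves
  \<open>x\<close>.\<close>

lemma fixed_sqrt_rational:
  assumes lc: "lead_coeff f = 1" and x: "x \<in> splitting_field f" and sq: "x\<^sup>2 = of_int D"
    and fixed: "\<And>\<sigma>. \<sigma> \<in> carrier (Gal f) \<Longrightarrow> \<sigma> x = x"
  shows "x \<in> \<int>"
proof -
  let ?p = "[:- of_int D, 0, 1:] :: complex poly"
  have p: "lead_coeff ?p = 1" "degree ?p = 2" "poly ?p x = 0" "?p \<in> polys_over \<int>"
    using sq by (simp_all add: polys_over_pCons polys_over_closed(1)[OF complex_subring_Ints] power2_eq_square)
  have alg: "algebraic_int x"
    using p by (intro algebraic_int.intros[of ?p]) (simp_all add: polys_over_def)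
  have "x \<in> \<rat>"
  proof (rule ccontr)
    assume x_irr: "x \<notin> \<rat>"
    have "poly q (- x) = 0" if q: "q \<in> polys_over \<rat>" "poly q x = 0" for q
    proof -
      obtain g r where gr: "g \<in> polys_over \<rat>" "r \<in> polys_over \<rat>" "q = ?p * g + r" "degree r < degree ?p"
        using monic_division[OF complex_subring_Rats polys_over_Rats[OF p(4)] p(1) _ q(1)] p(2) by auto
      have "poly q x = poly ?p x * poly g x + poly r x" unfolding gr(3) by (simp only: poly_add poly_mult)
      hence rx: "poly r x = 0" using q(2) p(3) by simp
      have "degree r \<le> 1" using gr(4) p(2) by simp
      hence "r = [:coeff r 0, coeff r 1:]"
        by (intro poly_eqI) (auto simp: coeff_pCons coeff_eq_0 split: nat.split)
      then obtain u v where uv: "r = [:u, v:]" by blast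
      have Q: "u \<in> \<rat>" "v \<in> \<rat>" using gr(2) unfolding uv by (simp_all add: polys_over_pCons)
      have "v = 0"
      proof (rule ccontr)
        assume "v \<noteq> 0"
        hence "x = - u / v" using rx unfolding uv by (simp add: field_simps add_eq_0_iff)
        thus False using Q x_irr by auto
      qed
      hence "r = 0" using rx uv by simp
      moreover have "poly ?p (- x) = 0" using p(3) by simp
      ultimately show ?thesis unfolding gr(3) by (simp only: poly_add poly_mult mult_zero_left poly_0 add_0)
    qed
    then obtain \<sigma> where "\<sigma> \<in> carrier (Gal f)" "\<sigma> x = - x" using Gal_conjugate[OF lc x alg, of "- x"] by blast
    hence "x = 0" using fixed by fastforce
    thus False using x_irr by simp
  qed
  thus ?thesis using rational_algebraic_int_is_int[OF alg] by blast
qed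

lemma quartic_roots_enumeration:
  fixes a d :: int
  assumes f: "f = monom 1 4 + monom a 3 + [:d:]" and irr: "irreducible_over_rat f"
  obtains t :: "nat \<Rightarrow> complex" where "bij_betw t {1..4} (complex_roots f)"
    "[:of_int d, 0, 0, of_int a, 1:] = [:- t 1, 1:] * [:- t 2, 1:] * [:- t 3, 1:] * [:- t 4, 1:]"
    "map_poly of_int f = [:of_int d, 0, 0, of_int a, 1 :: complex:]" "lead_coeff f = 1" "degree f = 4"
proof -
  have f': "f = [:d, 0, 0, a, 1:]"
    unfolding f by (simp add: monom_altdef numeral_eq_Suc)
  have F: "map_poly of_int f = [:of_int d, 0, 0, of_int a, 1 :: complex:]"
    unfolding f' by (rule poly_eqI) (simp add: coeff_map_poly coeff_pCons split: nat.split)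
  have deg: "lead_coeff f = 1" "degree f = 4" unfolding f' by simp_all
  note R = complex_roots_product[OF irr deg(1)]
  obtain u :: "nat \<Rightarrow> complex" where u: "bij_betw u {0..<4} (complex_roots f)"
    using ex_bij_betw_nat_finite[OF R(1)] R(3) deg(2) by auto
  define t where "t i = u (i - 1)" for i
  have "bij_betw (\<lambda>i::nat. i - 1) {1..4} {0..<4}"
    by (rule bij_betw_byWitness[where f' = Suc]) auto
  hence t: "bij_betw t {1..4} (complex_roots f)"
    using bij_betw_trans[OF _ u] unfolding t_def o_def by blast
  have "map_poly of_int f = (\<Prod>i\<in>{1..4}. [:- t i, 1:])"
    unfolding R(2) by (rule prod.reindex_bij_betw[OF t, symmetric])
  also have "{1..4} = {1, 2, 3, 4 :: nat}" by auto
  finally have "map_poly of_int f = [:- t 1, 1:] * [:- t 2, 1:] * [:- t 3, 1:] * [:- t 4, 1:]"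
    by (simp add: mult.assoc del: mult_pCons_left mult_pCons_right)
  thus ?thesis using F by (intro that[OF t _ F deg]) (simp only:)
qed

lemma quartic_Gal_alt_group_imp_square:
  fixes a d :: int
  assumes f: "f = monom 1 4 + monom a 3 + [:d:]" and irr: "irreducible_over_rat f" and d: "d \<noteq> 0"
    and iso: "Gal f \<cong> alt_group 4"
  shows "\<exists>s. 256 * d - 27 * a ^ 4 = s\<^sup>2"
proof -
  obtain t :: "nat \<Rightarrow> complex" where t: "bij_betw t {1..4} (complex_roots f)"
    "[:of_int d, 0, 0, of_int a, 1:] = [:- t 1, 1:] * [:- t 2, 1:] * [:- t 3, 1:] * [:- t 4, 1:]"
    and lc: "lead_coeff f = 1"
    using quartic_roots_enumeration[OF f irr] by metis
  note F = algebraic_field_splitting_field[OF lc]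
  have tL: "t i \<in> splitting_field f" if "i \<in> {1..4}" for i
    using that t(1) bij_betwE complex_roots_subset_splitting_field by blast
  have "embedding_on (splitting_field f) (\<lambda>x. x)" unfolding embedding_on_def by simp
  hence V: "vandermonde4 t \<in> splitting_field f" by (rule embedding_vandermonde4(2)[OF F _ tL])
  have sq: "(vandermonde4 t)\<^sup>2 = of_int (d\<^sup>2 * (256 * d - 27 * a ^ 4))"
    using vandermonde4_square[OF t(2)] by simp
  hence "(vandermonde4 t)\<^sup>2 \<in> \<rat>" by (metis Rats_of_int)
  hence "vandermonde4 t \<in> \<int>"
    using fixed_sqrt_rational[OF lc V sq] Gal_alt_group_fixes_sqrt[OF lc iso V] by blast
  then obtain v where "vandermonde4 t = of_int v" by (elim Ints_cases)
  hence "of_int (v\<^sup>2) = (of_int (d\<^sup>2 * (256 * d - 27 * a ^ 4)) :: complex)" using sq by simp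
  hence v: "v\<^sup>2 = d\<^sup>2 * (256 * d - 27 * a ^ 4)" by (simp only: of_int_eq_iff)
  hence "d\<^sup>2 dvd v\<^sup>2" by simp
  hence "d dvd v" by simp
  then obtain s where "v = d * s" by blast
  hence "d\<^sup>2 * s\<^sup>2 = d\<^sup>2 * (256 * d - 27 * a ^ 4)" using v by (simp add: power_mult_distrib)
  hence "256 * d - 27 * a ^ 4 = s\<^sup>2" using d by simp
  thus ?thesis by blast
qed


section \<open>Quartics with Galois group \<open>A\<^sub>4\<close>\<close>

text \<open>Orbit counting: the group is split into the fibres {s. s x = y} over the roots y of
  \<open>g\<close>. Composition with an automorphism taking y to z injects one fibre into another,
  in both directions, so all fibres have the same size.\<close>

lemma card_roots_dvd_card_Gal:
  assumes lc: "lead_coeff f = 1" and fin: "finite (carrier (Gal f))"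
    and irr: "irreducible_over_rat g" and lg: "lead_coeff g = 1"
    and sub: "complex_roots g \<subseteq> splitting_field f"
  shows "degree g dvd card (carrier (Gal f))"
proof (cases "complex_roots g = {}")
  case True
  thus ?thesis using complex_roots_nonempty[OF lg] irr lg
    by (cases "degree g = 0") (auto elim!: degree_eq_zeroE)
next
  case False
  let ?L = "splitting_field f" and ?G = "carrier (Gal f)" and ?R = "complex_roots g"
  note F = algebraic_field_splitting_field[OF lc]
  define fib where "fib x y = {\<sigma> \<in> ?G. \<sigma> x = y}" for x y
  obtain x where x: "x \<in> ?R" using False by blast
  note R = complex_roots_product[OF irr lg]
  have emb: "embedding_on ?L \<sigma>" "inj_on \<sigma> ?L" if "\<sigma> \<in> ?G" for \<sigma>
    using that unfolding Gal_carrier_iff[OF F] bij_betw_def by auto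
  have into: "\<sigma> y \<in> ?R" if "\<sigma> \<in> ?G" "y \<in> ?R" for \<sigma> y
  proof -
    have "poly (map_poly of_int g) (\<sigma> y) = \<sigma> (poly (map_poly of_int g) y)"
      by (rule embedding_on_poly_Rats[OF F emb(1)]) (use that sub in \<open>auto intro: polys_over_Rats\<close>)
    thus ?thesis using that(2) embedding_on_0[OF F emb(1)[OF that(1)]] unfolding complex_roots_def by simp
  qed
  have trans: "\<exists>\<sigma>\<in>?G. \<sigma> y = z" if "y \<in> ?R" "z \<in> ?R" for y z
    using Gal_conjugate[OF lc, of y z] that sub algebraic_int_root_monic[OF lg]
      irreducible_over_rat_conjugate[OF irr that] by blast
  have le: "card (fib x y) \<le> card (fib x z)" if yz: "y \<in> ?R" "z \<in> ?R" for y z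
  proof -
    obtain \<tau> where \<tau>: "\<tau> \<in> ?G" "\<tau> y = z" using trans yz by blast
    have "inj_on (\<lambda>\<sigma>. \<tau> \<otimes>\<^bsub>Gal f\<^esub> \<sigma>) (fib x y)"
    proof (rule inj_onI)
      fix \<sigma> \<rho> assume *: "\<sigma> \<in> fib x y" "\<rho> \<in> fib x y" "\<tau> \<otimes>\<^bsub>Gal f\<^esub> \<sigma> = \<tau> \<otimes>\<^bsub>Gal f\<^esub> \<rho>"
      hence G: "\<sigma> \<in> ?G" "\<rho> \<in> ?G" unfolding fib_def by auto
      have **: "\<sigma> \<in> extensional ?L" "bij_betw \<sigma> ?L ?L" "\<rho> \<in> extensional ?L" "bij_betw \<rho> ?L ?L"
        using G unfolding Gal_carrier_iff[OF F] by auto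
      show "\<sigma> = \<rho>"
      proof (rule extensionalityI[OF **(1,3)])
        fix u assume u: "u \<in> ?L"
        have "compose ?L \<tau> \<sigma> u = compose ?L \<tau> \<rho> u"
          using *(3) Gal_mult[OF \<tau>(1) G(1)] Gal_mult[OF \<tau>(1) G(2)] by simp
        hence "\<tau> (\<sigma> u) = \<tau> (\<rho> u)" using u by (simp add: compose_eq)
        thus "\<sigma> u = \<rho> u"
          using inj_onD[OF emb(2)[OF \<tau>(1)]] bij_betw_apply[OF **(2) u] bij_betw_apply[OF **(4) u] by blast
      qed
    qed
    moreover have "(\<lambda>\<sigma>. \<tau> \<otimes>\<^bsub>Gal f\<^esub> \<sigma>) ` fib x y \<subseteq> fib x z"
    proof clarify
      fix \<sigma> assume "\<sigma> \<in> fib x y"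
      hence \<sigma>: "\<sigma> \<in> ?G" "\<sigma> x = y" unfolding fib_def by auto
      have "(\<tau> \<otimes>\<^bsub>Gal f\<^esub> \<sigma>) x = z"
        unfolding Gal_mult[OF \<tau>(1) \<sigma>(1)] using x sub \<sigma> \<tau> by (simp add: compose_eq subset_iff)
      thus "\<tau> \<otimes>\<^bsub>Gal f\<^esub> \<sigma> \<in> fib x z" using Gal_closed[OF lc \<tau>(1) \<sigma>(1)] unfolding fib_def by simp
    qed
    moreover have "finite (fib x z)" unfolding fib_def using fin by simp
    ultimately show ?thesis by (rule card_inj_on_le)
  qed
  have "?G = (\<Union>y\<in>?R. fib x y)" unfolding fib_def using into x by auto
  hence "card ?G = card (\<Union>y\<in>?R. fib x y)" by simp
  also have "\<dots> = (\<Sum>y\<in>?R. card (fib x y))"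
    by (rule card_UN_disjoint) (use R(1) fin in \<open>auto simp: fib_def\<close>)
  also have "\<dots> = (\<Sum>y\<in>?R. card (fib x x))"
    using le x by (intro sum.cong refl) (meson le_antisym)
  finally show ?thesis using R(3) by simp
qed

theorem Gal_alt_group_4:
  assumes lc: "lead_coeff f = 1" and irr: "irreducible_over_rat f" and deg: "degree f = 4"
    and t: "bij_betw t {1..4} (complex_roots f)" and V: "vandermonde4 t \<in> \<rat>"
    and g: "irreducible_over_rat g" "lead_coeff g = 1" "degree g = 3"
    and sub: "complex_roots g \<subseteq> splitting_field f"
  shows "Gal f \<cong> alt_group 4"
proof -
  let ?L = "splitting_field f" and ?G = "carrier (Gal f)" and ?R = "complex_roots f"
  note F = algebraic_field_splitting_field[OF lc]
  note RL = complex_roots_subset_splitting_field[of f]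
  have tR: "t i \<in> ?R" if "i \<in> {1..4}" for i using t that by (rule bij_betw_apply)
  have tL: "t i \<in> ?L" if "i \<in> {1..4}" for i using tR[OF that] RL by blast
  have emb: "embedding_on ?L \<sigma>" and ext: "\<sigma> \<in> extensional ?L" and bij: "bij_betw \<sigma> ?L ?L"
    if "\<sigma> \<in> ?G" for \<sigma>
    using that unfolding Gal_carrier_iff[OF F] by auto
  have V0: "vandermonde4 t \<noteq> 0"
    using t unfolding vandermonde4_def bij_betw_def by (auto dest!: inj_onD)
  \<comment> \<open>The permutation of indices induced on the roots, extended by the identity
    outside {1..4} as \<open>permutes\<close> requires.\<close>
  define \<psi> where "\<psi> \<sigma> i = (if i \<in> {1..4} then inv_into {1..4} t (\<sigma> (t i)) else i)" for \<sigma> :: "complex \<Rightarrow> complex" and i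
  have \<psi>: "bij_betw (\<psi> \<sigma>) {1..4} {1..4}" "\<And>i. i \<in> {1..4} \<Longrightarrow> t (\<psi> \<sigma> i) = \<sigma> (t i)" if \<sigma>: "\<sigma> \<in> ?G" for \<sigma>
  proof -
    note perm = embedding_permutes_roots[OF lc emb[OF \<sigma>]]
    have "bij_betw (inv_into {1..4} t \<circ> (\<sigma> \<circ> t)) {1..4} {1..4}"
      using bij_betw_trans[OF bij_betw_trans[OF t perm] bij_betw_inv_into[OF t]] .
    thus "bij_betw (\<psi> \<sigma>) {1..4} {1..4}"
      by (rule bij_betw_cong[THEN iffD1, rotated]) (simp add: \<psi>_def)
    fix i :: nat assume i: "i \<in> {1..4}"
    have "\<sigma> (t i) \<in> t ` {1..4}" using bij_betw_apply[OF perm tR[OF i]] t unfolding bij_betw_def by blast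
    thus "t (\<psi> \<sigma> i) = \<sigma> (t i)" using i unfolding \<psi>_def by (simp only: if_True f_inv_into_f)
  qed
  have permutes: "\<psi> \<sigma> permutes {1..4}" if "\<sigma> \<in> ?G" for \<sigma>
    by (rule bij_imp_permutes[OF \<psi>(1)[OF that]]) (auto simp: \<psi>_def)
  \<comment> \<open>An automorphism fixes the rational number \<open>vandermonde4 t\<close>, while
    permuting the indices multiplies it by the sign; it is nonzero, so the sign is 1.\<close>
  have even: "evenperm (\<psi> \<sigma>)" if \<sigma>: "\<sigma> \<in> ?G" for \<sigma>
  proof -
    have "vandermonde4 (t \<circ> \<psi> \<sigma>) = vandermonde4 (\<sigma> \<circ> t)"
      using \<psi>(2)[OF \<sigma>] unfolding vandermonde4_def by simp
    also have "\<dots> = \<sigma> (vandermonde4 t)" using embedding_vandermonde4(1)[OF F emb[OF \<sigma>] tL] by simp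
    also have "\<dots> = vandermonde4 t" by (rule embedding_on_Rats[OF F emb[OF \<sigma>] V])
    finally have "of_int (sign (\<psi> \<sigma>)) * vandermonde4 t = vandermonde4 t"
      using vandermonde4_permutes[OF permutes[OF \<sigma>]] by simp
    hence "sign (\<psi> \<sigma>) = 1" using V0 by simp
    thus ?thesis by (simp add: sign_def split: if_splits)
  qed
  have inA: "\<psi> \<sigma> \<in> carrier (alt_group 4)" if "\<sigma> \<in> ?G" for \<sigma>
    using permutes[OF that] even[OF that] by (simp add: alt_group_carrier)
  have inj: "inj_on \<psi> ?G"
  proof (rule inj_onI)
    fix \<sigma> \<tau> assume st: "\<sigma> \<in> ?G" "\<tau> \<in> ?G" "\<psi> \<sigma> = \<psi> \<tau>"
    have agree: "\<sigma> r = \<tau> r" if "r \<in> ?R" for r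
    proof -
      obtain i where "i \<in> {1..4}" "r = t i" using \<open>r \<in> ?R\<close> t unfolding bij_betw_def by blast
      thus ?thesis using \<psi>(2)[OF st(1)] \<psi>(2)[OF st(2)] st(3) by metis
    qed
    \<comment> \<open>The set of agreement is a field containing the roots, hence the whole
      splitting field.\<close>
    have "algebraic_field {x\<in>?L. \<sigma> x = \<tau> x}"
    proof (rule algebraic_field_subset[OF F])
      show "complex_subring {x\<in>?L. \<sigma> x = \<tau> x}"
        unfolding complex_subring_def
        using complex_subringD[OF algebraic_fieldD(1)[OF F]] embedding_onD[OF emb[OF st(1)]]
          embedding_onD[OF emb[OF st(2)]] embedding_on_uminus[OF F emb[OF st(1)]]
          embedding_on_uminus[OF F emb[OF st(2)]] by simp
      show "\<rat> \<subseteq> {x\<in>?L. \<sigma> x = \<tau> x}"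
        using algebraic_fieldD(2)[OF F] embedding_on_Rats[OF F emb[OF st(1)]]
          embedding_on_Rats[OF F emb[OF st(2)]] by auto
    qed auto
    moreover have "?R \<subseteq> {x\<in>?L. \<sigma> x = \<tau> x}" using agree RL by blast
    ultimately have "?L \<subseteq> {x\<in>?L. \<sigma> x = \<tau> x}" using adjoin_least unfolding splitting_field_def by metis
    thus "\<sigma> = \<tau>" using ext[OF st(1)] ext[OF st(2)] by (intro extensionalityI) auto
  qed
  have card_A: "card (carrier (alt_group 4)) = 12"
    using alt_group_card_carrier[of 4] by (simp add: fact_numeral)
  have finA: "finite (carrier (alt_group 4))" using card_A by (metis card.infinite zero_neq_numeral)
  have image: "\<psi> ` ?G \<subseteq> carrier (alt_group 4)" using inA by blast
  have finG: "finite ?G" using finite_imageD[OF finite_subset[OF image finA] inj] .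
  have "degree f dvd card ?G" by (rule card_roots_dvd_card_Gal[OF lc finG irr lc RL])
  moreover have "degree g dvd card ?G" by (rule card_roots_dvd_card_Gal[OF lc finG g(1,2) sub])
  ultimately have "12 dvd card ?G" unfolding deg g(3) by presburger
  moreover have "card ?G \<noteq> 0"
  proof -
    have "t 1 \<in> ?L" using tL by simp
    then obtain \<sigma> where "\<sigma> \<in> ?G" 
      using Gal_conjugate[OF lc, of "t 1" "t 1"] algebraic_int_root_monic[OF lc tR[of 1]] by auto
    thus ?thesis using finG by auto
  qed
  moreover have "card ?G \<le> 12" using card_inj_on_le[OF inj image finA] card_A by simp
  ultimately have "card ?G = 12" by (meson dvd_imp_le le_antisym not_gr_zero)
  hence "\<psi> ` ?G = carrier (alt_group 4)"
    using card_subset_eq[OF finA image] card_image[OF inj] card_A by simp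
  hence "bij_betw \<psi> ?G (carrier (alt_group 4))" using inj unfolding bij_betw_def by blast
  moreover have "\<psi> \<in> hom (Gal f) (alt_group 4)"
  proof (rule homI)
    fix \<sigma> \<tau> assume st: "\<sigma> \<in> ?G" "\<tau> \<in> ?G"
    have "\<psi> (\<sigma> \<otimes>\<^bsub>Gal f\<^esub> \<tau>) i = \<psi> \<sigma> (\<psi> \<tau> i)" for i
    proof (cases "i \<in> {1..4}")
      case True
      hence i: "\<psi> \<tau> i \<in> {1..4}" using bij_betw_apply[OF \<psi>(1)[OF st(2)]] by blast
      have "t (\<psi> (\<sigma> \<otimes>\<^bsub>Gal f\<^esub> \<tau>) i) = (\<sigma> \<otimes>\<^bsub>Gal f\<^esub> \<tau>) (t i)"
        by (rule \<psi>(2)[OF Gal_closed[OF lc st] True])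
      also have "\<dots> = \<sigma> (t (\<psi> \<tau> i))"
        unfolding Gal_mult[OF st] using tL[OF True] \<psi>(2)[OF st(2) True] by (simp add: compose_eq)
      also have "\<dots> = t (\<psi> \<sigma> (\<psi> \<tau> i))" using \<psi>(2)[OF st(1) i] by simp
      finally show ?thesis
        using t i bij_betw_apply[OF \<psi>(1)[OF Gal_closed[OF lc st]] True] bij_betw_apply[OF \<psi>(1)[OF st(1)] i]
        unfolding bij_betw_def by (meson inj_onD)
    next
      case False
      thus ?thesis by (simp only: \<psi>_def if_False)
    qed
    thus "\<psi> (\<sigma> \<otimes>\<^bsub>Gal f\<^esub> \<tau>) = \<psi> \<sigma> \<otimes>\<^bsub>alt_group 4\<^esub> \<psi> \<tau>" by (auto simp: alt_group_mult)
  qed (use inA in auto)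
  ultimately have "\<psi> \<in> iso (Gal f) (alt_group 4)" unfolding iso_def by blast
  thus ?thesis unfolding is_iso_def by blast
qed

lemma irreducible_cubic:
  fixes p :: "rat poly"
  assumes deg: "degree p = 3" and no_root: "\<And>x. poly p x \<noteq> 0"
  shows "Factorial_Ring.irreducible p"
proof (rule Factorial_Ring.irreducibleI)
  show "p \<noteq> 0" "\<not> p dvd 1" using deg by (auto simp: poly_dvd_1)
  fix u v assume uv: "p = u * v"
  have nz: "u \<noteq> 0" "v \<noteq> 0" using uv deg by auto
  have not1: "degree q \<noteq> 1" if dvd: "q dvd p" for q
  proof
    assume q: "degree q = 1"
    have "q = [:coeff q 0, coeff q 1:]"
      using q by (intro poly_eqI) (auto simp: coeff_pCons coeff_eq_0 split: nat.split)
    moreover have "coeff q 1 \<noteq> 0" using q leading_coeff_0_iff[of q] by auto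
    ultimately have "poly q (- coeff q 0 / coeff q 1) = 0"
      by (metis (no_types, lifting) add.right_inverse mult.commute mult_zero_left nonzero_divide_eq_eq poly_0 poly_pCons add_0_right mult_zero_right)
    hence "poly p (- coeff q 0 / coeff q 1) = 0" using dvd by (auto simp: dvd_def)
    thus False using no_root by blast
  qed
  have "degree u + degree v = 3" using deg nz unfolding uv by (simp add: degree_mult_eq)
  moreover have "degree u \<noteq> 1" "degree v \<noteq> 1" using not1[of u] not1[of v] uv by auto
  ultimately have "degree u = 0 \<or> degree v = 0" by linarith
  thus "u dvd 1 \<or> v dvd 1" using nz by (auto simp: is_unit_iff_degree)
qed

text \<open>The resolvent cubic: its three roots correspond to the pairings of four elements and are
  permuted by S4, so the coefficients are symmetric. For e1 = -a, e2 = e3 = 0, e4 = d it becomes s^3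
  - 4 d s - a^2 d.\<close>

lemma quartic_resolvent:
  fixes x y z w s :: complex
  defines "e1 \<equiv> x + y + z + w" and "e2 \<equiv> x * y + x * z + x * w + y * z + y * w + z * w"
    and "e3 \<equiv> x * y * z + x * y * w + x * z * w + y * z * w" and "e4 \<equiv> x * y * z * w"
  shows "(s - (x * y + z * w)) * (s - (x * z + y * w)) * (s - (x * w + y * z)) =
     s ^ 3 - e2 * s\<^sup>2 + (e1 * e3 - 4 * e4) * s - (e1\<^sup>2 * e4 + e3\<^sup>2 - 4 * e2 * e4)"
  unfolding e1_def e2_def e3_def e4_def
  by (simp add: algebra_simps power2_eq_square power3_eq_cube)

lemma quartic_resolvent_roots:
  fixes a d :: int and t :: "nat \<Rightarrow> complex"
  assumes t: "[:of_int d, 0, 0, of_int a, 1:] = [:- t 1, 1:] * [:- t 2, 1:] * [:- t 3, 1:] * [:- t 4, 1 :: complex:]"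
    and S: "complex_subring S" "\<And>i. i \<in> {1..4} \<Longrightarrow> t i \<in> S"
  shows "complex_roots [:- (a\<^sup>2 * d), - 4 * d, 0, 1:] \<subseteq> S"
proof
  fix s assume "s \<in> complex_roots [:- (a\<^sup>2 * d), - 4 * d, 0, 1:]"
  moreover have "map_poly of_int [:- (a\<^sup>2 * d), - 4 * d, 0, 1:] =
      [:- ((of_int a)\<^sup>2 * of_int d), - 4 * of_int d, 0, 1 :: complex:]"
    by (rule poly_eqI) (simp add: coeff_map_poly coeff_pCons split: nat.split)
  ultimately have "s ^ 3 - 4 * of_int d * s - (of_int a)\<^sup>2 * of_int d = 0"
    by (simp add: complex_roots_def power3_eq_cube algebra_simps)
  hence "(s - (t 1 * t 2 + t 3 * t 4)) * (s - (t 1 * t 3 + t 2 * t 4)) * (s - (t 1 * t 4 + t 2 * t 3)) = 0"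
    unfolding quartic_resolvent quartic_vieta[OF t] by simp
  hence "s = t 1 * t 2 + t 3 * t 4 \<or> s = t 1 * t 3 + t 2 * t 4 \<or> s = t 1 * t 4 + t 2 * t 3" by auto
  moreover have "t 1 \<in> S" "t 2 \<in> S" "t 3 \<in> S" "t 4 \<in> S" by (auto intro: S(2))
  ultimately show "s \<in> S" by (auto intro!: complex_subringD(4,6)[OF S(1)])
qed

text \<open>The cofactor \<open>e\<close> of gcd d y in \<open>d\<close> is coprime to the cofactor
  of \<open>y\<close>, and by squarefreeness to the gcd itself, hence to \<open>y\<close>. As it
  divides y^n, it is a unit.\<close>

lemma squarefree_dvd_power_imp_dvd:
  fixes d y :: int
  assumes sqf: "squarefree d" and dvd: "d dvd y ^ n"
  shows "d dvd y"
proof -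
  have d0: "d \<noteq> 0" using sqf by auto
  obtain e where e: "d = gcd d y * e" using gcd_dvd1 by (meson dvdE)
  obtain y' where y': "y = gcd d y * y'" using gcd_dvd2 by (meson dvdE)
  have "gcd d y * gcd e y' = gcd d y"
    by (metis abs_of_nonneg e gcd_ge_0_int gcd_mult_distrib_int y')
  hence "Rings.coprime e y'" using d0 by (simp add: coprime_iff_gcd_eq_1)
  moreover have "Rings.coprime e (gcd d y)"
  proof (rule coprimeI)
    fix c assume "c dvd e" "c dvd gcd d y"
    hence "c\<^sup>2 dvd d" unfolding power2_eq_square by (subst e) (simp add: mult_dvd_mono mult.commute)
    thus "c dvd 1" using sqf squarefreeD by blast
  qed
  ultimately have "Rings.coprime e y" by (subst y') simp
  hence "Rings.coprime e (y ^ n)" by simp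
  moreover have "e dvd y ^ n" using dvd e by (metis dvd_mult_right)
  ultimately have "e dvd 1" using coprime_common_divisor[of e "y ^ n" e] by simp
  hence "gcd d y * e dvd gcd d y" by (metis dvd_refl mult_dvd_mono mult.right_neutral)
  thus ?thesis using e by (metis gcd_dvd2 dvd_trans)
qed

text \<open>A rational root is an integer y, and \<open>d\<close> divides y^3, hence y. Dividing the
  equation by \<open>d\<close> leaves d | 16 k^2; since \<open>d\<close> is odd and coprime to
  \<open>k\<close>, this forces d = 1, against \<open>k\<close> being nonzero.\<close>

lemma resolvent_irreducible:
  fixes k d :: int
  assumes d: "d = 27 * k ^ 4 + 1" and k: "k \<noteq> 0" and sqf: "squarefree d" and odd: "odd d"
  shows "irreducible_over_rat [:- ((4 * k)\<^sup>2 * d), - 4 * d, 0, 1:]"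
proof (rule irreducible_cubic)
  let ?g = "[:- ((4 * k)\<^sup>2 * d), - 4 * d, 0, 1:]"
  have g: "map_poly of_int ?g = [:- of_int ((4 * k)\<^sup>2 * d), - of_int (4 * d), 0, 1 :: rat:]"
    by (rule poly_eqI) (simp add: coeff_map_poly coeff_pCons split: nat.split)
  show "degree (map_poly of_int ?g :: rat poly) = 3" unfolding g by simp
  fix x :: rat
  show "poly (map_poly of_int ?g) x \<noteq> 0"
  proof
    assume 0: "poly (map_poly of_int ?g) x = 0"
    have "algebraic_int x"
      using 0 by (subst algebraic_int_altdef_ipoly) (auto intro!: exI[of _ ?g])
    moreover have "x \<in> \<rat>" by (metis Rats_of_rat of_rat_eq_id id_apply)
    ultimately have "x \<in> \<int>" by (rule rational_algebraic_int_is_int)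
    then obtain y where y: "x = of_int y" by (elim Ints_cases)
    have "of_int (y ^ 3) = (of_int (4 * d * y + (4 * k)\<^sup>2 * d) :: rat)"
      using 0 unfolding g y by (simp add: algebra_simps power3_eq_cube)
    hence eq: "y ^ 3 = 4 * d * y + (4 * k)\<^sup>2 * d" by (simp only: of_int_eq_iff)
    hence "d dvd y ^ 3" by simp
    hence "d dvd y" by (rule squarefree_dvd_power_imp_dvd[OF sqf])
    then obtain z where z: "y = d * z" by blast
    have "d * (16 * k\<^sup>2) = d * (d * (d * z ^ 3 - 4 * z))"
      using eq unfolding z by (simp add: algebra_simps power2_eq_square power3_eq_cube)
    moreover have "d \<noteq> 0" using odd by auto
    ultimately have "16 * k\<^sup>2 = d * (d * z ^ 3 - 4 * z)" by simp
    hence "d dvd 16 * k\<^sup>2" by simp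
    moreover have "Rings.coprime d k"
    proof (rule coprimeI)
      fix c assume "c dvd d" "c dvd k"
      hence "c dvd d - k * (27 * k ^ 3)" by (intro dvd_diff dvd_mult2) auto
      also have "d - k * (27 * k ^ 3) = 1" unfolding d by (simp add: power3_eq_cube power4_eq_xxxx)
      finally show "c dvd 1" .
    qed
    hence "Rings.coprime d (k\<^sup>2)" by simp
    ultimately have "d dvd 16" using coprime_dvd_mult_left_iff by blast
    moreover have "Rings.coprime d 2" using odd by simp
    hence "Rings.coprime d (2 ^ 4)" by (simp only: coprime_power_right_iff) simp
    ultimately have "d dvd 1" using coprime_common_divisor[of d 16 d] by simp
    hence "d = 1" using d by (auto simp: zdvd1_eq)
    thus False using d k by simp
  qed
qed


section \<open>Conjugates, norms and the different\<close>

lemma polys_over_pcompose: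
  assumes S: "complex_subring S" and "p \<in> polys_over S" "q \<in> polys_over S"
  shows "pcompose p q \<in> polys_over S"
  using assms(2)
proof (induction p)
  case 0
  show ?case by (simp add: polys_over_closed(1)[OF S])
next
  case (pCons a p)
  thus ?case using assms(3)
    by (simp only: pcompose_pCons polys_over_pCons)
      (intro polys_over_closed(3,7,9)[OF S], auto)
qed

text \<open>If P is a monic integral equation of p(t), the composite of P with \<open>p\<close>
  vanishes at \<open>t\<close>, hence at the conjugate \<open>r\<close>.\<close>

lemma algebraic_int_conjugate:
  assumes irr: "irreducible_over_rat f" and t: "t \<in> complex_roots f" and r: "r \<in> complex_roots f"
    and p: "p \<in> polys_over \<rat>" and alg: "algebraic_int (poly p t)"
  shows "algebraic_int (poly p r)"
proof -
  obtain P where P: "lead_coeff P = 1" "\<forall>i. coeff P i \<in> \<int>" "poly P (poly p t) = 0"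
    using alg by (auto elim: algebraic_int.cases)
  have "P \<in> polys_over \<int>" using P(2) by (simp add: polys_over_def)
  hence "pcompose P p \<in> polys_over \<rat>"
    by (intro polys_over_pcompose complex_subring_Rats polys_over_Rats p)
  hence "poly (pcompose P p) r = 0"
    using irreducible_over_rat_conjugate[OF irr t r, of "pcompose P p"] P(3) by (simp add: poly_pcompose)
  thus ?thesis using P by (intro algebraic_int.intros[of P]) (auto simp: poly_pcompose)
qed

lemma algebraic_int_norm:
  assumes "irreducible_over_rat f" "t \<in> complex_roots f" "p \<in> polys_over \<rat>" "algebraic_int (poly p t)"
  shows "algebraic_int (\<Prod>r\<in>complex_roots f. poly p r)"
  using complex_subring_prod[OF complex_subring_algebraic_int, of "complex_roots f" "poly p"]
    algebraic_int_conjugate[OF assms(1,2) _ assms(3,4)] by auto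

lemma poly_deriv_at_root:
  assumes "irreducible_over_rat f" "lead_coeff f = 1" "r \<in> complex_roots f"
  shows "poly (map_poly of_int (pderiv f)) r = (\<Prod>s\<in>complex_roots f - {r}. r - s)"
proof -
  note R = complex_roots_product[OF assms(1,2)]
  have "poly (map_poly of_int (pderiv f)) r =
      (\<Sum>s\<in>complex_roots f. poly (\<Prod>u\<in>complex_roots f - {s}. [:- u, 1:]) r)"
    unfolding of_int_hom.map_poly_pderiv R(2) pderiv_prod by (simp add: poly_sum pderiv_pCons)
  also have "\<dots> = (\<Sum>s\<in>complex_roots f. if s = r then \<Prod>u\<in>complex_roots f - {r}. r - u else 0)"
  proof (rule sum.cong[OF refl])
    fix s assume "s \<in> complex_roots f"
    show "poly (\<Prod>u\<in>complex_roots f - {s}. [:- u, 1:]) r =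
        (if s = r then \<Prod>u\<in>complex_roots f - {r}. r - u else 0)"
      using assms(3) R(1) by (auto simp: poly_prod intro!: prod_zero)
  qed
  also have "\<dots> = (\<Prod>u\<in>complex_roots f - {r}. r - u)" using assms(3) R(1) by simp
  finally show ?thesis .
qed

text \<open>Euler: the polynomial \<open>\<Sum>\<^sub>r x\<^sub>r f(X) / (X - r)\<close>, where \<open>x\<^sub>r\<close> runs through the conjugates of \<open>x\<close>, has
  coefficients that are algebraic integers, and rational ones since it equals \<open>p f'\<close> modulo \<open>f\<close>
  for \<open>x = p(t)\<close>; at \<open>t\<close> it takes the value \<open>f'(t) x\<close>.\<close>

lemma different_mult_integral:
  assumes irr: "irreducible_over_rat f" and lc: "lead_coeff f = 1" and t: "t \<in> complex_roots f"
    and x: "x \<in> adjoin_ring \<rat> t" and alg: "algebraic_int x"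
  shows "poly (map_poly of_int (pderiv f)) t * x \<in> adjoin_ring \<int> t"
proof -
  let ?R = "complex_roots f" and ?F = "map_poly of_int f :: complex poly"
  let ?D = "map_poly of_int (pderiv f) :: complex poly"
  note R = complex_roots_product[OF irr lc]
  note AI = complex_subring_algebraic_int
  obtain p where p: "p \<in> polys_over \<rat>" "x = poly p t" using x by (rule adjoin_ringE)
  have deg: "degree f > 0" using degree_root_pos[OF lc t] .
  define H where "H = (\<Sum>r\<in>?R. smult (poly p r) (\<Prod>s\<in>?R - {r}. [:- s, 1:]))"
  have pD: "p * ?D \<in> polys_over \<rat>" by (intro polys_over_closed[OF complex_subring_Rats] p polys_over_Rats) simp
  have FQ: "?F \<in> polys_over \<rat>" by (intro polys_over_Rats) simp
  have F1: "lead_coeff ?F = 1" "degree ?F > 0" using lc deg by simp_all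
  obtain q g where qg: "g \<in> polys_over \<rat>" "p * ?D = ?F * q + g" "degree g < degree ?F"
    by (rule monic_division[OF complex_subring_Rats FQ F1 pD])
  have Hr: "poly H r = poly p r * poly ?D r" if r: "r \<in> ?R" for r
  proof -
    have "poly H r = (\<Sum>s\<in>?R. if s = r then poly p r * (\<Prod>u\<in>?R - {r}. r - u) else 0)"
      unfolding H_def poly_sum
    proof (rule sum.cong[OF refl])
      fix s assume "s \<in> ?R"
      show "poly (smult (poly p s) (\<Prod>u\<in>?R - {s}. [:- u, 1:])) r =
          (if s = r then poly p r * (\<Prod>u\<in>?R - {r}. r - u) else 0)"
        using r R(1) by (auto simp: poly_prod intro!: prod_zero)
    qed
    also have "\<dots> = poly p r * (\<Prod>u\<in>?R - {r}. r - u)" using r R(1) by simp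
    finally show ?thesis unfolding poly_deriv_at_root[OF irr lc r] .
  qed
  have gr: "poly g r = poly p r * poly ?D r" if r: "r \<in> ?R" for r
  proof -
    have "poly (p * ?D) r = poly (?F * q + g) r" unfolding qg(2) ..
    thus ?thesis using r unfolding complex_roots_def by simp
  qed
  have "degree H \<le> degree f - 1"
    unfolding H_def
  proof (rule degree_sum_le[OF R(1)])
    fix r assume r: "r \<in> ?R"
    have "degree (\<Prod>s\<in>?R - {r}. [:- s, 1:]) = card (?R - {r})"
      by (subst degree_prod_sum_eq) auto
    also have "\<dots> = degree f - 1" using r R by simp
    finally show "degree (smult (poly p r) (\<Prod>s\<in>?R - {r}. [:- s, 1:])) \<le> degree f - 1"
      using degree_smult_le le_trans by metis
  qed
  hence "degree H < card ?R" using R(3) deg by simp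
  moreover have "degree g < card ?R" using qg(3) R(3) by simp
  \<comment> \<open>Both have degree below the number of roots and take the same values
    there.\<close>
  ultimately have "H = g" using Hr gr by (intro poly_eqI_degree[of ?R]) auto
  have "H \<in> polys_over {x. algebraic_int x}"
    unfolding H_def
  proof (intro complex_subring_polys_over_sum[OF AI] polys_over_closed(10)[OF AI] complex_subring_polys_over_prod[OF AI])
    fix r assume r: "r \<in> ?R"
    show "poly p r \<in> {x. algebraic_int x}"
      using algebraic_int_conjugate[OF irr t r p(1)] alg p(2) by simp
    fix s assume "s \<in> ?R - {r}"
    thus "[:- s, 1:] \<in> polys_over {x. algebraic_int x}"
      using algebraic_int_root_monic[OF lc] polys_over_closed(1)[OF AI] by (simp add: polys_over_pCons)
  qed
  hence "H \<in> polys_over \<int>"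
    using qg(1) rational_algebraic_int_is_int unfolding \<open>H = g\<close> polys_over_def by blast
  thus ?thesis using adjoin_ringI[of H \<int> t] Hr[OF t] p(2) by (simp add: mult.commute)
qed

section \<open>The family \<open>x\<^sup>4 + 4 k x\<^sup>3 + 27 k\<^sup>4 + 1\<close>\<close>

lemma map_poly_quartic:
  "map_poly of_int [:d, 0, 0, a, 1:] = [:of_int d, 0, 0, of_int a, 1 :: 'a :: {ring_1, ring_char_0}:]"
  by (rule poly_eqI) (simp add: coeff_map_poly coeff_pCons split: nat.split)

lemma complex_roots_quartic:
  "t \<in> complex_roots [:d, 0, 0, a, 1:] \<longleftrightarrow> t ^ 4 + of_int a * t ^ 3 + of_int d = 0"
  unfolding complex_roots_def map_poly_quartic
  by (simp add: power3_eq_cube power4_eq_xxxx algebra_simps)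

text \<open>For even \<open>k\<close> all coefficients of f(X - 1) below the leading one are even;
  \<open>h\<close> collects minus their halves.\<close>

lemma family_shifted_power:
  fixes t :: complex and k c d :: int
  assumes d: "d = 27 * k ^ 4 + 1" and k: "k = 2 * c"
    and t: "t ^ 4 + of_int (4 * k) * t ^ 3 + of_int d = 0"
  obtains h where "h \<in> polys_over \<int>" "(t + 1) ^ 4 = 2 * poly h t"
proof -
  define u where "u = t + 1"
  define h where "h = [:of_int (- 1 + 4 * c - 216 * c ^ 4), of_int (- 12 * c + 2) , of_int (12 * c - 3), of_int (2 - 4 * c) :: complex:]"
  \<comment> \<open>The same value written as a polynomial in \<open>t\<close> instead of u = t +
    1.\<close>
  define e where "e = pcompose h [:1, 1:]"
  have "[:1, 1 :: complex:] \<in> polys_over \<int>" "h \<in> polys_over \<int>"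
    unfolding h_def by (simp_all add: polys_over_pCons polys_over_closed(1)[OF complex_subring_Ints])
  hence e: "e \<in> polys_over \<int>" unfolding e_def by (intro polys_over_pcompose complex_subring_Ints)
  have T: "t = u - 1" unfolding u_def by simp
  have id: "u ^ 4 - 2 * ((- 1 + 4 * C - 216 * C ^ 4) + (- 12 * C + 2) * u + (12 * C - 3) * u\<^sup>2 + (2 - 4 * C) * u ^ 3)
      = (u - 1) ^ 4 + 8 * C * (u - 1) ^ 3 + (432 * C ^ 4 + 1)" for C u :: complex
    by (simp add: power2_eq_square power3_eq_cube power4_eq_xxxx ring_distribs mult_ac)
  have "(u - 1) ^ 4 + 8 * of_int c * (u - 1) ^ 3 + (432 * of_int c ^ 4 + 1) = 0"
    using t unfolding T d k by (simp add: power_mult_distrib)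
  hence "u ^ 4 = 2 * ((- 1 + 4 * of_int c - 216 * of_int c ^ 4) + (- 12 * of_int c + 2) * u
       + (12 * of_int c - 3) * u\<^sup>2 + (2 - 4 * of_int c) * u ^ 3)"
    unfolding id[symmetric] by simp
  also have "\<dots> = 2 * poly h u"
    unfolding h_def by (simp add: power2_eq_square power3_eq_cube algebra_simps)
  also have "poly h u = poly e t" unfolding e_def u_def by (simp add: poly_pcompose add.commute)
  finally show thesis using that[OF e] unfolding u_def by blast
qed


lemma monic_value_algebraic_int:
  fixes p :: "complex poly"
  assumes "lead_coeff p = 1" "\<And>z. poly p z = 0 \<Longrightarrow> algebraic_int z" "algebraic_int x"
  shows "algebraic_int (poly p x)"
proof -
  have "p = (\<Prod>z | poly p z = 0. [:- z, 1:] ^ order z p)"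
    using complex_poly_decompose[of p] assms(1) by simp
  hence "poly p x = poly (\<Prod>z | poly p z = 0. [:- z, 1:] ^ order z p) x" by simp
  also have "\<dots> = (\<Prod>z | poly p z = 0. (x - z) ^ order z p)" by (simp add: poly_prod poly_power)
  also have "\<dots> \<in> {x. algebraic_int x}"
    by (rule complex_subring_prod[OF complex_subring_algebraic_int]) (use assms in auto)
  finally show ?thesis by simp
qed

text \<open>An Eisenstein argument at 2: the fourth power of \<open>t + 1\<close> is divisible by 2.\<close>

lemma family_factor_value_even:
  fixes k c d :: int and w :: "rat poly"
  assumes d: "d = 27 * k ^ 4 + 1" and k: "k = 2 * c"
    and w: "lead_coeff w = 1" "degree w > 0" "w dvd [:of_int d, 0, 0, of_int (4 * k), 1:]"
  obtains n where "poly w (- 1) = of_int n" "even n"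
proof -
  interpret h: map_poly_inj_idom_hom "of_rat :: rat \<Rightarrow> complex" ..
  let ?f = "[:d, 0, 0, 4 * k, 1:]" and ?W = "map_poly of_rat w :: complex poly"
  obtain v where v: "[:of_int d, 0, 0, of_int (4 * k), 1:] = w * v" using w(3) by blast
  have "(map_poly of_int ?f :: complex poly) = map_poly of_rat [:of_int d, 0, 0, of_int (4 * k), 1 :: rat:]"
    unfolding map_poly_quartic[symmetric] of_rat_of_int_poly ..
  hence F: "map_poly of_int ?f = ?W * map_poly of_rat v" unfolding v h.hom_mult .
  have root: "z \<in> complex_roots ?f" if "poly ?W z = 0" for z
    using that unfolding complex_roots_def F by simp
  have alg: "algebraic_int z" if "poly ?W z = 0" for z
    using algebraic_int_root_monic[OF _ root[OF that]] by simp
  have W: "lead_coeff ?W = 1" "degree ?W > 0" using w by (simp_all add: coeff_map_poly)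
  have "\<not> constant (poly ?W)" using W(2) by (simp add: constant_degree)
  then obtain z where z: "poly ?W z = 0" using fundamental_theorem_of_algebra by blast
  \<comment> \<open>One root suffices: w(-1) = -(z + 1) V(-1), and the fourth power of z + 1
    contributes a factor 2. So n^4 / 2 is a rational algebraic integer and \<open>n\<close> is
    even.\<close>
  then obtain V where V: "?W = [:- z, 1:] * V" by (metis dvdE poly_eq_0_iff_dvd)
  have "lead_coeff V = 1" using W(1) unfolding V by (simp only: lead_coeff_mult) simp
  hence Vm: "algebraic_int (poly V (- 1))"
    using alg by (intro monic_value_algebraic_int) (auto simp: V)
  have "of_rat (poly w (- 1)) = poly ?W (- 1)" by (simp flip: of_rat_hom.poly_map_poly)
  hence val: "of_rat (poly w (- 1)) = - (z + 1) * poly V (- 1)" unfolding V by (simp add: algebra_simps)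
  have "algebraic_int (- (z + 1) * poly V (- 1))"
    using alg[OF z] by (intro algebraic_int_closed Vm) auto
  hence "of_rat (poly w (- 1)) \<in> (\<int> :: complex set)"
    unfolding val[symmetric] by (rule rational_algebraic_int_is_int) simp
  then obtain n where n: "of_rat (poly w (- 1)) = complex_of_int n" by (elim Ints_cases)
  hence wn: "poly w (- 1) = of_int n" by (metis of_rat_eq_iff of_rat_of_int_eq)
  have "z ^ 4 + of_int (4 * k) * z ^ 3 + of_int d = 0"
    using root[OF z] unfolding complex_roots_quartic .
  then obtain g where g: "g \<in> polys_over \<int>" "(z + 1) ^ 4 = 2 * poly g z"
    using family_shifted_power[OF d k] by blast
  have "algebraic_int (poly g z)"
    using poly_in_subring[OF complex_subring_algebraic_int polys_over_algebraic_int[OF g(1)]] alg[OF z] by blast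
  hence A: "algebraic_int (poly g z * poly V (- 1) ^ 4)" using Vm by auto
  have "complex_of_int (n ^ 4) = (- (z + 1) * poly V (- 1)) ^ 4" using val n by simp
  also have "(- x * y) ^ 4 = x ^ 4 * y ^ 4" for x y :: complex by (simp add: power_mult_distrib)
  also have "(z + 1) ^ 4 * poly V (- 1) ^ 4 = 2 * (poly g z * poly V (- 1) ^ 4)" using g(2) by simp
  finally have eq: "complex_of_int (n ^ 4) = 2 * (poly g z * poly V (- 1) ^ 4)" .
  hence "poly g z * poly V (- 1) ^ 4 = of_int (n ^ 4) / 2" by simp
  moreover have "(of_int (n ^ 4) / 2 :: complex) \<in> \<rat>" by simp
  ultimately have "poly g z * poly V (- 1) ^ 4 \<in> \<rat>" by (simp only:)
  hence "poly g z * poly V (- 1) ^ 4 \<in> \<int>" by (rule rational_algebraic_int_is_int[OF A])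
  then obtain m where "poly g z * poly V (- 1) ^ 4 = of_int m" by (elim Ints_cases)
  hence "complex_of_int (n ^ 4) = of_int (2 * m)" using eq by simp
  hence "n ^ 4 = 2 * m" by (simp only: of_int_eq_iff)
  hence "even (n ^ 4)" by simp
  hence "even n" by simp
  thus ?thesis using that wn by blast
qed

text \<open>Two monic factors of positive degree would both be even at -1, so 4 would divide f(-1) =
  2 (1 - 4 c + 216 c^4), twice an odd number.\<close>

lemma family_irreducible:
  fixes k c d :: int
  assumes d: "d = 27 * k ^ 4 + 1" and k: "k = 2 * c"
  shows "irreducible_over_rat [:d, 0, 0, 4 * k, 1:]"
  unfolding map_poly_quartic
proof (rule Factorial_Ring.irreducibleI)
  let ?F = "[:of_int d, 0, 0, of_int (4 * k), 1 :: rat:]"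
  show "?F \<noteq> 0" "\<not> ?F dvd 1" by (simp_all add: poly_dvd_1)
  fix u v assume uv: "?F = u * v"
  show "u dvd 1 \<or> v dvd 1"
  proof (rule ccontr)
    assume "\<not> (u dvd 1 \<or> v dvd 1)"
    moreover have nz: "u \<noteq> 0" "v \<noteq> 0" using uv by auto
    ultimately have deg: "degree u > 0" "degree v > 0" by (auto simp: is_unit_iff_degree)
    have lc: "lead_coeff u * lead_coeff v = 1" using arg_cong[OF uv, of lead_coeff] by (simp add: lead_coeff_mult)
    define a b where "a = smult (inverse (lead_coeff u)) u" and "b = smult (inverse (lead_coeff v)) v"
    have ab: "?F = a * b" unfolding uv a_def b_def
      using lc by (simp add: mult.commute flip: inverse_mult_distrib)
    have m: "lead_coeff a = 1" "lead_coeff b = 1" "degree a > 0" "degree b > 0"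
      using nz deg unfolding a_def b_def by simp_all
    obtain n where n: "poly a (- 1) = of_int n" "even n"
      using family_factor_value_even[OF d k m(1,3)] ab by (metis dvd_triv_left)
    obtain l where l: "poly b (- 1) = of_int l" "even l"
      using family_factor_value_even[OF d k m(2,4)] ab by (metis dvd_triv_right)
    have "poly ?F (- 1) = of_int (n * l)" unfolding ab using n(1) l(1) by simp
    moreover have "poly ?F (- 1) = of_int (1 - 4 * k + d)" by simp
    ultimately have "1 - 4 * k + d = n * l" by (simp only: of_int_eq_iff)
    moreover obtain n' l' where "n = 2 * n'" "l = 2 * l'" using n(2) l(2) by (elim evenE)
    ultimately have "2 * (1 - 4 * c + 216 * c ^ 4) = 2 * (2 * (n' * l'))"
      unfolding d k by (simp add: power_mult_distrib)
    hence "2 * (n' * l') = 2 * (108 * c ^ 4 - 2 * c) + 1" by simp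
    thus False by (rule even_neq_odd)
  qed
qed

text \<open>The norms of t and t + 1 are f(0) and f(-1); the sign (-1)^4 is trivial.\<close>

lemma family_roots_product:
  fixes k c d :: int
  assumes d: "d = 27 * k ^ 4 + 1" and k: "k = 2 * c"
  defines "R \<equiv> complex_roots [:d, 0, 0, 4 * k, 1:]"
  shows "(\<Prod>r\<in>R. r) = of_int d" "(\<Prod>r\<in>R. r + 1) = of_int (1 - 4 * k + d)"
    "card R = 4" "finite R"
proof -
  note P = complex_roots_product[OF family_irreducible[OF d k]]
  show fin: "finite R" and card: "card R = 4" unfolding R_def using P(1,3) by simp_all
  have F: "[:of_int d, 0, 0, of_int (4 * k), 1:] = (\<Prod>r\<in>R. [:- r, 1:])"
    unfolding R_def using P(2) map_poly_quartic[of d "4 * k"] by simp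
  have eval: "poly [:of_int d, 0, 0, of_int (4 * k), 1:] x = (\<Prod>r\<in>R. r - x)" for x
  proof -
    have "poly [:of_int d, 0, 0, of_int (4 * k), 1:] x = (\<Prod>r\<in>R. (- 1) * (r - x))"
      unfolding F by (simp add: poly_prod)
    also have "\<dots> = (\<Prod>r\<in>R. r - x)" unfolding prod.distrib using card by simp
    finally show ?thesis .
  qed
  show "(\<Prod>r\<in>R. r) = of_int d" using eval[of 0] by simp
  show "(\<Prod>r\<in>R. r + 1) = of_int (1 - 4 * k + d)" using eval[of "- 1", symmetric] by (simp add: algebra_simps)
qed

text \<open>With u = t + 1 write 2 y = c0 + c1 u + c2 u^2 + c3 u^3. As u^4 is twice an integral
  element, multiplying y by u^3, u^2, u and 1 in turn isolates ci u^3 / 2 up to integral terms,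
  provided the earlier coefficients are already known to be even. So all ci are even.\<close>

lemma family_divide_2:
  fixes k c d :: int
  assumes d: "d = 27 * k ^ 4 + 1" and k: "k = 2 * c" and t: "t \<in> complex_roots [:d, 0, 0, 4 * k, 1:]"
    and y: "algebraic_int y" and y2: "2 * y \<in> adjoin_ring \<int> t"
  shows "y \<in> adjoin_ring \<int> t"
proof -
  let ?f = "[:d, 0, 0, 4 * k, 1:]"
  note irr = family_irreducible[OF d k]
  note A = complex_subringD[OF complex_subring_adjoin_ring[OF complex_subring_Ints, of t]]
  note I = complex_subringD[OF complex_subring_algebraic_int, simplified]
  have alg: "algebraic_int t" using algebraic_int_root_monic[OF _ t] by simp
  have tA: "t \<in> adjoin_ring \<int> t" by (rule adjoin_ring_generator[OF complex_subring_Ints])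
  define u where "u = t + 1"
  have u: "u \<in> adjoin_ring \<int> t" "algebraic_int u" unfolding u_def using tA alg A(2,4) by auto
  obtain g where g: "g \<in> polys_over \<int>" "u ^ 4 = 2 * poly g t"
    using family_shifted_power[OF d k] t unfolding complex_roots_quartic u_def by blast
  define s where "s = poly g t"
  have s: "algebraic_int s" unfolding s_def
    using poly_in_subring[OF complex_subring_algebraic_int polys_over_algebraic_int[OF g(1)]] alg by blast
  have u4: "u ^ 4 = 2 * s" using g(2) unfolding s_def .
  define M where "M = 1 - 4 * c + 216 * c ^ 4"
  text \<open>The norm of \<open>u\<close> is exactly divisible by 2, so an odd multiple of \<open>u\<^sup>3 / 2\<close> is not integral.\<close>
  have even: "even n" if n: "algebraic_int (of_int n * u ^ 3 / 2)" for n
  proof -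
    let ?p = "smult (of_int n / 2) ([:1, 1:] ^ 3) :: complex poly"
    have "[:1, 1 :: complex:] \<in> polys_over \<rat>"
      by (simp add: polys_over_pCons polys_over_closed(1)[OF complex_subring_Rats])
    hence p: "?p \<in> polys_over \<rat>" unfolding power3_eq_cube
      by (intro polys_over_closed(9,10)[OF complex_subring_Rats]) auto
    have pv: "poly ?p r = of_int n / 2 * (r + 1) ^ 3" for r by (simp add: poly_power add.commute)
    have "algebraic_int (poly ?p t)" using n unfolding pv u_def by simp
    hence "algebraic_int (\<Prod>r\<in>complex_roots ?f. of_int n / 2 * (r + 1) ^ 3)"
      using algebraic_int_norm[OF irr t p] unfolding pv by simp
    \<comment> \<open>With the norm 2 M of \<open>u\<close>, this is n^4 (2 M)^3 / 16 = n^4 M^3 / 2,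
      where M is odd.\<close>
    also have "(\<Prod>r\<in>complex_roots ?f. of_int n / 2 * (r + 1) ^ 3) =
        (of_int n / 2) ^ 4 * (of_int (1 - 4 * k + d)) ^ 3"
      unfolding prod.distrib prod_power_distrib[symmetric] family_roots_product(2)[OF d k]
      using family_roots_product(3)[OF d k] by simp
    also have "1 - 4 * k + d = 2 * M"
      unfolding M_def d k by (simp add: power_mult_distrib)
    also have "(of_int n / 2) ^ 4 * (of_int (2 * M)) ^ 3 = (of_int (n ^ 4 * M ^ 3) / 2 :: complex)"
      by (simp add: power_divide power_mult_distrib)
    finally have "of_int (n ^ 4 * M ^ 3) / 2 \<in> (\<int> :: complex set)"
      by (rule rational_algebraic_int_is_int) simp
    then obtain m where "of_int (n ^ 4 * M ^ 3) / 2 = complex_of_int m"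
      by (elim Ints_cases)
    hence "complex_of_int (n ^ 4 * M ^ 3) = of_int (2 * m)" by (simp add: field_simps)
    hence "n ^ 4 * M ^ 3 = 2 * m" by (simp only: of_int_eq_iff)
    hence "even (n ^ 4 * M ^ 3)" by simp
    moreover have "odd M" unfolding M_def by simp
    ultimately show ?thesis by simp
  qed
  have F: "map_poly of_int ?f \<in> polys_over \<int>" by (rule polys_over_of_int)
  have F': "lead_coeff (map_poly of_int ?f :: complex poly) = 1"
    "degree (map_poly of_int ?f :: complex poly) > 0" "poly (map_poly of_int ?f) t = 0"
    using t by (simp_all add: complex_roots_def)
  obtain r where r: "r \<in> polys_over \<int>" "degree r < degree (map_poly of_int ?f :: complex poly)" "2 * y = poly r t"
    by (rule adjoin_ring_reduced[OF complex_subring_Ints F F' y2])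
  have "degree r < 4" using r(2) by simp
  have "\<forall>i. \<exists>n. coeff r i = of_int n" using r(1) by (auto simp: polys_over_def elim: Ints_cases)
  then obtain e where e: "\<And>i. coeff r i = of_int (e i)" by metis
  have "poly r t = (\<Sum>i<4. coeff r i * t ^ i)"
    unfolding poly_altdef
    using \<open>degree r < 4\<close> by (intro sum.mono_neutral_left) (auto simp: coeff_eq_0)
  hence ry: "2 * y = of_int (e 0) + of_int (e 1) * t + of_int (e 2) * t\<^sup>2 + of_int (e 3) * t ^ 3"
    using r(3) e by (simp add: numeral_eq_Suc)
  \<comment> \<open>The coefficients after the substitution t = u - 1.\<close>
  define c0 c1 c2 c3 where "c0 = e 0 - e 1 + e 2 - e 3" and "c1 = e 1 - 2 * e 2 + 3 * e 3"
    and "c2 = e 2 - 3 * e 3" and "c3 = e 3"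
  have ty: "t = u - 1" unfolding u_def by simp
  have y': "2 * y = of_int c0 + of_int c1 * u + of_int c2 * u\<^sup>2 + of_int c3 * u ^ 3"
    unfolding ry ty c0_def c1_def c2_def c3_def
    by (simp add: power2_eq_square power3_eq_cube algebra_simps)
  have u3: "u ^ 5 = 2 * s * u" "u ^ 6 = 2 * s * u\<^sup>2"
    using u4 by (simp_all add: numeral_eq_Suc mult_ac)
  have "of_int c0 * u ^ 3 / 2 = y * u ^ 3 - (of_int c1 * s + of_int c2 * (s * u) + of_int c3 * (s * u\<^sup>2))"
  proof -
    have "2 * (y * u ^ 3) = (2 * y) * u ^ 3" by simp
    also have "\<dots> = of_int c0 * u ^ 3 + of_int c1 * u ^ 4 + of_int c2 * u ^ 5 + of_int c3 * u ^ 6"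
      unfolding y' by (simp add: numeral_eq_Suc algebra_simps)
    finally show ?thesis unfolding u3 u4 by (simp add: field_simps)
  qed
  moreover have "algebraic_int \<dots>" using y u(2) s by (intro I(4,5,6,7)) auto
  ultimately obtain b0 where b0: "c0 = 2 * b0" using even[of c0] by (metis evenE)
  have "of_int c1 * u ^ 3 / 2 = y * u\<^sup>2 - (of_int b0 * u\<^sup>2 + of_int c2 * s + of_int c3 * (s * u))"
  proof -
    have "2 * (y * u\<^sup>2) = (2 * y) * u\<^sup>2" by simp
    also have "\<dots> = of_int c0 * u\<^sup>2 + of_int c1 * u ^ 3 + of_int c2 * u ^ 4 + of_int c3 * u ^ 5"
      unfolding y' by (simp add: numeral_eq_Suc algebra_simps)
    finally show ?thesis unfolding u3 u4 b0 by (simp add: field_simps)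
  qed
  moreover have "algebraic_int \<dots>" using y u(2) s by (intro I(4,5,6,7)) auto
  ultimately obtain b1 where b1: "c1 = 2 * b1" using even[of c1] by (metis evenE)
  have "of_int c2 * u ^ 3 / 2 = y * u - (of_int b0 * u + of_int b1 * u\<^sup>2 + of_int c3 * s)"
  proof -
    have "2 * (y * u) = (2 * y) * u" by simp
    also have "\<dots> = of_int c0 * u + of_int c1 * u\<^sup>2 + of_int c2 * u ^ 3 + of_int c3 * u ^ 4"
      unfolding y' by (simp add: numeral_eq_Suc algebra_simps)
    finally show ?thesis unfolding u4 b0 b1 by (simp add: field_simps)
  qed
  moreover have "algebraic_int \<dots>" using y u(2) s by (intro I(4,5,6,7)) auto
  ultimately obtain b2 where b2: "c2 = 2 * b2" using even[of c2] by (metis evenE)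
  have "of_int c3 * u ^ 3 / 2 = (2 * y - (of_int c0 + of_int c1 * u + of_int c2 * u\<^sup>2)) / 2"
    unfolding y' by simp
  also have "\<dots> = y - (of_int b0 + of_int b1 * u + of_int b2 * u\<^sup>2)"
    unfolding b0 b1 b2 by (simp add: diff_divide_distrib add_divide_distrib)
  finally have "of_int c3 * u ^ 3 / 2 = y - (of_int b0 + of_int b1 * u + of_int b2 * u\<^sup>2)" .
  moreover have "algebraic_int \<dots>" using y u(2) s by (intro I(4,5,6,7)) auto
  ultimately obtain b3 where b3: "c3 = 2 * b3" using even[of c3] by (metis evenE)
  have "2 * y = 2 * (of_int b0 + of_int b1 * u + of_int b2 * u\<^sup>2 + of_int b3 * u ^ 3)"
    unfolding y' b0 b1 b2 b3 by (simp add: ring_distribs)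
  hence "y = of_int b0 + of_int b1 * u + of_int b2 * u\<^sup>2 + of_int b3 * u ^ 3"
    by (simp only: mult_cancel_left) simp
  also have "\<dots> \<in> adjoin_ring \<int> t"
    using adjoin_ring_base[OF complex_subring_Ints Ints_of_int] by (intro A(4,6,7) u(1))
  finally show ?thesis .
qed

text \<open>Subtracting an element of Z[t] from \<open>y\<close> leaves \<open>z\<close> with t z =
  n an integer. Taking norms, \<open>d\<close> divides n^4, hence n because \<open>d\<close> is
  squarefree, and then n / t lies in Z[t].\<close>

lemma family_divide_root:
  fixes k c d :: int
  assumes d: "d = 27 * k ^ 4 + 1" and k: "k = 2 * c" and sqf: "squarefree d"
    and t: "t \<in> complex_roots [:d, 0, 0, 4 * k, 1:]"
    and y: "algebraic_int y" and ty: "t * y \<in> adjoin_ring \<int> t"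
  shows "y \<in> adjoin_ring \<int> t"
proof -
  let ?f = "[:d, 0, 0, 4 * k, 1:]"
  note irr = family_irreducible[OF d k]
  note A = complex_subringD[OF complex_subring_adjoin_ring[OF complex_subring_Ints, of t]]
  have alg: "algebraic_int t" using algebraic_int_root_monic[OF _ t] by simp
  have d0: "complex_of_int d \<noteq> 0" using sqf by auto
  obtain p where p: "p \<in> polys_over \<int>" "t * y = poly p t" using ty by (rule adjoin_ringE)
  obtain a q where pq: "p = pCons a q" by (cases p)
  have aq: "a \<in> \<int>" "q \<in> polys_over \<int>" using p(1) unfolding pq by (simp_all add: polys_over_pCons)
  obtain n where n: "a = of_int n" using aq(1) by (elim Ints_cases)
  define z where "z = y - poly q t"
  have q: "poly q t \<in> adjoin_ring \<int> t" using adjoin_ringI[OF aq(2)] .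
  have "algebraic_int (poly q t)"
    using poly_in_subring[OF complex_subring_algebraic_int polys_over_algebraic_int[OF aq(2)]] alg by blast
  hence z: "algebraic_int z" unfolding z_def using y by auto
  have tz: "t * z = of_int n" using p(2) unfolding pq z_def n by (simp add: algebra_simps)
  \<comment> \<open>From r (r^3 + 4 k r^2) = -d, the value of \<open>g\<close> at each root r is n /
    r.\<close>
  define g where "g = smult (- of_int n / of_int d) [:0, 0, of_int (4 * k), 1 :: complex:]"
  have g: "g \<in> polys_over \<rat>" unfolding g_def
    by (intro polys_over_closed(10)[OF complex_subring_Rats])
      (auto simp: polys_over_pCons polys_over_closed(1)[OF complex_subring_Rats])
  have gr: "r * poly g r = of_int n" "r \<noteq> 0" if "r \<in> complex_roots ?f" for r
  proof -
    have "r ^ 4 + of_int (4 * k) * r ^ 3 = - of_int d"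
      using that unfolding complex_roots_quartic by (simp add: eq_neg_iff_add_eq_0)
    moreover have "r * poly (smult C [:0, 0, B, 1:]) r = C * (r ^ 4 + B * r ^ 3)" for B C
      by (simp add: power3_eq_cube power4_eq_xxxx algebra_simps)
    hence "r * poly g r = (- of_int n / of_int d) * (r ^ 4 + of_int (4 * k) * r ^ 3)"
      unfolding g_def .
    ultimately show "r * poly g r = of_int n" using d0 by simp
    show "r \<noteq> 0" using that d0 unfolding complex_roots_quartic by auto
  qed
  have "t * z = t * poly g t" using tz gr(1)[OF t] by simp
  hence zg: "z = poly g t" using gr(2)[OF t] by simp
  have "algebraic_int (\<Prod>r\<in>complex_roots ?f. poly g r)"
    using algebraic_int_norm[OF irr t g] z unfolding zg by simp
  moreover have "of_int d * (\<Prod>r\<in>complex_roots ?f. poly g r) = of_int (n ^ 4)"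
  proof -
    have "of_int d * (\<Prod>r\<in>complex_roots ?f. poly g r) = (\<Prod>r\<in>complex_roots ?f. r * poly g r)"
      unfolding prod.distrib family_roots_product(1)[OF d k] ..
    also have "\<dots> = (\<Prod>r\<in>complex_roots ?f. of_int n)" by (rule prod.cong[OF refl gr(1)])
    also have "\<dots> = of_int (n ^ 4)" using family_roots_product(3)[OF d k] by simp
    finally show ?thesis .
  qed
  hence N: "(\<Prod>r\<in>complex_roots ?f. poly g r) = of_int (n ^ 4) / of_int d"
    using d0 by (simp add: field_simps)
  ultimately have "of_int (n ^ 4) / of_int d \<in> (\<int> :: complex set)"
    by (intro rational_algebraic_int_is_int) (simp_all only:, simp)
  then obtain m where "of_int (n ^ 4) / of_int d = complex_of_int m" by (elim Ints_cases)
  hence "complex_of_int (n ^ 4) = of_int (d * m)" using d0 by (simp add: field_simps)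
  hence "n ^ 4 = d * m" by (simp only: of_int_eq_iff)
  hence "d dvd n ^ 4" by simp
  hence "d dvd n" by (rule squarefree_dvd_power_imp_dvd[OF sqf])
  then obtain l where l: "n = d * l" by blast
  have "g \<in> polys_over \<int>" unfolding g_def l using d0
    by (intro polys_over_closed(10)[OF complex_subring_Ints])
      (auto simp: polys_over_pCons polys_over_closed(1)[OF complex_subring_Ints])
  hence "z \<in> adjoin_ring \<int> t" unfolding zg by (rule adjoin_ringI)
  hence "z + poly q t \<in> adjoin_ring \<int> t" using q A(4) by blast
  thus ?thesis unfolding z_def by simp
qed

text \<open>The two division lemmas ask only that the quotient be an algebraic integer; membership
  of \<open>x\<close> in Q(t) enters through the different alone.\<close>

lemma family_maximal:
  fixes k c d :: int
  assumes d: "d = 27 * k ^ 4 + 1" and k: "k = 2 * c" and sqf: "squarefree d"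
    and t: "t \<in> complex_roots [:d, 0, 0, 4 * k, 1:]"
    and x: "x \<in> adjoin_ring \<rat> t" "algebraic_int x"
  shows "x \<in> adjoin_ring \<int> t"
proof -
  let ?f = "[:d, 0, 0, 4 * k, 1:]"
  note A = complex_subringD[OF complex_subring_adjoin_ring[OF complex_subring_Ints, of t]]
  have alg: "algebraic_int t" using algebraic_int_root_monic[OF _ t] by simp
  have tA: "t \<in> adjoin_ring \<int> t" by (rule adjoin_ring_generator[OF complex_subring_Ints])
  have IA: "of_int n \<in> adjoin_ring \<int> t" for n by (rule adjoin_ring_base[OF complex_subring_Ints]) simp
  let ?K = "of_int k :: complex"
  have "map_poly of_int (pderiv ?f) = pderiv [:of_int d, 0, 0, of_int (4 * k), 1 :: complex:]"
    unfolding of_int_hom.map_poly_pderiv map_poly_quartic ..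
  hence "poly (map_poly of_int (pderiv ?f)) t = 4 * t\<^sup>2 * (t + 3 * ?K)"
    by (simp add: pderiv_pCons power2_eq_square algebra_simps)
  hence D: "4 * t\<^sup>2 * (t + 3 * ?K) * x \<in> adjoin_ring \<int> t"
    using different_mult_integral[OF family_irreducible[OF d k] _ t x] by simp
  text \<open>Since \<open>f(- 3 k) = 1\<close>, the factor \<open>t + 3 k\<close> of \<open>f'(t)\<close> is a unit.\<close>
  define q where "q = t ^ 3 + ?K * t\<^sup>2 - 3 * ?K\<^sup>2 * t + 9 * ?K ^ 3"
  have "q = t ^ 3 + of_int k * t\<^sup>2 - of_int (3 * k\<^sup>2) * t + of_int (9 * k ^ 3)"
    unfolding q_def by simp
  also have "\<dots> \<in> adjoin_ring \<int> t" by (intro A(4,5,6,7) IA tA)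
  finally have q: "q \<in> adjoin_ring \<int> t" .
  have "(t + 3 * K) * (t ^ 3 + K * t\<^sup>2 - 3 * K\<^sup>2 * t + 9 * K ^ 3) = t ^ 4 + 4 * K * t ^ 3 + 27 * K ^ 4"
    for K by (simp add: power2_eq_square power3_eq_cube power4_eq_xxxx ring_distribs mult_ac)
  hence "(t + 3 * ?K) * q = t ^ 4 + 4 * ?K * t ^ 3 + 27 * ?K ^ 4" unfolding q_def .
  also have "\<dots> = - 1" using t unfolding complex_roots_quartic d by (simp add: eq_neg_iff_add_eq_0 add.assoc)
  finally have unit: "(t + 3 * ?K) * q = - 1" .
  have "4 * t\<^sup>2 * (t + 3 * ?K) * x * q = ((t + 3 * ?K) * q) * (4 * t\<^sup>2 * x)" by (simp add: mult_ac)
  hence "4 * t\<^sup>2 * x = - (4 * t\<^sup>2 * (t + 3 * ?K) * x * q)" unfolding unit by (simp only: mult_minus1 minus_minus)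
  also have "\<dots> \<in> adjoin_ring \<int> t" by (intro A(3,6) D q)
  finally have 4: "2 * (2 * (t\<^sup>2 * x)) \<in> adjoin_ring \<int> t" by (simp add: mult_ac)
  have tx: "algebraic_int (t\<^sup>2 * x)" using alg x(2) by auto
  have "algebraic_int (of_int 2 * (t\<^sup>2 * x))" by (intro algebraic_int_closed algebraic_int_of_int tx)
  hence "2 * (t\<^sup>2 * x) \<in> adjoin_ring \<int> t" using family_divide_2[OF d k t _ 4] by simp
  hence "t\<^sup>2 * x \<in> adjoin_ring \<int> t" by (rule family_divide_2[OF d k t tx])
  hence "t * (t * x) \<in> adjoin_ring \<int> t" by (simp add: power2_eq_square mult_ac)
  hence "t * x \<in> adjoin_ring \<int> t"
    by (rule family_divide_root[OF d k sqf t algebraic_int_closed(3)[OF alg x(2)]])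
  thus ?thesis by (rule family_divide_root[OF d k sqf t x(2)])
qed

theorem theorem1p3:
  fixes a d :: int and f :: "int poly"
  assumes "a * d \<noteq> 0"
    and "f = Polynomial.monom 1 4 + Polynomial.monom a 3 + [:d:]"
  shows "monogenic f \<and> Gal f \<cong> alt_group 4 \<longleftrightarrow>
    (\<exists>k::int. k \<noteq> 0 \<and> a = 4 * k \<and> d = 27 * k ^ 4 + 1 \<and> squarefree d)"
proof
  have f: "f = [:d, 0, 0, a, 1:]"
    unfolding assms(2) by (simp add: monom_altdef numeral_eq_Suc)
  have deg: "degree f = 4" and lc: "lead_coeff f = 1" unfolding f by simp_all
  {
    assume *: "monogenic f \<and> Gal f \<cong> alt_group 4"
    hence irr: "irreducible_over_rat f" unfolding monogenic_def by blast
    have "d \<noteq> 0" using assms(1) by auto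
    then obtain s where s: "256 * d - 27 * a ^ 4 = s\<^sup>2"
      using quartic_Gal_alt_group_imp_square[OF assms(2) irr] * by blast
    show "\<exists>k::int. k \<noteq> 0 \<and> a = 4 * k \<and> d = 27 * k ^ 4 + 1 \<and> squarefree d"
    proof (rule quartic_square_discriminant[OF _ s assms(1)])
      fix m r :: int
      assume m: "m > 1" and dvd: "m\<^sup>2 dvd r ^ 4 + a * r ^ 3 + d" "m dvd r\<^sup>2 * (4 * r + 3 * a)"
      have "poly f r = r ^ 4 + a * r ^ 3 + d"
        unfolding f by (simp add: power3_eq_cube power4_eq_xxxx algebra_simps)
      moreover have "poly (pderiv f) r = r\<^sup>2 * (4 * r + 3 * a)"
        unfolding f by (simp add: pderiv_pCons power2_eq_square algebra_simps)
      ultimately show False using monogenic_no_double_root[of f m r] * deg m dvd by simp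
    qed
  }
  assume "\<exists>k::int. k \<noteq> 0 \<and> a = 4 * k \<and> d = 27 * k ^ 4 + 1 \<and> squarefree d"
  then obtain k where k: "k \<noteq> 0" "a = 4 * k" "d = 27 * k ^ 4 + 1" "squarefree d" by blast
  have "even k"
  proof (rule ccontr)
    assume "odd k"
    then obtain q where "k ^ 4 = 8 * q + 1" by (rule odd_power4)
    hence "d = 2\<^sup>2 * (54 * q + 7)" unfolding k(3) by simp
    hence "2\<^sup>2 dvd d" by simp
    hence "(2 :: int) dvd 1" using k(4) squarefreeD by blast
    thus False by simp
  qed
  then obtain c where c: "k = 2 * c" by blast
  have f': "f = [:d, 0, 0, 4 * k, 1:]" unfolding f k(2) ..
  have irr: "irreducible_over_rat f" unfolding f' by (rule family_irreducible[OF k(3) c])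
  have "monogenic f"
    unfolding monogenic_def
    using lc irr integral_basis_powers_iff[OF irr lc] family_maximal[OF k(3) c k(4)] unfolding f' by blast
  moreover have "Gal f \<cong> alt_group 4"
  proof -
    obtain t :: "nat \<Rightarrow> complex" where t: "bij_betw t {1..4} (complex_roots f)"
      "[:of_int d, 0, 0, of_int a, 1:] = [:- t 1, 1:] * [:- t 2, 1:] * [:- t 3, 1:] * [:- t 4, 1:]"
      using quartic_roots_enumeration[OF assms(2) irr] by metis
    have "(vandermonde4 t)\<^sup>2 = (of_int d)\<^sup>2 * (256 * of_int d - 27 * (of_int a) ^ 4)"
      by (rule vandermonde4_square[OF t(2)])
    \<comment> \<open>For a = 4 k and d = 27 k^4 + 1 the factor 256 d - 27 a^4 is 256.\<close>
    also have "\<dots> = (16 * of_int d)\<^sup>2"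
      unfolding k(2,3) by (simp add: power_mult_distrib power2_eq_square algebra_simps)
    finally have "vandermonde4 t = 16 * of_int d \<or> vandermonde4 t = - (16 * of_int d)"
      by (simp only: power2_eq_iff)
    moreover have "16 * complex_of_int d \<in> \<rat>" by simp
    ultimately have V: "vandermonde4 t \<in> \<rat>" by (metis Rats_minus_iff)
    have odd: "odd d" unfolding k(3) c by simp
    have tL: "t i \<in> splitting_field f" if "i \<in> {1..4}" for i
      using bij_betw_apply[OF t(1) that] complex_roots_subset_splitting_field by blast
    show ?thesis
      using resolvent_irreducible[OF k(3,1,4) odd] 
        quartic_resolvent_roots[OF t(2) algebraic_fieldD(1)[OF algebraic_field_splitting_field[OF lc]] tL]
      by (intro Gal_alt_group_4[OF lc irr deg t(1) V, of "[:- ((4 * k)\<^sup>2 * d), - 4 * d, 0, 1:]"])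
        (simp_all add: k(2))
  qed
  ultimately show "monogenic f \<and> Gal f \<cong> alt_group 4" ..
qed

end
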